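(* Let $\rho:\Gamma\to\mathrm{U}(n)$ be irreducible, let $\mu_1,\mu_2\in\mathcal{H}^{0,1}(X,\mathrm{End}\,E_\rho)$, and let $\varphi_1,\varphi_2$ be their Eichler–Shimura periods. Then (with $\varphi^*(\gamma):=\varphi(\gamma)^*$) $$\omega_G(\varphi_1,\varphi_2^* )=\sqrt{-1}\,\langle\mu_1,\mu_2\rangle\qquad\text{and}\qquad \omega_G(\varphi_1,\varphi_2)=0,$$ where $\omega_G$ is the Goldman pairing for the representation $\sigma=\rho$.
   Context: $X\cong\Gamma\backslash\mathbb{H}$ is compact of genus $g>1$, $\Gamma$ cocompact Fuchsian, base point $z_0\in\mathbb{H}$, $E_\rho=\Gamma\backslash(\mathbb{H}\times\mathbb{C}^n)$. $\mathcal{H}^{0,1}(X,\mathrm{End}\,E_\rho)$ = antiholomorphic matrix functions $\mu$ on $\mathbb{H}$ with $\mu(\gamma z)\overline{\gamma'(z)}=\rho(\gamma)\mu(z)\rho(\gamma)^{-1}$. Hodge inner product: $\langle\mu,\nu\rangle=\sqrt{-1}\iint_F\mathrm{tr}(\mu(z)\nu(z)^* )\,dz\wedge d\bar z$, $F$ a fundamental domain of $\Gamma$. Eichler–Shimura periods: $\varphi(\gamma)=\int_{z_0}^{\gamma z_0}\mu(z)\,d\bar z$; $\varphi$ and $\varphi^*$ are 1-cocycles: $\chi(\gamma_1\gamma_2)=\chi(\gamma_1)+\sigma(\gamma_1)\chi(\gamma_2)\sigma(\gamma_1)^{-1}$. Let $a_k,b_k$ ($k=1,\dots,g$) be standard generators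 of $\Gamma$ with $\prod_{k=1}^g[a_k,b_k]=1$, $[a,b]=aba^{-1}b^{-1}$, $R_k=\prod_{i=1}^k[a_i,b_i]$, $R_0=1$, and dual generators $\alpha_k=R_{k-1}b_k^{-1}R_k^{-1}$, $\beta_k=R_ka_k^{-1}R_{k-1}^{-1}$. For a representation $\sigma:\Gamma\to\mathrm{GL}(n,\mathbb{C})$ and 1-cocycles $\chi_1,\chi_2$ with values in $\mathfrak{gl}(n,\mathbb{C})$ (twisted by $\mathrm{Ad}\,\sigma$), the Goldman form is $$\omega_G(\chi_1,\chi_2)=\sum_{k=1}^g\mathrm{tr}\big(\chi_1(\alpha_k)\,\sigma(R_{k-1})\chi_2(a_k)\sigma(R_{k-1})^{-1}\big)-\mathrm{tr}\big(\chi_1(\beta_k)\,\sigma(R_k)\chi_2(b_k)\sigma(R_k)^{-1}\big),$$ which depends only on the cohomology classes and equals the cup product pairing (with $\mathrm{tr}$) evaluated on the fundamental class. *)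

theory Defs
  imports "HOL-Complex_Analysis.Complex_Analysis" "HOL-Algebra.Generated_Groups"
begin

definition upper_half_plane :: "complex set" where
  "upper_half_plane = {z. 0 < Im z}"

definition real_moebius :: "(complex \<Rightarrow> complex) \<Rightarrow> bool" where
  "real_moebius f \<longleftrightarrow> (\<exists>a b c d :: real. a * d - b * c = 1 \<and>
      (\<forall>z. f z = (of_real a * z + of_real b) / (of_real c * z + of_real d)))"

definition fuchsian_action :: "('g, 'm) monoid_scheme \<Rightarrow> ('g \<Rightarrow> complex \<Rightarrow> complex) \<Rightarrow> bool" where
  "fuchsian_action G act \<longleftrightarrow> group G \<and>
     (\<forall>\<gamma>\<in>carrier G. real_moebius (act \<gamma>)) \<and>
     (\<forall>\<gamma>\<in>carrier G. \<forall>\<delta>\<in>carrier G. \<forall>z\<in>upper_half_plane.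
         act (\<gamma> \<otimes>\<^bsub>G\<^esub> \<delta>) z = act \<gamma> (act \<delta> z)) \<and>
     (\<forall>\<gamma>\<in>carrier G. (\<forall>z\<in>upper_half_plane. act \<gamma> z = z) \<longrightarrow> \<gamma> = \<one>\<^bsub>G\<^esub>)"

definition fundamental_domain ::
  "('g, 'm) monoid_scheme \<Rightarrow> ('g \<Rightarrow> complex \<Rightarrow> complex) \<Rightarrow> complex set \<Rightarrow> bool" where
  "fundamental_domain G act F \<longleftrightarrow> F \<subseteq> upper_half_plane \<and> F \<in> sets lebesgue \<and>
     (\<Union>\<gamma>\<in>carrier G. act \<gamma> ` F) = upper_half_plane \<and>
     (\<forall>\<gamma>\<in>carrier G. \<forall>\<delta>\<in>carrier G. \<gamma> \<noteq> \<delta> \<longrightarrow>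
         (act \<gamma> ` F \<inter> act \<delta> ` F) \<in> null_sets lebesgue)"

primrec comm_prod :: "('g, 'm) monoid_scheme \<Rightarrow> (nat \<Rightarrow> 'g) \<Rightarrow> (nat \<Rightarrow> 'g) \<Rightarrow> nat \<Rightarrow> 'g" where
  "comm_prod G a b 0 = \<one>\<^bsub>G\<^esub>"
| "comm_prod G a b (Suc k) = comm_prod G a b k \<otimes>\<^bsub>G\<^esub>
      (a (Suc k) \<otimes>\<^bsub>G\<^esub> b (Suc k) \<otimes>\<^bsub>G\<^esub> inv\<^bsub>G\<^esub> (a (Suc k)) \<otimes>\<^bsub>G\<^esub> inv\<^bsub>G\<^esub> (b (Suc k)))"

definition surface_letter :: "('g, 'm) monoid_scheme \<Rightarrow> (nat \<Rightarrow> 'g) \<Rightarrow> (nat \<Rightarrow> 'g) \<Rightarrow> nat \<Rightarrow> 'g" where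
  "surface_letter G a b j = (let k = j div 4 + 1 in
     if j mod 4 = 0 then a k else if j mod 4 = 1 then b k
     else if j mod 4 = 2 then inv\<^bsub>G\<^esub> (a k) else inv\<^bsub>G\<^esub> (b k))"

primrec surface_prefix :: "('g, 'm) monoid_scheme \<Rightarrow> (nat \<Rightarrow> 'g) \<Rightarrow> (nat \<Rightarrow> 'g) \<Rightarrow> nat \<Rightarrow> 'g" where
  "surface_prefix G a b 0 = \<one>\<^bsub>G\<^esub>"
| "surface_prefix G a b (Suc j) = surface_prefix G a b j \<otimes>\<^bsub>G\<^esub> surface_letter G a b j"

text \<open>Edge j of the canonical polygon: given paths ca k from p to a_k p and cb k from
  p to b_k p, the edge j runs from w_j p to w_{j+1} p, where w_j is the j-th prefix.\<close>
definition polygon_edge ::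
  "('g, 'm) monoid_scheme \<Rightarrow> ('g \<Rightarrow> complex \<Rightarrow> complex) \<Rightarrow> (nat \<Rightarrow> 'g) \<Rightarrow> (nat \<Rightarrow> 'g) \<Rightarrow>
   (nat \<Rightarrow> real \<Rightarrow> complex) \<Rightarrow> (nat \<Rightarrow> real \<Rightarrow> complex) \<Rightarrow> nat \<Rightarrow> real \<Rightarrow> complex" where
  "polygon_edge G act a b ca cb j = (let k = j div 4 + 1 in
     if j mod 4 = 0 then act (surface_prefix G a b j) \<circ> ca k
     else if j mod 4 = 1 then act (surface_prefix G a b j) \<circ> cb k
     else if j mod 4 = 2 then act (surface_prefix G a b (Suc j)) \<circ> reversepath (ca k)
     else act (surface_prefix G a b (Suc j)) \<circ> reversepath (cb k))"

primrec polygon_edges ::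
  "('g, 'm) monoid_scheme \<Rightarrow> ('g \<Rightarrow> complex \<Rightarrow> complex) \<Rightarrow> (nat \<Rightarrow> 'g) \<Rightarrow> (nat \<Rightarrow> 'g) \<Rightarrow>
   (nat \<Rightarrow> real \<Rightarrow> complex) \<Rightarrow> (nat \<Rightarrow> real \<Rightarrow> complex) \<Rightarrow> nat \<Rightarrow> nat \<Rightarrow> real \<Rightarrow> complex" where
  "polygon_edges G act a b ca cb 0 j = polygon_edge G act a b ca cb j"
| "polygon_edges G act a b ca cb (Suc m) j =
     polygon_edge G act a b ca cb j +++ polygon_edges G act a b ca cb m (Suc j)"

text \<open>a_1,b_1,...,a_g,b_g are standard generators: they lie in the group, generate it,
  satisfy prod [a_k,b_k] = 1, and there is a canonical fundamental 4g-gon: a simple closed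
  piecewise smooth curve in H, positively oriented (winding number 1 around its inside),
  with consecutive vertices p, a_1 p, a_1 b_1 p, a_1 b_1 a_1^{-1} p, ..., whose sides are paired
  as above, and whose closed inside is a fundamental domain (translates cover H, the
  translates of the open inside by nontrivial elements are disjoint from it).\<close>
definition standard_generators ::
  "('g, 'm) monoid_scheme \<Rightarrow> ('g \<Rightarrow> complex \<Rightarrow> complex) \<Rightarrow> nat \<Rightarrow> (nat \<Rightarrow> 'g) \<Rightarrow> (nat \<Rightarrow> 'g) \<Rightarrow> bool" where
  "standard_generators G act g a b \<longleftrightarrow>
     (\<forall>k\<in>{1..g}. a k \<in> carrier G \<and> b k \<in> carrier G) \<and>
     generate G (a ` {1..g} \<union> b ` {1..g}) = carrier G \<and>
     comm_prod G a b g = \<one>\<^bsub>G\<^esub> \<and>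
     (\<exists>p ca cb. p \<in> upper_half_plane \<and>
        (\<forall>k\<in>{1..g}. valid_path (ca k) \<and> pathstart (ca k) = p \<and> pathfinish (ca k) = act (a k) p \<and>
                     valid_path (cb k) \<and> pathstart (cb k) = p \<and> pathfinish (cb k) = act (b k) p) \<and>
        (let c = polygon_edges G act a b ca cb (4 * g - 1) 0;
             U = {z. z \<notin> path_image c \<and> winding_number c z = 1} in
           simple_path c \<and> valid_path c \<and> path_image c \<subseteq> upper_half_plane \<and>
           (\<forall>z. z \<notin> path_image c \<longrightarrow> winding_number c z = 0 \<or> winding_number c z = 1) \<and>
           U \<noteq> {} \<and>
           (\<Union>\<gamma>\<in>carrier G. act \<gamma> ` (U \<union> path_image c)) = upper_half_plane \<and>
           (\<forall>\<gamma>\<in>carrier G. \<gamma> \<noteq> \<one>\<^bsub>G\<^esub> \<longrightarrow> act \<gamma> ` U \<inter> U = {})))"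

definition mat_adj :: "complex^'n^'n \<Rightarrow> complex^'n^'n" where
  "mat_adj A = (\<chi> i j. cnj (A $ j $ i))"

definition scal_mat :: "complex \<Rightarrow> complex^'n^'n \<Rightarrow> complex^'n^'n" where
  "scal_mat c A = (\<chi> i j. c * A $ i $ j)"

definition unitary_mat :: "complex^'n^'n \<Rightarrow> bool" where
  "unitary_mat A \<longleftrightarrow> A ** mat_adj A = mat 1 \<and> mat_adj A ** A = mat 1"

definition complex_subspace :: "(complex^'n) set \<Rightarrow> bool" where
  "complex_subspace V \<longleftrightarrow> 0 \<in> V \<and> (\<forall>x\<in>V. \<forall>y\<in>V. x + y \<in> V) \<and>
     (\<forall>c. \<forall>x\<in>V. (\<chi> i. c * x $ i) \<in> V)"

definition mat_representation :: "('g, 'm) monoid_scheme \<Rightarrow> ('g \<Rightarrow> complex^'n^'n) \<Rightarrow> bool" where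
  "mat_representation G \<sigma> \<longleftrightarrow> (\<forall>\<gamma>\<in>carrier G. invertible (\<sigma> \<gamma>)) \<and>
     (\<forall>\<gamma>\<in>carrier G. \<forall>\<delta>\<in>carrier G. \<sigma> (\<gamma> \<otimes>\<^bsub>G\<^esub> \<delta>) = \<sigma> \<gamma> ** \<sigma> \<delta>)"

definition unitary_representation :: "('g, 'm) monoid_scheme \<Rightarrow> ('g \<Rightarrow> complex^'n^'n) \<Rightarrow> bool" where
  "unitary_representation G \<rho> \<longleftrightarrow> mat_representation G \<rho> \<and> (\<forall>\<gamma>\<in>carrier G. unitary_mat (\<rho> \<gamma>))"

definition irreducible_rep :: "('g, 'm) monoid_scheme \<Rightarrow> ('g \<Rightarrow> complex^'n^'n) \<Rightarrow> bool" where
  "irreducible_rep G \<rho> \<longleftrightarrow> (\<forall>V. complex_subspace V \<and> (\<forall>\<gamma>\<in>carrier G. \<forall>v\<in>V. \<rho> \<gamma> *v v \<in> V)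
        \<longrightarrow> V = {0} \<or> V = UNIV)"

definition harmonic_01 ::
  "('g, 'm) monoid_scheme \<Rightarrow> ('g \<Rightarrow> complex \<Rightarrow> complex) \<Rightarrow> ('g \<Rightarrow> complex^'n^'n) \<Rightarrow>
   (complex \<Rightarrow> complex^'n^'n) \<Rightarrow> bool" where
  "harmonic_01 G act \<rho> \<mu> \<longleftrightarrow>
     (\<forall>i j. (\<lambda>z. cnj (\<mu> z $ i $ j)) holomorphic_on upper_half_plane) \<and>
     (\<forall>\<gamma>\<in>carrier G. \<forall>z\<in>upper_half_plane.
        scal_mat (cnj (deriv (act \<gamma>) z)) (\<mu> (act \<gamma> z)) = \<rho> \<gamma> ** \<mu> z ** matrix_inv (\<rho> \<gamma>))"

text \<open>Hodge inner product sqrt(-1) \<integral>\<integral>_F tr(\<mu> \<nu>^*) dz \<and> dz-bar, using dz \<and> dz-bar = -2i dx \<and> dy.\<close>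
definition hodge_ip :: "complex set \<Rightarrow> (complex \<Rightarrow> complex^'n^'n) \<Rightarrow> (complex \<Rightarrow> complex^'n^'n) \<Rightarrow> complex" where
  "hodge_ip F \<mu> \<nu> = \<i> * ((- 2 * \<i>) * integral F (\<lambda>z. trace (\<mu> z ** mat_adj (\<nu> z))))"

text \<open>Eichler--Shimura period \<phi>(\<gamma>) = \<integral>_{z0}^{\<gamma> z0} \<mu>(z) dz-bar (along the segment, which
  lies in H; the integral is path independent since \<mu> is antiholomorphic).\<close>
definition es_period ::
  "('g \<Rightarrow> complex \<Rightarrow> complex) \<Rightarrow> complex \<Rightarrow> (complex \<Rightarrow> complex^'n^'n) \<Rightarrow> 'g \<Rightarrow> complex^'n^'n" where
  "es_period act z0 \<mu> \<gamma> =
     (\<chi> i j. cnj (contour_integral (linepath z0 (act \<gamma> z0)) (\<lambda>z. cnj (\<mu> z $ i $ j))))"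

definition goldman_form ::
  "('g, 'm) monoid_scheme \<Rightarrow> nat \<Rightarrow> (nat \<Rightarrow> 'g) \<Rightarrow> (nat \<Rightarrow> 'g) \<Rightarrow> ('g \<Rightarrow> complex^'n^'n) \<Rightarrow>
   ('g \<Rightarrow> complex^'n^'n) \<Rightarrow> ('g \<Rightarrow> complex^'n^'n) \<Rightarrow> complex" where
  "goldman_form G g a b \<sigma> \<chi>1 \<chi>2 =
     (let R = comm_prod G a b;
          \<alpha> = (\<lambda>k. R (k - 1) \<otimes>\<^bsub>G\<^esub> inv\<^bsub>G\<^esub> (b k) \<otimes>\<^bsub>G\<^esub> inv\<^bsub>G\<^esub> (R k));
          \<beta> = (\<lambda>k. R k \<otimes>\<^bsub>G\<^esub> inv\<^bsub>G\<^esub> (a k) \<otimes>\<^bsub>G\<^esub> inv\<^bsub>G\<^esub> (R (k - 1)))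
      in (\<Sum>k=1..g.
           trace (\<chi>1 (\<alpha> k) ** (\<sigma> (R (k - 1)) ** \<chi>2 (a k) ** matrix_inv (\<sigma> (R (k - 1)))))
         - trace (\<chi>1 (\<beta> k) ** (\<sigma> (R k) ** \<chi>2 (b k) ** matrix_inv (\<sigma> (R k))))))"

end

theory Submission
  imports Defs
begin

text \<open>
  Let \<open>\<Phi>\<close> be the antiholomorphic primitive of \<open>\<mu>1\<close>. The function \<open>f = tr (\<Phi> \<mu>2*)\<close> satisfies
  \<open>f(\<gamma> z) \<gamma>'(z) = f(z) + tr (\<phi>1(\<gamma>) Ad(\<gamma>) \<mu>2*(z))\<close>, so integrating \<open>f dz\<close> around the boundary of the
  fundamental polygon and pairing the sides yields the Goldman form, while Green's formula yields
  \<open>2 i\<close> times the integral of \<open>tr (\<mu>1 \<mu>2*)\<close> over the polygon. For the pairing of \<open>\<phi>1\<close> with \<open>\<phi>2\<close>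
  the complex conjugate integrand is holomorphic and the boundary integral vanishes.

  The sides of the polygon need not be rectifiable. They are replaced by translates of segments,
  which changes the polygon into a chain with an integer-valued winding function. This function
  still sums to 1 over almost every orbit, which is all that is needed to unfold the area
  integral to an arbitrary fundamental domain. Green's formula for closed chains weighted by the
  winding number follows from Fubini's theorem applied to the Cauchy transform.
\<close>

section \<open>The Cauchy transform\<close>

text \<open>Once the sides are segments, the closed chain may cross itself and bounds no region to
  which Green's formula could be applied directly. Let B be the d-bar derivative of f, g a compactly
  supported continuous extension of B from a box, and C g (w) the area integral of g(\<zeta>) /
  (\<zeta> - w). Formally C g has d-bar derivative -pi g, so f + C g / pi is holomorphic on the box
  and integrates to zero along closed chains. What remains is the integral of C g along the chain;
  exchanging the two integrations turns it into the area integral of g against the winding function,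
  whatever the shape of the chain.

  As g is merely continuous, C g need not be differentiable. The d-bar equation is therefore used
  only in integrated form over rectangles, and holomorphy is replaced by a primitive built as in
  Morera's theorem.

  A second obstacle is the base point: periods start at \<open>z0\<close>, the polygon at its own
  vertex \<open>p\<close>. The change alters the second cocycle by a coboundary, which pairs to zero
  because the chain is closed.\<close>

lemma borel_measurable_Complex:
  assumes [measurable]: "f \<in> borel_measurable M" "g \<in> borel_measurable M"
  shows "(\<lambda>x. Complex (f x) (g x)) \<in> borel_measurable M"
  unfolding Complex_eq by measurable

lemma borel_measurable_Complex_pair [measurable]:
  "(\<lambda>p. Complex (fst p) (snd p)) \<in> borel_measurable (borel :: (real \<times> real) measure)"
  unfolding borel_prod [symmetric] by (rule borel_measurable_Complex) auto

text \<open>Passage from area integrals over \<open>complex\<close> to iterated integrals in x and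
  y. Checking boxes is enough, since they determine Lebesgue measure.\<close>

lemma distr_lborel_Complex:
  "distr (lborel :: (real \<times> real) measure) borel (\<lambda>(x, y). Complex x y) = lborel"
proof (rule lborel_eqI [symmetric])
  fix l u :: complex assume lu: "\<And>b. b \<in> Basis \<Longrightarrow> l \<bullet> b \<le> u \<bullet> b"
  have le: "Re l \<le> Re u" "Im l \<le> Im u"
    using lu[of 1] lu[of \<i>] by (auto simp: Basis_complex_def)
  have vim: "(\<lambda>p. Complex (fst p) (snd p)) -` box l u = box (Re l) (Re u) \<times> box (Im l) (Im u)"
    by (auto simp: in_box_complex_iff)
  have "emeasure (distr lborel borel (\<lambda>(x, y). Complex x y)) (box l u) =
      emeasure (lborel \<Otimes>\<^sub>M lborel) (box (Re l) (Re u) \<times> box (Im l) (Im u))"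
    by (subst emeasure_distr) (simp_all add: vim lborel_prod case_prod_unfold del: box_real)
  also have "\<dots> = ennreal (Re u - Re l) * ennreal (Im u - Im l)"
    using le by (subst lborel.emeasure_pair_measure_Times) auto
  finally show "emeasure (distr lborel borel (\<lambda>(x, y). Complex x y)) (box l u) = (\<Prod>b\<in>Basis. (u - l) \<bullet> b)"
    using le by (simp add: Basis_complex_def ennreal_mult)
qed simp

lemma integrable_inverse_sqrt:
  fixes R :: real
  shows "integrable lborel (\<lambda>x. indicator {-R..R} x * \<bar>x\<bar> powr (-1/2))"
proof (cases "R \<ge> 0")
  case True
  have 1: "(\<lambda>x. \<bar>x\<bar> powr (-1/2)) integrable_on {0..R}"
    using integrable_on_powr_from_0[of "-1/2" R] True
    by (rule_tac integrable_eq[where f="\<lambda>x. x powr (-1/2)"]) auto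
  have "(\<lambda>x. \<bar>-x\<bar> powr (-1/2)) integrable_on {-R..-0}"
    using 1 Henstock_Kurzweil_Integration.integrable_reflect_real[where f = "\<lambda>x. \<bar>x\<bar> powr (-1/2)" and a = 0 and b = R] by simp
  then have 2: "(\<lambda>x. \<bar>x\<bar> powr (-1/2)) integrable_on {-R..0}" by simp
  have "(\<lambda>x. \<bar>x\<bar> powr (-1/2)) integrable_on {-R..R}"
    by (rule Henstock_Kurzweil_Integration.integrable_combine[OF _ _ 2 1]) (use True in auto)
  then have "(\<lambda>x. \<bar>x\<bar> powr (-1/2)) absolutely_integrable_on {-R..R}"
    by (intro nonnegative_absolutely_integrable_1) auto
  then have "integrable lebesgue (\<lambda>x. indicator {-R..R} x * \<bar>x\<bar> powr (-1/2))"
    by (simp add: set_integrable_def)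
  then show ?thesis
    by (subst (asm) integrable_completion) auto
qed auto

lemma integrable_lborel_complex_iff:
  fixes f :: "complex \<Rightarrow> 'b :: {banach, second_countable_topology}"
  assumes [measurable]: "f \<in> borel_measurable borel"
  shows "integrable lborel f \<longleftrightarrow> integrable (lborel \<Otimes>\<^sub>M lborel) (\<lambda>(x, y). f (Complex x y))"
  by (subst distr_lborel_Complex [symmetric])
    (subst integrable_distr_eq, auto simp: case_prod_unfold lborel_prod)

lemma integral_lborel_complex:
  fixes f :: "complex \<Rightarrow> 'b :: {banach, second_countable_topology}"
  assumes [measurable]: "f \<in> borel_measurable borel"
  shows "integral\<^sup>L lborel f = integral\<^sup>L (lborel \<Otimes>\<^sub>M lborel) (\<lambda>(x, y). f (Complex x y))"
  by (subst distr_lborel_Complex [symmetric])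
    (subst integral_distr, auto simp: case_prod_unfold lborel_prod)

lemma indicator_norm_measurable:
  "(\<lambda>z :: complex. indicator (cball 0 R) z / norm z :: real) \<in> borel_measurable borel"
  by (intro borel_measurable_divide borel_measurable_indicator borel_closed closed_cball
      borel_measurable_norm)

text \<open>No polar coordinates: since |x| |y| \<le> x^2 + y^2, the singularity 1 / |z| is
  dominated by the product |x|^(-1/2) |y|^(-1/2), whose integral splits into two integrals in one
  variable.\<close>

lemma integrable_inverse_norm_cball:
  fixes R :: real
  shows "integrable lborel (\<lambda>z :: complex. indicator (cball 0 R) z / norm z)"
proof -
  define u where "u = (\<lambda>x :: real. indicator {-R..R} x * \<bar>x\<bar> powr (-1/2))"
  have u: "integrable lborel u" and [measurable]: "u \<in> borel_measurable borel"
    using integrable_inverse_sqrt[of R] by (auto simp: u_def)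
  have "integrable (lborel \<Otimes>\<^sub>M lborel) (\<lambda>(x, y). u x * u y)"
  proof (rule lborel_pair.Fubini_integrable)
    show "integrable lborel (\<lambda>x. LINT y|lborel. norm (case (x, y) of (x, y) \<Rightarrow> u x * u y))"
      using u by (simp add: abs_mult)
  qed (use u in auto)
  then have int: "integrable (lborel \<Otimes>\<^sub>M lborel) (\<lambda>(x, y). u x * u y)" .
  have "integrable (lborel \<Otimes>\<^sub>M lborel) (\<lambda>(x, y). indicator (cball 0 R) (Complex x y) / norm (Complex x y))"
  proof (rule Bochner_Integration.integrable_bound[OF int])
    have C: "(\<lambda>p. Complex (fst p) (snd p)) \<in> borel_measurable (lborel \<Otimes>\<^sub>M lborel)"
      using borel_measurable_Complex_pair by (simp add: lborel_prod)
    show "(\<lambda>(x, y). indicator (cball 0 R) (Complex x y) / norm (Complex x y))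
       \<in> borel_measurable (lborel \<Otimes>\<^sub>M lborel)"
      unfolding case_prod_unfold
      by (rule measurable_compose[OF C indicator_norm_measurable])
    have *: "indicator (cball 0 R) (Complex x y) / norm (Complex x y) \<le> u x * u y"
      if "x \<noteq> 0" "y \<noteq> 0" for x y
    proof (cases "Complex x y \<in> cball 0 R")
      case True
      then have xy: "\<bar>x\<bar> \<le> R" "\<bar>y\<bar> \<le> R"
        using abs_Re_le_cmod[of "Complex x y"] abs_Im_le_cmod[of "Complex x y"] by auto
      have "\<bar>x\<bar> * \<bar>y\<bar> \<le> x\<^sup>2 + y\<^sup>2"
        using sum_squares_bound[of "\<bar>x\<bar>" "\<bar>y\<bar>"] mult_nonneg_nonneg[of "\<bar>x\<bar>" "\<bar>y\<bar>"]
        unfolding power2_abs by linarith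
      then have "sqrt (\<bar>x\<bar> * \<bar>y\<bar>) \<le> norm (Complex x y)"
        by (simp add: cmod_def)
      moreover have "0 < sqrt (\<bar>x\<bar> * \<bar>y\<bar>)" using that by simp
      ultimately have "1 / norm (Complex x y) \<le> 1 / sqrt (\<bar>x\<bar> * \<bar>y\<bar>)"
        by (intro frac_le) auto
      moreover have "1 / sqrt (\<bar>x\<bar> * \<bar>y\<bar>) = \<bar>x\<bar> powr (-1/2) * \<bar>y\<bar> powr (-1/2)"
        using that by (simp add: powr_minus powr_half_sqrt real_sqrt_mult field_simps)
      moreover have "x \<in> {-R..R}" "y \<in> {-R..R}" using xy by auto
      ultimately show ?thesis using True by (simp add: u_def)
    qed (simp add: u_def)
    \<comment> \<open>On the axes the bound fails, because \<open>0 powr (-1/2)\<close> is 0 by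
      convention; they form a null set.\<close>
    have "AE z in lborel \<Otimes>\<^sub>M lborel. fst z \<noteq> (0::real) \<and> snd z \<noteq> (0::real)"
    proof (rule lborel_pair.AE_pair_measure)
      show "{z \<in> space (lborel \<Otimes>\<^sub>M lborel). fst z \<noteq> (0::real) \<and> snd z \<noteq> (0::real)}
          \<in> sets (lborel \<Otimes>\<^sub>M lborel)"
        by measurable
    qed (use AE_lborel_singleton[of "0::real"] in auto)
    then show "AE z in lborel \<Otimes>\<^sub>M lborel.
      norm (case z of (x, y) \<Rightarrow> indicator (cball 0 R) (Complex x y) / norm (Complex x y))
        \<le> norm (case z of (x, y) \<Rightarrow> u x * u y)"
      by eventually_elim (use * in \<open>auto simp: u_def\<close>)
  qed
  then show ?thesis
    by (subst integrable_lborel_complex_iff[OF indicator_norm_measurable])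
qed

text \<open>Up to the factor -pi, convolution with the fundamental solution of the d-bar operator.
  Only its continuity and its integrals along curves are used below.\<close>

definition cauchy_transform :: "(complex \<Rightarrow> complex) \<Rightarrow> complex \<Rightarrow> complex" where
  "cauchy_transform g w = (LINT \<zeta>|lborel. g \<zeta> / (\<zeta> - w))"

text \<open>The integral of dw / (\<zeta> - w) along the arc \<open>e\<close> with velocity
  \<open>e'\<close>; around a closed curve it is -2 pi i times the winding number. Where the
  integrand is not integrable, which can only happen on a continuously differentiable arc itself,
  the value defaults to 0.\<close>

definition cauchy_kernel_integral ::
  "real \<Rightarrow> real \<Rightarrow> (real \<Rightarrow> complex) \<Rightarrow> (real \<Rightarrow> complex) \<Rightarrow> complex \<Rightarrow> complex" where
  "cauchy_kernel_integral u v e e' \<zeta> = (LINT t:{u..v}|lborel. e' t / (\<zeta> - e t))"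

locale compactly_supported =
  fixes g :: "complex \<Rightarrow> complex" and R :: real
  assumes cont: "continuous_on UNIV g" and supp: "\<And>z. norm z > R \<Longrightarrow> g z = 0"
begin

lemma measurable_g [measurable]: "g \<in> borel_measurable borel"
  by (rule borel_measurable_continuous_onI [OF cont])

lemma bounded_g: obtains B where "\<And>z. norm (g z) \<le> B"
proof -
  have "compact (g ` cball 0 R)"
    by (intro compact_continuous_image continuous_on_subset[OF cont]) auto
  then obtain B where B: "\<And>z. z \<in> cball 0 R \<Longrightarrow> norm (g z) \<le> B"
    by (metis bounded_iff compact_imp_bounded imageI)
  have "norm (g z) \<le> max B 0" for z
    using B[of z] supp[of z] by (cases "norm z \<le> R") auto
  then show ?thesis using that[of "max B 0"] by auto
qed

lemma norm_shifted_le: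
  assumes "\<And>z. norm (g z) \<le> B" "norm w \<le> M"
  shows "norm (g (w + \<eta>) / \<eta>) \<le> B * (indicator (cball 0 (R + M)) \<eta> / norm \<eta>)"
proof (cases "norm (w + \<eta>) > R")
  case True
  have "0 \<le> B" using assms(1)[of 0] norm_ge_zero order_trans by blast
  then show ?thesis using supp[OF True] by simp
next
  case False
  have "norm \<eta> \<le> norm (w + \<eta>) + norm w"
    by (metis add_diff_cancel_left' norm_triangle_ineq4)
  then show ?thesis
    using False assms by (auto simp: norm_divide intro!: divide_right_mono)
qed

lemma integrable_shifted: "integrable lborel (\<lambda>\<eta>. g (w + \<eta>) / \<eta>)"
proof -
  obtain B where B: "\<And>z. norm (g z) \<le> B" using bounded_g by metis
  show ?thesis
  proof (rule Bochner_Integration.integrable_bound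
        [OF integrable_mult_right[OF integrable_inverse_norm_cball[of "R + norm w"], of B]])
    show "AE \<eta> in lborel. norm (g (w + \<eta>) / \<eta>)
        \<le> norm (B * (indicator (cball 0 (R + norm w)) \<eta> / norm \<eta>))"
      unfolding real_norm_def
      by (intro AE_I2 order_trans[OF norm_shifted_le[OF B order_refl] abs_ge_self])
  qed auto
qed

text \<open>Translation by \<open>w\<close> moves the singularity to the origin, so that one
  integrable function dominates for all \<open>w\<close> in a bounded set.\<close>

lemma
  shows integrable_cauchy: "integrable lborel (\<lambda>\<zeta>. g \<zeta> / (\<zeta> - w))"
    and cauchy_transform_shift: "cauchy_transform g w = (LINT \<eta>|lborel. g (w + \<eta>) / \<eta>)"
    and norm_cauchy_shift:
      "(LINT \<zeta>|lborel. norm (g \<zeta> / (\<zeta> - w))) = (LINT \<eta>|lborel. norm (g (w + \<eta>) / \<eta>))"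
proof -
  show "integrable lborel (\<lambda>\<zeta>. g \<zeta> / (\<zeta> - w))"
    by (subst lborel_distr_plus[of w, symmetric], subst integrable_distr_eq)
      (use integrable_shifted[of w] in auto)
  show "cauchy_transform g w = (LINT \<eta>|lborel. g (w + \<eta>) / \<eta>)"
    unfolding cauchy_transform_def
    by (subst lborel_distr_plus[of w, symmetric], subst integral_distr) auto
  show "(LINT \<zeta>|lborel. norm (g \<zeta> / (\<zeta> - w))) = (LINT \<eta>|lborel. norm (g (w + \<eta>) / \<eta>))"
    by (subst lborel_distr_plus[of w, symmetric], subst integral_distr) auto
qed

lemma norm_cauchy_bounded:
  obtains C where "\<And>w. norm w \<le> M \<Longrightarrow> (LINT \<zeta>|lborel. norm (g \<zeta> / (\<zeta> - w))) \<le> C"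
proof -
  obtain B where B: "\<And>z. norm (g z) \<le> B" using bounded_g by metis
  have "(LINT \<zeta>|lborel. norm (g \<zeta> / (\<zeta> - w))) \<le>
      (LINT \<eta>|lborel. B * (indicator (cball 0 (R + M)) \<eta> / norm (\<eta> :: complex)))"
    if "norm w \<le> M" for w
    unfolding norm_cauchy_shift
    by (intro integral_mono integrable_norm integrable_shifted integrable_mult_right
        integrable_inverse_norm_cball norm_shifted_le[OF B that])
  then show ?thesis using that by blast
qed

text \<open>After the shift only \<open>g (w + \<eta>)\<close> depends on \<open>w\<close> while the
  singular kernel stays fixed, so dominated convergence along sequences applies.\<close>

lemma continuous_cauchy_transform: "continuous_on UNIV (cauchy_transform g)"
  unfolding continuous_on_sequentially o_def
proof (intro ballI allI impI, elim conjE)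
  fix x :: "nat \<Rightarrow> complex" and w
  assume x: "x \<longlonglongrightarrow> w"
  obtain B where B: "\<And>z. norm (g z) \<le> B" using bounded_g by metis
  obtain M where M: "\<And>n. norm (x n) \<le> M"
    using convergent_imp_Bseq[of x] x by (metis BseqE convergentI)
  show "(\<lambda>n. cauchy_transform g (x n)) \<longlonglongrightarrow> cauchy_transform g w"
    unfolding cauchy_transform_shift
  proof (rule integral_dominated_convergence
      [where w = "\<lambda>\<eta>. B * (indicator (cball 0 (R + M)) \<eta> / norm \<eta>)"])
    show "AE \<eta> in lborel. (\<lambda>n. g (x n + \<eta>) / \<eta>) \<longlonglongrightarrow> g (w + \<eta>) / \<eta>"
    proof (rule AE_I2)
      fix \<eta>
      have "(\<lambda>n. g (x n + \<eta>)) \<longlonglongrightarrow> g (w + \<eta>)"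
        using cont by (intro isCont_tendsto_compose[of _ g] tendsto_intros x)
          (auto simp: continuous_on_eq_continuous_at)
      then show "(\<lambda>n. g (x n + \<eta>) / \<eta>) \<longlonglongrightarrow> g (w + \<eta>) / \<eta>"
        unfolding divide_inverse by (rule tendsto_mult_right)
    qed
    show "AE \<eta> in lborel. norm (g (x n + \<eta>) / \<eta>) \<le> B * (indicator (cball 0 (R + M)) \<eta> / norm \<eta>)" for n
      using norm_shifted_le[OF B M[of n]] by auto
    show "integrable lborel (\<lambda>\<eta> :: complex. B * (indicator (cball 0 (R + M)) \<eta> / norm \<eta>))"
      by (rule integrable_mult_right[OF integrable_inverse_norm_cball])
  qed auto
qed

text \<open>Fubini's theorem for area against arc. It moves all dependence on the arc into the
  kernel integral, where winding numbers become visible. Continuity of \<open>e'\<close> and the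
  uniform bound on the area integrals give integrability on the product.\<close>

lemma
  fixes u v :: real and e e' :: "real \<Rightarrow> complex"
  assumes e: "continuous_on {u..v} e" and e': "continuous_on {u..v} e'"
  shows integrable_cauchy_kernel_integral:
      "integrable lborel (\<lambda>\<zeta>. g \<zeta> * cauchy_kernel_integral u v e e' \<zeta>)"
    and integral_cauchy_transform_path:
      "integral {u..v} (\<lambda>t. cauchy_transform g (e t) * e' t) =
         (LINT \<zeta>|lborel. g \<zeta> * cauchy_kernel_integral u v e e' \<zeta>)"
proof -
  \<comment> \<open>Cut off by zero, the arc and its velocity are Borel functions on the whole line.
    Off \<open>{u..v}\<close> the factor \<open>e2\<close> vanishes, so the altered kernel
    contributes nothing.\<close>
  define e1 where "e1 = (\<lambda>t. indicator {u..v} t *\<^sub>R e t)"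
  define e2 where "e2 = (\<lambda>t. indicator {u..v} t *\<^sub>R e' t)"
  have [measurable]: "e1 \<in> borel_measurable borel" "e2 \<in> borel_measurable borel"
    unfolding e1_def e2_def
    by (rule borel_measurable_continuous_on_indicator; use e e' in auto)+
  define f where "f = (\<lambda>t \<zeta>. g \<zeta> * (e2 t / (\<zeta> - e1 t)))"
  have [measurable]: "case_prod f \<in> borel_measurable (lborel \<Otimes>\<^sub>M lborel)"
    unfolding f_def by measurable
  have "bounded (e ` {u..v})" "bounded (e' ` {u..v})"
    using e e' by (auto intro!: compact_imp_bounded compact_continuous_image)
  then obtain M M' where M: "\<And>t. t \<in> {u..v} \<Longrightarrow> norm (e t) \<le> M"
    and M': "\<And>t. t \<in> {u..v} \<Longrightarrow> norm (e' t) \<le> M'"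
    unfolding bounded_iff by blast
  obtain C where C: "\<And>w. norm w \<le> M \<Longrightarrow> (LINT \<zeta>|lborel. norm (g \<zeta> / (\<zeta> - w))) \<le> C"
    using norm_cauchy_bounded[of M] by metis
  have f_eq: "f t \<zeta> = e2 t * (g \<zeta> / (\<zeta> - e1 t))" for t \<zeta> by (simp add: f_def)
  have int: "integrable (lborel \<Otimes>\<^sub>M lborel) (case_prod f)"
  proof (rule lborel_pair.Fubini_integrable)
    show "AE t in lborel. integrable lborel (\<lambda>\<zeta>. case (t, \<zeta>) of (t, \<zeta>) \<Rightarrow> f t \<zeta>)"
      unfolding f_eq prod.case by (intro AE_I2 integrable_mult_right integrable_cauchy)
    have "integrable lborel (\<lambda>t. indicator {u..v::real} t * (M' * C))"
      by (intro integrable_mult_left integrable_real_indicator) (auto simp: emeasure_lborel_Icc_eq)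
    then show "integrable lborel (\<lambda>t. LINT \<zeta>|lborel. norm (case (t, \<zeta>) of (t, \<zeta>) \<Rightarrow> f t \<zeta>))"
    proof (rule Bochner_Integration.integrable_bound)
      show "AE t in lborel. norm (LINT \<zeta>|lborel. norm (case (t, \<zeta>) of (t, \<zeta>) \<Rightarrow> f t \<zeta>))
          \<le> norm (indicator {u..v} t * (M' * C))"
      proof (intro AE_I2)
        fix t :: real
        have eq: "(LINT \<zeta>|lborel. norm (f t \<zeta>)) = norm (e2 t) * (LINT \<zeta>|lborel. norm (g \<zeta> / (\<zeta> - e1 t)))"
          unfolding f_eq norm_mult by simp
        show "norm (LINT \<zeta>|lborel. norm (case (t, \<zeta>) of (t, \<zeta>) \<Rightarrow> f t \<zeta>))
          \<le> norm (indicator {u..v} t * (M' * C))"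
        proof (cases "t \<in> {u..v}")
          case True
          have "0 \<le> M'" using M'[OF True] norm_ge_zero order_trans by blast
          have "norm (e2 t) * (LINT \<zeta>|lborel. norm (g \<zeta> / (\<zeta> - e1 t))) \<le> M' * C"
            by (intro mult_mono C) (use M M' True \<open>0 \<le> M'\<close> in \<open>auto simp: e1_def e2_def\<close>)
          then show ?thesis using True eq
            by (simp add: abs_mult[symmetric] order_trans[OF _ abs_ge_self])
        next
          case False
          then show ?thesis by (simp add: f_eq e2_def)
        qed
      qed
    qed measurable
  qed measurable
  have f_inner: "(LINT t|lborel. f t \<zeta>) = g \<zeta> * cauchy_kernel_integral u v e e' \<zeta>" for \<zeta>
  proof -
    have "(LINT t|lborel. f t \<zeta>) = g \<zeta> * (LINT t|lborel. e2 t / (\<zeta> - e1 t))"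
      unfolding f_def by (rule integral_mult_right_zero)
    also have "(LINT t|lborel. e2 t / (\<zeta> - e1 t)) = cauchy_kernel_integral u v e e' \<zeta>"
      unfolding cauchy_kernel_integral_def set_lebesgue_integral_def
      by (rule Bochner_Integration.integral_cong) (auto simp: e1_def e2_def indicator_def)
    finally show ?thesis .
  qed
  show "integrable lborel (\<lambda>\<zeta>. g \<zeta> * cauchy_kernel_integral u v e e' \<zeta>)"
    using lborel_pair.integrable_snd[OF int] by (simp add: f_inner)
  have "continuous_on {u..v} (\<lambda>t. cauchy_transform g (e t) * e' t)"
    by (intro continuous_intros e' continuous_on_compose2[OF continuous_cauchy_transform e]) auto
  then have "integral {u..v} (\<lambda>t. cauchy_transform g (e t) * e' t) =
      (LINT t:{u..v}|lborel. cauchy_transform g (e t) * e' t)"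
    by (intro set_borel_integral_eq_integral(2)[symmetric] borel_integrable_atLeastAtMost')
  also have "\<dots> = (LINT t|lborel. LINT \<zeta>|lborel. f t \<zeta>)"
    unfolding set_lebesgue_integral_def
  proof (rule Bochner_Integration.integral_cong[OF refl])
    fix t :: real
    show "indicator {u..v} t *\<^sub>R (cauchy_transform g (e t) * e' t) = (LINT \<zeta>|lborel. f t \<zeta>)"
      unfolding f_eq integral_mult_right_zero cauchy_transform_def [symmetric]
      by (simp add: e1_def e2_def indicator_def mult.commute)
  qed
  also have "\<dots> = (LINT \<zeta>|lborel. g \<zeta> * cauchy_kernel_integral u v e e' \<zeta>)"
    using lborel_pair.Fubini_integral[OF int] by (simp add: f_inner)
  finally show "integral {u..v} (\<lambda>t. cauchy_transform g (e t) * e' t) =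
         (LINT \<zeta>|lborel. g \<zeta> * cauchy_kernel_integral u v e e' \<zeta>)" .
qed

end

section \<open>Green's formula\<close>

lemma negligible_imp_AE_lborel:
  assumes "negligible S"
  shows "AE x in lborel. x \<notin> S"
  using AE_not_in[of S lebesgue] assms
  by (simp add: negligible_iff_null_sets AE_completion_iff)

section \<open>Boundary integrals over rectangles\<close>

lemma contour_integral_linepath_same_Im:
  assumes "Im z = c" "Im z' = c" "Re z = a" "Re z' = b" "a < b"
  shows "contour_integral (linepath z z') f = integral {a..b} (\<lambda>x. f (Complex x c))"
proof -
  have zz': "z = Complex a c" "z' = Complex b c"
    using assms by (auto simp: complex_eq_iff)
  have "contour_integral (linepath z z') f = (z' - z) * integral {0..1} (\<lambda>x. f (linepath z z' x))"
    by (simp add: contour_integral_integral)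
  also have "z' - z = of_real (b - a)"
    by (simp add: zz' Complex_eq algebra_simps)
  also have "integral {0..1} (\<lambda>x. f (linepath z z' x)) =
             integral {0..1} (\<lambda>x. f (Complex (linepath a b x) c))"
    by (simp add: linepath_def Complex_eq scaleR_conv_of_real algebra_simps zz')
  also have "\<dots> = integral {0..(b - a) / (b - a)} (\<lambda>x. f (Complex (a + (b - a) * x) c))"
    using \<open>a < b\<close> by (simp add: algebra_simps linepath_def)
  also have "{0..(b - a) / (b - a)} = (\<lambda>x. x / (b - a)) ` {0..b - a}"
    using \<open>a < b\<close> by simp
  also have "integral \<dots> (\<lambda>x. f (Complex (a + (b - a) * x) c)) =
             integral {a-a..b-a} (\<lambda>x. f (Complex (x + a) c)) / of_real (b - a)"
    using \<open>a < b\<close> by (subst integral_stretch_real) (auto simp: scaleR_conv_of_real add_ac)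
  also have "\<dots> = integral {a..b} (\<lambda>x. f (Complex x c)) / of_real (b - a)"
    by (subst integral_shift_real_ivl) (rule refl)
  finally show ?thesis
    using \<open>a < b\<close> by simp
qed

definition rect_integral :: "(complex \<Rightarrow> complex) \<Rightarrow> complex \<Rightarrow> complex \<Rightarrow> complex" where
  "rect_integral h a b =
     integral {Re a..Re b} (\<lambda>t. h (Complex t (Im a))) + \<i> * integral {Im a..Im b} (\<lambda>t. h (Complex (Re b) t))
     - integral {Re a..Re b} (\<lambda>t. h (Complex t (Im b))) - \<i> * integral {Im a..Im b} (\<lambda>t. h (Complex (Re a) t))"

lemma contour_integral_rectpath:
  assumes ab: "Re a < Re b" "Im a < Im b" and h: "continuous_on (path_image (rectpath a b)) h"
  shows "contour_integral (rectpath a b) h = rect_integral h a b"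
proof -
  define a2 a4 where "a2 = Complex (Re b) (Im a)" and "a4 = Complex (Re a) (Im b)"
  have rp: "rectpath a b = linepath a a2 +++ linepath a2 b +++ linepath b a4 +++ linepath a4 a"
    by (simp add: rectpath_def Let_def a2_def a4_def)
  have im: "path_image (rectpath a b) = closed_segment a a2 \<union> closed_segment a2 b \<union> closed_segment b a4 \<union> closed_segment a4 a"
    unfolding rp by (simp add: path_image_join Un_assoc)
  have int: "h contour_integrable_on linepath a a2" "h contour_integrable_on linepath a2 b"
    "h contour_integrable_on linepath b a4" "h contour_integrable_on linepath a4 a"
    by (intro contour_integrable_continuous_linepath continuous_on_subset[OF h], force simp: im)+
  have "contour_integral (rectpath a b) h = contour_integral (linepath a a2) h + contour_integral (linepath a2 b) h
      + contour_integral (linepath b a4) h + contour_integral (linepath a4 a) h"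
    unfolding rp using int by simp
  also have "contour_integral (linepath b a4) h = - contour_integral (linepath a4 b) h"
    by (rule contour_integral_reverse_linepath)
      (intro continuous_on_subset[OF h], force simp: im closed_segment_commute)
  also have "contour_integral (linepath a4 a) h = - contour_integral (linepath a a4) h"
    by (rule contour_integral_reverse_linepath)
      (intro continuous_on_subset[OF h], force simp: im closed_segment_commute)
  also have "contour_integral (linepath a4 b) h = integral {Re a..Re b} (\<lambda>x. h (Complex x (Im b)))"
    by (rule contour_integral_linepath_same_Im) (use ab in \<open>auto simp: a4_def\<close>)
  also have "contour_integral (linepath a a2) h = integral {Re a..Re b} (\<lambda>x. h (Complex x (Im a)))"
    by (rule contour_integral_linepath_same_Im) (use ab in \<open>auto simp: a2_def\<close>)
  also have "contour_integral (linepath a a4) h = \<i> * integral {Im a..Im b} (\<lambda>x. h (Complex (Re a) x))"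
    by (rule contour_integral_linepath_same_Re) (use ab in \<open>auto simp: a4_def\<close>)
  also have "contour_integral (linepath a2 b) h = \<i> * integral {Im a..Im b} (\<lambda>x. h (Complex (Re b) x))"
    by (rule contour_integral_linepath_same_Re) (use ab in \<open>auto simp: a2_def\<close>)
  finally show ?thesis by (simp add: rect_integral_def)
qed

lemma continuous_on_Complex_slice:
  assumes "continuous_on (cbox a b) h"
  shows "continuous_on (cbox (Re a, Im a) (Re b, Im b)) (\<lambda>(x, y). h (Complex x y))"
    and "y \<in> {Im a..Im b} \<Longrightarrow> continuous_on {Re a..Re b} (\<lambda>x. h (Complex x y))"
    and "x \<in> {Re a..Re b} \<Longrightarrow> continuous_on {Im a..Im b} (\<lambda>y. h (Complex x y))"
  unfolding case_prod_unfold
  by (rule continuous_on_compose2[OF assms];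
      force simp: Complex_eq in_cbox_complex_iff intro!: continuous_intros)+

text \<open>\<open>A\<close> and \<open>B\<close> are the Wirtinger derivatives: f_x = A + B and f_y
  = i (A - B). The fundamental theorem of calculus in each variable turns the boundary integral into
  the double integral of i f_x - f_y = 2 i B, in which the holomorphic part cancels.\<close>

theorem rect_integral_Green:
  fixes f A B :: "complex \<Rightarrow> complex"
  assumes ab: "Re a \<le> Re b" "Im a \<le> Im b"
    and der: "\<And>z. z \<in> cbox a b \<Longrightarrow> (f has_derivative (\<lambda>h. A z * h + B z * cnj h)) (at z)"
    and A: "continuous_on (cbox a b) A" and B: "continuous_on (cbox a b) B"
  shows "rect_integral f a b =
    2 * \<i> * integral {Re a..Re b} (\<lambda>x. integral {Im a..Im b} (\<lambda>y. B (Complex x y)))"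
proof -
  define fx where "fx = (\<lambda>z. A z + B z)"
  define fy where "fy = (\<lambda>z. \<i> * (A z - B z))"
  have cont: "continuous_on (cbox a b) fx" "continuous_on (cbox a b) fy"
    unfolding fx_def fy_def by (intro continuous_intros A B)+
  have f: "continuous_on (cbox a b) f"
    using der has_derivative_continuous continuous_at_imp_continuous_on by blast
  have in_cbox: "Complex x y \<in> cbox a b" if "x \<in> {Re a..Re b}" "y \<in> {Im a..Im b}" for x y
    using that by (auto simp: in_cbox_complex_iff)
  have dx: "((\<lambda>x. f (Complex x y)) has_vector_derivative fx (Complex x y)) (at x within {Re a..Re b})"
    if "x \<in> {Re a..Re b}" "y \<in> {Im a..Im b}" for x y
  proof -
    have C: "((\<lambda>x. Complex x y) has_vector_derivative 1) (at x within {Re a..Re b})"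
      unfolding Complex_eq by (auto intro!: derivative_eq_intros)
    have "(f has_derivative (\<lambda>h. A (Complex x y) * h + B (Complex x y) * cnj h))
        (at (Complex x y) within (\<lambda>x. Complex x y) ` {Re a..Re b})"
      by (rule has_derivative_at_withinI[OF der[OF in_cbox[OF that]]])
    from vector_derivative_diff_chain_within[OF C this] show ?thesis
      by (simp add: o_def fx_def)
  qed
  have dy: "((\<lambda>y. f (Complex x y)) has_vector_derivative fy (Complex x y)) (at y within {Im a..Im b})"
    if "x \<in> {Re a..Re b}" "y \<in> {Im a..Im b}" for x y
  proof -
    have C: "((\<lambda>y. Complex x y) has_vector_derivative \<i>) (at y within {Im a..Im b})"
      unfolding Complex_eq by (auto intro!: derivative_eq_intros)
    have "(f has_derivative (\<lambda>h. A (Complex x y) * h + B (Complex x y) * cnj h))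
        (at (Complex x y) within Complex x ` {Im a..Im b})"
      by (rule has_derivative_at_withinI[OF der[OF in_cbox[OF that]]])
    from vector_derivative_diff_chain_within[OF C this] show ?thesis
      by (simp add: o_def fy_def algebra_simps)
  qed
  let ?X = "{Re a..Re b}" and ?Y = "{Im a..Im b}"
  have fx_int: "integral ?X (\<lambda>x. fx (Complex x y)) = f (Complex (Re b) y) - f (Complex (Re a) y)"
    if "y \<in> ?Y" for y
    by (rule integral_unique, rule fundamental_theorem_of_calculus) (use ab dx that in auto)
  have fy_int: "integral ?Y (\<lambda>y. fy (Complex x y)) = f (Complex x (Im b)) - f (Complex x (Im a))"
    if "x \<in> ?X" for x
    by (rule integral_unique, rule fundamental_theorem_of_calculus) (use ab dy that in auto)
  have int_fx: "integral ?Y (\<lambda>y. f (Complex (Re b) y)) - integral ?Y (\<lambda>y. f (Complex (Re a) y)) =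
      integral ?X (\<lambda>x. integral ?Y (\<lambda>y. fx (Complex x y)))"
  proof -
    have "integral ?Y (\<lambda>y. f (Complex (Re b) y)) - integral ?Y (\<lambda>y. f (Complex (Re a) y)) =
        integral ?Y (\<lambda>y. f (Complex (Re b) y) - f (Complex (Re a) y))"
      by (rule integral_diff[symmetric];
          intro integrable_continuous_real continuous_on_Complex_slice(3)[OF f]) (use ab in auto)
    also have "\<dots> = integral ?Y (\<lambda>y. integral ?X (\<lambda>x. fx (Complex x y)))"
      by (rule integral_cong) (simp add: fx_int)
    also have "\<dots> = integral ?X (\<lambda>x. integral ?Y (\<lambda>y. fx (Complex x y)))"
      using integral_swap_continuous[of "Re a" "Im a" "Re b" "Im b" "\<lambda>x y. fx (Complex x y)"]
        continuous_on_Complex_slice(1)[OF cont(1)] by simp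
    finally show ?thesis .
  qed
  have int_fy: "integral ?X (\<lambda>x. f (Complex x (Im b))) - integral ?X (\<lambda>x. f (Complex x (Im a))) =
      integral ?X (\<lambda>x. integral ?Y (\<lambda>y. fy (Complex x y)))"
  proof -
    have "integral ?X (\<lambda>x. f (Complex x (Im b))) - integral ?X (\<lambda>x. f (Complex x (Im a))) =
        integral ?X (\<lambda>x. f (Complex x (Im b)) - f (Complex x (Im a)))"
      by (rule integral_diff[symmetric];
          intro integrable_continuous_real continuous_on_Complex_slice(2)[OF f]) (use ab in auto)
    also have "\<dots> = integral ?X (\<lambda>x. integral ?Y (\<lambda>y. fy (Complex x y)))"
      by (rule integral_cong) (simp add: fy_int)
    finally show ?thesis .
  qed
  have inner: "continuous_on ?X (\<lambda>x. integral ?Y (\<lambda>y. h (Complex x y)))"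
    if "continuous_on (cbox a b) h" for h :: "complex \<Rightarrow> complex"
    using integral_continuous_on_param[of "{Re a..Re b}" "Im a" "Im b" "\<lambda>x y. h (Complex x y)"]
      continuous_on_Complex_slice(1)[OF that] by (simp add: cbox_Pair_eq)
  have "rect_integral f a b = \<i> * (integral ?Y (\<lambda>y. f (Complex (Re b) y)) - integral ?Y (\<lambda>y. f (Complex (Re a) y)))
     - (integral ?X (\<lambda>x. f (Complex x (Im b))) - integral ?X (\<lambda>x. f (Complex x (Im a))))"
    unfolding rect_integral_def by (simp add: algebra_simps)
  also have "\<dots> = \<i> * integral ?X (\<lambda>x. integral ?Y (\<lambda>y. fx (Complex x y))) -
      integral ?X (\<lambda>x. integral ?Y (\<lambda>y. fy (Complex x y)))"
    unfolding int_fx int_fy ..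
  also have "\<dots> = integral ?X (\<lambda>x. \<i> * integral ?Y (\<lambda>y. fx (Complex x y)) - integral ?Y (\<lambda>y. fy (Complex x y)))"
    by (subst integral_diff) (auto intro!: integrable_continuous_real continuous_intros inner cont)
  also have "\<dots> = integral ?X (\<lambda>x. 2 * \<i> * integral ?Y (\<lambda>y. B (Complex x y)))"
  proof (rule integral_cong)
    fix x assume x: "x \<in> ?X"
    have "\<i> * integral ?Y (\<lambda>y. fx (Complex x y)) - integral ?Y (\<lambda>y. fy (Complex x y)) =
      integral ?Y (\<lambda>y. \<i> * fx (Complex x y) - fy (Complex x y))"
      by (subst integral_diff)
        (auto intro!: integrable_continuous_real continuous_intros continuous_on_Complex_slice(3) x cont)
    also have "\<dots> = integral ?Y (\<lambda>y. 2 * \<i> * B (Complex x y))"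
      by (rule integral_cong) (simp add: fx_def fy_def algebra_simps)
    finally show "\<i> * integral ?Y (\<lambda>y. fx (Complex x y)) - integral ?Y (\<lambda>y. fy (Complex x y)) =
      2 * \<i> * integral ?Y (\<lambda>y. B (Complex x y))" by simp
  qed
  finally show ?thesis by simp
qed

lemma cauchy_kernel_integral_eq_integral:
  assumes "continuous_on {u..v} e" "continuous_on {u..v} e'" "\<zeta> \<notin> e ` {u..v}"
  shows "cauchy_kernel_integral u v e e' \<zeta> = integral {u..v} (\<lambda>t. e' t / (\<zeta> - e t))"
  unfolding cauchy_kernel_integral_def
  by (intro set_borel_integral_eq_integral(2) borel_integrable_atLeastAtMost' continuous_intros assms)
    (use assms(3) in auto)

context compactly_supported
begin

text \<open>The integrated form of the d-bar equation, with -pi g in the place of B in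
  \<open>rect_integral_Green\<close>. After the exchange of integrals the kernel round the rectangle
  is -2 pi i times a winding number, and off the boundary that number is the indicator of the
  rectangle.\<close>

lemma rect_integral_cauchy_transform:
  assumes ab: "Re a < Re b" "Im a < Im b"
  shows "rect_integral (cauchy_transform g) a b =
    - (2 * pi * \<i>) * integral {Re a..Re b} (\<lambda>x. integral {Im a..Im b} (\<lambda>y. g (Complex x y)))"
proof -
  define K where "K = (\<lambda>\<zeta>.
      cauchy_kernel_integral (Re a) (Re b) (\<lambda>t. Complex t (Im a)) (\<lambda>_. 1) \<zeta>
    + cauchy_kernel_integral (Im a) (Im b) (\<lambda>t. Complex (Re b) t) (\<lambda>_. \<i>) \<zeta>
    - cauchy_kernel_integral (Re a) (Re b) (\<lambda>t. Complex t (Im b)) (\<lambda>_. 1) \<zeta>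
    - cauchy_kernel_integral (Im a) (Im b) (\<lambda>t. Complex (Re a) t) (\<lambda>_. \<i>) \<zeta>)"
  have contC: "continuous_on S (\<lambda>t. Complex t y)" "continuous_on S (\<lambda>t. Complex x t)" for S x y
    unfolding Complex_eq by (intro continuous_intros)+
  have "rect_integral (cauchy_transform g) a b =
      integral {Re a..Re b} (\<lambda>t. cauchy_transform g (Complex t (Im a)) * 1)
    + integral {Im a..Im b} (\<lambda>t. cauchy_transform g (Complex (Re b) t) * \<i>)
    - integral {Re a..Re b} (\<lambda>t. cauchy_transform g (Complex t (Im b)) * 1)
    - integral {Im a..Im b} (\<lambda>t. cauchy_transform g (Complex (Re a) t) * \<i>)"
    by (simp add: rect_integral_def)
  also have "\<dots> = (LINT \<zeta>|lborel. g \<zeta> * K \<zeta>)"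
    unfolding K_def
    by (subst (1 2 3 4) integral_cauchy_transform_path)
      (auto simp: contC distrib_left right_diff_distrib integrable_cauchy_kernel_integral)
  also have "\<dots> = (LINT \<zeta>|lborel. - (2 * pi * \<i>) * (indicator (cbox a b) \<zeta> *\<^sub>R g \<zeta>))"
  proof (rule integral_cong_AE)
    have K: "K \<zeta> = - (2 * pi * \<i>) * indicator (cbox a b) \<zeta>" if "\<zeta> \<notin> path_image (rectpath a b)" for \<zeta>
    proof -
      have pi: "path_image (rectpath a b) = {w. Re w \<in> {Re a, Re b} \<and> Im w \<in> {Im a..Im b}} \<union>
          {w. Im w \<in> {Im a, Im b} \<and> Re w \<in> {Re a..Re b}}"
        by (rule path_image_rectpath) (use ab in auto)
      have cont': "continuous_on (path_image (rectpath a b)) (\<lambda>w. 1 / (\<zeta> - w))"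
        by (intro continuous_intros) (use that in auto)
      have "K \<zeta> = rect_integral (\<lambda>w. 1 / (\<zeta> - w)) a b"
        unfolding K_def rect_integral_def
        by (subst (1 2 3 4) cauchy_kernel_integral_eq_integral)
          (use that ab in \<open>auto simp: contC pi integral_mult_right[symmetric]\<close>)
      also have "\<dots> = contour_integral (rectpath a b) (\<lambda>w. 1 / (\<zeta> - w))"
        by (rule contour_integral_rectpath[symmetric, OF ab cont'])
      also have "\<dots> = contour_integral (rectpath a b) (\<lambda>w. - (1 / (w - \<zeta>)))"
        by (intro arg_cong[where f = "contour_integral _"] ext) (metis minus_diff_eq minus_divide_right)
      also have "\<dots> = - (2 * pi * \<i>) * winding_number (rectpath a b) \<zeta>"
        using winding_number_valid_path[of "rectpath a b" \<zeta>] that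
        by (simp add: contour_integral_neg)
      also have "winding_number (rectpath a b) \<zeta> = indicator (cbox a b) \<zeta>"
      proof (cases "\<zeta> \<in> cbox a b")
        case True
        then have "\<zeta> \<in> box a b"
          using that ab path_image_rectpath_cbox_minus_box[of a b] by auto
        then show ?thesis using True by (simp add: winding_number_rectpath)
      next
        case False
        then show ?thesis using ab by (simp add: winding_number_rectpath_outside)
      qed
      finally show ?thesis .
    qed
    \<comment> \<open>The value of the kernel on the boundary itself is left open, since the
      boundary is a null set.\<close>
    have "negligible (path_image (rectpath a b))"
      using ab path_image_rectpath_cbox_minus_box[of a b] negligible_frontier_interval[of a b] by simp
    from negligible_imp_AE_lborel[OF this]
    show "AE \<zeta> in lborel. g \<zeta> * K \<zeta> = - (2 * pi * \<i>) * (indicator (cbox a b) \<zeta> *\<^sub>R g \<zeta>)"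
      by eventually_elim (simp add: K indicator_def)
    show "(\<lambda>\<zeta>. g \<zeta> * K \<zeta>) \<in> borel_measurable lborel"
      unfolding K_def distrib_left right_diff_distrib
      by (intro borel_measurable_add borel_measurable_diff borel_measurable_integrable
          integrable_cauchy_kernel_integral contC continuous_intros)
  qed auto
  also have "\<dots> = - (2 * pi * \<i>) * (LINT \<zeta>|lborel. indicator (cbox a b) \<zeta> *\<^sub>R g \<zeta>)"
    by (rule integral_mult_right_zero)
  also have "(LINT \<zeta>|lborel. indicator (cbox a b) \<zeta> *\<^sub>R g \<zeta>) =
      (LINT p:cbox (Re a, Im a) (Re b, Im b)|lborel. (\<lambda>(x, y). g (Complex x y)) p)"
    unfolding set_lebesgue_integral_def
    by (subst integral_lborel_complex)
      (auto simp: lborel_prod in_cbox_complex_iff cbox_Pair_eq indicator_def intro!: Bochner_Integration.integral_cong)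
  also have "\<dots> = integral (cbox (Re a, Im a) (Re b, Im b)) (\<lambda>(x, y). g (Complex x y))"
    by (intro set_borel_integral_eq_integral(2))
      (auto simp: set_integrable_def intro!: borel_integrable_compact continuous_on_Complex_slice(1)
          continuous_on_subset[OF cont])
  also have "\<dots> = integral {Re a..Re b} (\<lambda>x. integral {Im a..Im b} (\<lambda>y. g (Complex x y)))"
    using integral_prod_continuous[OF continuous_on_Complex_slice(1), of a b g] continuous_on_subset[OF cont]
    by simp
  finally show ?thesis .
qed

end

text \<open>Morera's argument. Rectangles with one corner at \<open>a\<close> suffice: for them,
  integrating from \<open>a\<close> first horizontally and then vertically agrees with the opposite
  order, and each partial derivative can be read off one of the two expressions.\<close>

theorem primitive_from_rectangles:
  fixes h :: "complex \<Rightarrow> complex"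
  assumes h: "continuous_on (cbox a b) h"
    and rect: "\<And>z. z \<in> box a b \<Longrightarrow> rect_integral h a z = 0"
  obtains P where "\<And>z. z \<in> box a b \<Longrightarrow> (P has_field_derivative h z) (at z)"
proof -
  define P where "P = (\<lambda>x y. integral {Re a..x} (\<lambda>t. h (Complex t (Im a)))
      + \<i> * integral {Im a..y} (\<lambda>t. h (Complex x t)))"
  have "((\<lambda>z. P (Re z) (Im z)) has_field_derivative h z) (at z)" if z: "z \<in> box a b" for z
  proof -
    have ab: "Re a < Re z" "Re z < Re b" "Im a < Im z" "Im z < Im b"
      using z by (auto simp: in_box_complex_iff)
    let ?X = "{Re a<..<Re b}" and ?Y = "{Im a<..<Im b}"
    have P_alt: "P x y = \<i> * integral {Im a..y} (\<lambda>t. h (Complex (Re a) t)) +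
        integral {Re a..x} (\<lambda>t. h (Complex t y))" if "x \<in> ?X" "y \<in> ?Y" for x y
      using rect[of "Complex x y"] that
      by (auto simp: in_box_complex_iff P_def rect_integral_def algebra_simps)
    have dx: "((\<lambda>x. P x (Im z)) has_derivative (\<lambda>t. t *\<^sub>R h z)) (at (Re z) within ?X)"
    proof -
      have "((\<lambda>x. integral {Re a..x} (\<lambda>t. h (Complex t (Im z)))) has_vector_derivative h (Complex (Re z) (Im z)))
          (at (Re z) within {Re a..Re b})"
        by (rule integral_has_vector_derivative[OF continuous_on_Complex_slice(2)[OF h]]) (use ab in auto)
      then have "((\<lambda>x. \<i> * integral {Im a..Im z} (\<lambda>t. h (Complex (Re a) t)) +
          integral {Re a..x} (\<lambda>t. h (Complex t (Im z)))) has_vector_derivative 0 + h z) (at (Re z) within ?X)"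
        by (intro has_vector_derivative_add has_vector_derivative_const)
          (auto intro: has_vector_derivative_within_subset)
      then have "((\<lambda>x. P x (Im z)) has_vector_derivative h z) (at (Re z) within ?X)"
        by (rule_tac has_vector_derivative_transform[rotated -1]) (use ab P_alt in auto)
      then show ?thesis by (simp add: has_vector_derivative_def)
    qed
    \<comment> \<open>Total differentiability follows from one partial derivative at the point and
      the other one existing nearby and being continuous there; hence the y-derivative is needed at
      all points of the box.\<close>
    have dy: "((\<lambda>y. P x y) has_derivative blinfun_scaleR_left (\<i> * h (Complex x y))) (at y within ?Y)"
      if "x \<in> ?X" "y \<in> ?Y" for x y
    proof -
      have "((\<lambda>y. integral {Im a..y} (\<lambda>t. h (Complex x t))) has_vector_derivative h (Complex x y))
          (at y within {Im a..Im b})"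
        by (rule integral_has_vector_derivative[OF continuous_on_Complex_slice(3)[OF h]]) (use that in auto)
      then have "((\<lambda>y. P x y) has_vector_derivative 0 + \<i> * h (Complex x y)) (at y within ?Y)"
        unfolding P_def
        by (intro has_vector_derivative_add has_vector_derivative_const has_vector_derivative_mult_right)
          (auto intro: has_vector_derivative_within_subset)
      then show ?thesis by (simp add: has_vector_derivative_def)
    qed
    have "((\<lambda>(x, y). P x y) has_derivative (\<lambda>(tx, ty). tx *\<^sub>R h z + blinfun_scaleR_left (\<i> * h (Complex (Re z) (Im z))) ty))
        (at (Re z, Im z) within ?X \<times> ?Y)"
    proof (rule has_derivative_partialsI[OF dx dy])
      have "continuous_on (?X \<times> ?Y) (\<lambda>(x, y). h (Complex x y))"
        by (rule continuous_on_subset[OF continuous_on_Complex_slice(1)[OF h]]) (auto simp: cbox_Pair_eq)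
      then have "continuous_on (?X \<times> ?Y) (\<lambda>p. blinfun_scaleR_left (\<i> * h (Complex (fst p) (snd p))))"
        by (intro continuous_intros bounded_linear.continuous_on[OF bounded_linear_blinfun_scaleR_left])
          (simp_all add: case_prod_unfold)
      then show "continuous (at (Re z, Im z) within ?X \<times> ?Y) (\<lambda>(x, y). blinfun_scaleR_left (\<i> * h (Complex x y)))"
        using ab by (auto simp: continuous_on_eq_continuous_within case_prod_unfold)
    qed (use ab in auto)
    then have P2: "((\<lambda>(x, y). P x y) has_derivative (\<lambda>(tx, ty). tx *\<^sub>R h z + ty *\<^sub>R (\<i> * h z)))
        (at (Re z, Im z))"
      using ab by (subst (asm) at_within_open) (auto intro: open_Times)
    have "((\<lambda>z. (Re z, Im z)) has_derivative (\<lambda>t. (Re t, Im t))) (at z)"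
      by (auto intro!: derivative_eq_intros)
    from diff_chain_at[OF this P2]
    have "((\<lambda>z. P (Re z) (Im z)) has_derivative (\<lambda>t. Re t *\<^sub>R h z + Im t *\<^sub>R (\<i> * h z))) (at z)"
      by (simp add: o_def)
    moreover have "(\<lambda>t. Re t *\<^sub>R h z + Im t *\<^sub>R (\<i> * h z)) = (*) (h z)"
      by (rule ext) (simp add: complex_eq_iff algebra_simps)
    ultimately show ?thesis by (simp add: has_field_derivative_def)
  qed
  then show ?thesis using that by blast
qed

text \<open>The Cauchy transform turns Green's formula into an identity for arcs: the boundary terms
  P are those of a primitive of a holomorphic function, so they cancel along closed chains.\<close>

theorem Green_arcs:
  fixes f A B :: "complex \<Rightarrow> complex"
  assumes ne: "box a b \<noteq> {}"
    and der: "\<And>z. z \<in> cbox a b \<Longrightarrow> (f has_derivative (\<lambda>h. A z * h + B z * cnj h)) (at z)"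
    and A: "continuous_on (cbox a b) A" and B: "continuous_on (cbox a b) B"
  obtains P g R where "compactly_supported g R" "\<And>z. z \<in> cbox a b \<Longrightarrow> g z = B z"
    "\<And>e e'. (\<And>t. t \<in> {0..1} \<Longrightarrow> (e has_vector_derivative e' t) (at t within {0..1})) \<Longrightarrow>
       continuous_on {0..1} e' \<Longrightarrow> e ` {0..1} \<subseteq> box a b \<Longrightarrow>
       integral {0..1} (\<lambda>t. f (e t) * e' t) =
         P (e 1) - P (e 0) - (LINT \<zeta>|lborel. g \<zeta> * cauchy_kernel_integral 0 1 e e' \<zeta>) / pi"
proof -
  let ?D = "cbox a b"
  have ne': "?D \<noteq> {}" using ne box_subset_cbox by blast
  \<comment> \<open>Composing \<open>B\<close> with the nearest-point projection extends it
    continuously beyond the box, and the factor \<open>1 - dist z (cp z)\<close> cuts the extension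
    off at distance 1.\<close>
  define cp where "cp = closest_point ?D"
  define g where "g = (\<lambda>z. max 0 (1 - dist z (cp z)) *\<^sub>R B (cp z))"
  have cp_in: "cp z \<in> ?D" for z unfolding cp_def by (intro closest_point_in_set ne') auto
  have cp_cont: "continuous_on UNIV cp"
    unfolding cp_def by (intro continuous_on_closest_point ne') auto
  obtain M where M: "\<And>z. z \<in> ?D \<Longrightarrow> norm z \<le> M"
    using bounded_cbox[of a b] by (auto simp: bounded_iff)
  have g: "compactly_supported g (M + 1)"
  proof
    show "continuous_on UNIV g"
      unfolding g_def by (intro continuous_intros cp_cont continuous_on_compose2[OF B cp_cont]) (auto simp: cp_in)
    fix z :: complex assume "M + 1 < norm z"
    then have "dist z (cp z) \<ge> 1"
      using M[OF cp_in[of z]] norm_triangle_ineq2[of z "cp z"] by (simp add: dist_norm)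
    then show "g z = 0" by (simp add: g_def)
  qed
  interpret compactly_supported g "M + 1" by (rule g)
  have gB: "g z = B z" if "z \<in> ?D" for z
    using that by (simp add: g_def cp_def closest_point_self)
  have f: "continuous_on ?D f"
    using der has_derivative_continuous continuous_at_imp_continuous_on by blast
  \<comment> \<open>The correction term cancels the d-bar derivative of \<open>f\<close>: on the box
    \<open>g\<close> equals \<open>B\<close>, and \<open>cauchy_transform g\<close> formally has
    d-bar derivative -pi g.\<close>
  define h where "h = (\<lambda>z. f z + cauchy_transform g z / pi)"
  have T: "continuous_on S (cauchy_transform g)" for S
    by (rule continuous_on_subset[OF continuous_cauchy_transform]) simp
  have h: "continuous_on ?D h" unfolding h_def by (intro continuous_intros f T) auto
  have rect: "rect_integral h a z = 0" if "z \<in> box a b" for z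
  proof -
    have z: "Re a < Re z" "Im a < Im z" and sub: "cbox a z \<subseteq> ?D"
      using that by (auto simp: in_box_complex_iff in_cbox_complex_iff)
    have f': "continuous_on (cbox a z) f" by (rule continuous_on_subset[OF f sub])
    have "rect_integral h a z = rect_integral f a z + rect_integral (cauchy_transform g) a z / pi"
      unfolding h_def rect_integral_def using z
      by (subst (1 2 3 4) integral_add)
        (auto intro!: integrable_continuous_real continuous_intros
           continuous_on_Complex_slice(2)[OF f'] continuous_on_Complex_slice(3)[OF f']
           continuous_on_Complex_slice(2)[OF T] continuous_on_Complex_slice(3)[OF T]
          simp: field_simps)
    also have "rect_integral f a z = 2 * \<i> * integral {Re a..Re z} (\<lambda>x. integral {Im a..Im z} (\<lambda>y. B (Complex x y)))"
      by (rule rect_integral_Green) (use z sub der in \<open>auto intro!: continuous_on_subset[OF A] continuous_on_subset[OF B]\<close>)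
    also have "rect_integral (cauchy_transform g) a z =
        - (2 * pi * \<i>) * integral {Re a..Re z} (\<lambda>x. integral {Im a..Im z} (\<lambda>y. g (Complex x y)))"
      by (rule rect_integral_cauchy_transform[OF z])
    also have "integral {Re a..Re z} (\<lambda>x. integral {Im a..Im z} (\<lambda>y. g (Complex x y))) =
        integral {Re a..Re z} (\<lambda>x. integral {Im a..Im z} (\<lambda>y. B (Complex x y)))"
      by (intro integral_cong gB subsetD[OF sub]) (auto simp: in_cbox_complex_iff)
    finally show ?thesis by simp
  qed
  obtain P where P: "\<And>z. z \<in> box a b \<Longrightarrow> (P has_field_derivative h z) (at z)"
    using primitive_from_rectangles[OF h rect] by blast
  show ?thesis
  proof (rule that[OF g gB])
    fix e e' :: "real \<Rightarrow> complex"
    assume e: "\<And>t. t \<in> {0..1} \<Longrightarrow> (e has_vector_derivative e' t) (at t within {0..1})"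
      and e': "continuous_on {0..1} e'" and im: "e ` {0..1} \<subseteq> box a b"
    have ec: "continuous_on {0..1} e"
      using e by (meson continuous_on_eq_continuous_within has_vector_derivative_continuous)
    have "((\<lambda>t. h (e t) * e' t) has_integral (P \<circ> e) 1 - (P \<circ> e) 0) {0..1}"
    proof (rule fundamental_theorem_of_calculus)
      fix t :: real assume t: "t \<in> {0..1}"
      have "((P \<circ> e) has_vector_derivative e' t * h (e t)) (at t within {0..1})"
        by (rule field_vector_diff_chain_within[OF e[OF t]])
          (use im t in \<open>auto intro!: has_field_derivative_at_within P\<close>)
      then show "((P \<circ> e) has_vector_derivative h (e t) * e' t) (at t within {0..1})"
        by (simp add: mult.commute)
    qed simp
    then have "P (e 1) - P (e 0) = integral {0..1} (\<lambda>t. h (e t) * e' t)"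
      by (simp add: integral_unique)
    also have "\<dots> = integral {0..1} (\<lambda>t. f (e t) * e' t + cauchy_transform g (e t) * e' t / pi)"
      by (simp add: h_def field_simps)
    also have "\<dots> = integral {0..1} (\<lambda>t. f (e t) * e' t) + integral {0..1} (\<lambda>t. cauchy_transform g (e t) * e' t) / pi"
      using im box_subset_cbox[of a b]
      by (subst integral_add)
        (auto intro!: integrable_continuous_real continuous_intros e' continuous_on_compose2[OF f ec]
          continuous_on_compose2[OF T[of UNIV] ec])
    also have "integral {0..1} (\<lambda>t. cauchy_transform g (e t) * e' t) =
        (LINT \<zeta>|lborel. g \<zeta> * cauchy_kernel_integral 0 1 e e' \<zeta>)"
      by (rule integral_cauchy_transform_path[OF ec e'])
    finally show "integral {0..1} (\<lambda>t. f (e t) * e' t) =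
         P (e 1) - P (e 0) - (LINT \<zeta>|lborel. g \<zeta> * cauchy_kernel_integral 0 1 e e' \<zeta>) / pi"
      by (simp add: algebra_simps)
  qed
qed

section \<open>Real Moebius transformations\<close>

abbreviation "HH \<equiv> upper_half_plane"

lemma open_HH: "open HH" and convex_HH: "convex HH"
  by (simp_all add: upper_half_plane_def open_halfspace_Im_gt convex_halfspace_Im_gt)

lemma real_moebius_cases:
  assumes "real_moebius f"
  obtains a b c d :: real where "a * d - b * c = 1"
    "\<And>z. f z = (of_real a * z + of_real b) / (of_real c * z + of_real d)"
    "\<And>z. z \<in> HH \<Longrightarrow> of_real c * z + of_real d \<noteq> 0"
    "\<And>z. z \<in> HH \<Longrightarrow> (f has_field_derivative 1 / (of_real c * z + of_real d)\<^sup>2) (at z)"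
    "\<And>z w. z \<in> HH \<Longrightarrow> w \<in> HH \<Longrightarrow>
       f z - f w = (z - w) / ((of_real c * z + of_real d) * (of_real c * w + of_real d))"
    "\<And>z. Im (f z) = Im z / (norm (of_real c * z + of_real d))\<^sup>2"
proof -
  obtain a b c d :: real where det: "a * d - b * c = 1"
    and f: "\<And>z. f z = (of_real a * z + of_real b) / (of_real c * z + of_real d)"
    using assms by (auto simp: real_moebius_def)
  have det': "complex_of_real a * of_real d - of_real b * of_real c = 1"
    by (metis det of_real_1 of_real_diff of_real_mult)
  have nz: "of_real c * z + of_real d \<noteq> 0" if "z \<in> HH" for z
  proof
    assume 0: "of_real c * z + of_real d = 0"
    then have "Im (of_real c * z + of_real d) = 0" by (metis zero_complex.simps(2))
    then have "c * Im z = 0" by simp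
    then have "c = 0" using that by (simp add: upper_half_plane_def)
    then show False using 0 det by simp
  qed
  have der: "(f has_field_derivative 1 / (of_real c * z + of_real d)\<^sup>2) (at z)" if "z \<in> HH" for z
  proof -
    have "f = (\<lambda>z. (of_real a * z + of_real b) / (of_real c * z + of_real d))" using f by auto
    moreover have "((\<lambda>z. (of_real a * z + of_real b) / (of_real c * z + of_real d)) has_field_derivative
        (of_real a * (of_real c * z + of_real d) - (of_real a * z + of_real b) * of_real c) /
          ((of_real c * z + of_real d) * (of_real c * z + of_real d))) (at z)"
      using nz[OF that] by (auto intro!: derivative_eq_intros)
    moreover have "of_real a * (of_real c * z + of_real d) - (of_real a * z + of_real b) * of_real c = 1"
      using det' by (simp add: algebra_simps)
    ultimately show ?thesis by (simp add: power2_eq_square)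
  qed
  have diff: "f z - f w = (z - w) / ((of_real c * z + of_real d) * (of_real c * w + of_real d))"
    if "z \<in> HH" "w \<in> HH" for z w
  proof -
    have "f z - f w = ((of_real a * z + of_real b) * (of_real c * w + of_real d)
       - (of_real a * w + of_real b) * (of_real c * z + of_real d)) /
         ((of_real c * z + of_real d) * (of_real c * w + of_real d))"
      unfolding f using nz[OF that(1)] nz[OF that(2)] by (simp add: diff_frac_eq)
    also have "(of_real a * z + of_real b) * (of_real c * w + of_real d)
       - (of_real a * w + of_real b) * (of_real c * z + of_real d) =
       (complex_of_real a * of_real d - of_real b * of_real c) * (z - w)"
      by (simp add: algebra_simps)
    finally show ?thesis using det' by simp
  qed
  have Im: "Im (f z) = Im z / (norm (of_real c * z + of_real d))\<^sup>2" for z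
  proof -
    have "Im (f z) = (a * d - b * c) * Im z / (norm (of_real c * z + of_real d))\<^sup>2"
      unfolding f Im_divide cmod_power2[symmetric]
      by (simp add: cmod_power2 algebra_simps)
    then show ?thesis using det by simp
  qed
  show ?thesis by (rule that[OF det f nz der diff Im])
qed

text \<open>The equivalence holds at every \<open>z\<close>, poles included: \<open>Im (f z)\<close>
  is \<open>Im z\<close> divided by a square, and where the denominator vanishes the quotient is 0,
  which only happens off \<open>HH\<close>.\<close>

lemma real_moebius_in_HH_iff:
  assumes "real_moebius f"
  shows "f z \<in> HH \<longleftrightarrow> z \<in> HH"
proof -
  obtain a b c d where nz: "\<And>z. z \<in> HH \<Longrightarrow> complex_of_real c * z + of_real d \<noteq> 0"
    and Im: "\<And>z. Im (f z) = Im z / (norm (complex_of_real c * z + of_real d))\<^sup>2"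
    using real_moebius_cases[OF assms] by metis
  show ?thesis
    using nz[of z] Im[of z] by (auto simp: upper_half_plane_def zero_less_divide_iff)
qed

lemma real_moebius_holomorphic:
  assumes "real_moebius f"
  shows "f holomorphic_on HH"
  using real_moebius_cases[OF assms] by (metis field_differentiable_at_within field_differentiable_def holomorphic_on_def)

lemma real_moebius_has_deriv:
  assumes "real_moebius f" "z \<in> HH"
  shows "(f has_field_derivative deriv f z) (at z)"
  using assms open_HH holomorphic_derivI real_moebius_holomorphic by blast

lemma real_moebius_norm_deriv:
  assumes "real_moebius f" "z \<in> HH"
  shows "norm (deriv f z) * Im z = Im (f z)"
proof -
  obtain a b c d where der: "\<And>z. z \<in> HH \<Longrightarrow> (f has_field_derivative 1 / (complex_of_real c * z + of_real d)\<^sup>2) (at z)"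
    and Im: "\<And>z. Im (f z) = Im z / (norm (complex_of_real c * z + of_real d))\<^sup>2"
    using real_moebius_cases[OF assms(1)] by metis
  show ?thesis
    using DERIV_imp_deriv[OF der[OF assms(2)]] Im[of z] by (simp add: norm_divide norm_power)
qed

lemma real_moebius_cnj:
  assumes "real_moebius f"
  shows "f (cnj z) = cnj (f z)"
  using assms by (auto simp: real_moebius_def)

text \<open>The difference of the two poles is the logarithmic derivative in \<open>w\<close> of (w
  - z) / (w - cnj z). Real coefficients make \<open>f\<close> commute with conjugation, and under
  \<open>f\<close> this quotient changes only by a factor that does not involve
  \<open>w\<close>.\<close>

lemma real_moebius_kernel:
  assumes f: "real_moebius f" and z: "z \<in> HH" and w: "w \<in> HH" and "z \<noteq> w"
  shows "deriv f w * (1 / (f w - f z) - 1 / (f w - cnj (f z))) = 1 / (w - z) - 1 / (w - cnj z)"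
proof -
  obtain a b c d where det: "a * d - b * c = 1"
    and fdef: "\<And>z. f z = (of_real a * z + of_real b) / (of_real c * z + of_real d)"
    and nz: "\<And>z. z \<in> HH \<Longrightarrow> complex_of_real c * z + of_real d \<noteq> 0"
    and der: "\<And>z. z \<in> HH \<Longrightarrow> (f has_field_derivative 1 / (complex_of_real c * z + of_real d)\<^sup>2) (at z)"
    and diff: "\<And>z w. z \<in> HH \<Longrightarrow> w \<in> HH \<Longrightarrow>
       f z - f w = (z - w) / ((of_real c * z + of_real d) * (of_real c * w + of_real d))"
    using real_moebius_cases[OF f] by metis
  define p where "p = of_real c * w + complex_of_real d"
  define q where "q = of_real c * z + complex_of_real d"
  define r where "r = of_real c * cnj z + complex_of_real d"
  have det': "complex_of_real a * of_real d - of_real b * of_real c = 1"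
    by (metis det of_real_1 of_real_diff of_real_mult)
  have r: "r = cnj q" by (simp add: r_def q_def)
  have "p \<noteq> 0" "q \<noteq> 0" using nz[OF w] nz[OF z] by (auto simp: p_def q_def)
  then have nz': "p \<noteq> 0" "q \<noteq> 0" "r \<noteq> 0" by (auto simp: r)
  have d1: "f w - f z = (w - z) / (p * q)" using diff[OF w z] by (simp add: p_def q_def)
  have d2: "f w - cnj (f z) = (w - cnj z) / (p * r)"
  proof -
    have "f w - f (cnj z) = ((of_real a * w + of_real b) * r - (of_real a * cnj z + of_real b) * p) / (p * r)"
      unfolding fdef p_def[symmetric] r_def[symmetric] using nz' by (simp add: diff_frac_eq)
    also have "(of_real a * w + of_real b) * r - (of_real a * cnj z + of_real b) * p =
        (complex_of_real a * of_real d - of_real b * of_real c) * (w - cnj z)"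
      by (simp add: p_def r_def algebra_simps)
    finally show ?thesis using det' by (simp add: real_moebius_cnj[OF f])
  qed
  have wz: "w - z \<noteq> 0" "w - cnj z \<noteq> 0"
    using assms by (auto simp: upper_half_plane_def complex_eq_iff)
  \<comment> \<open>Dividing by \<open>w - z\<close> shows that a single pole would leave the extra
    term \<open>of_real c\<close>; the mirror pole leaves the same one, and the difference removes
    it.\<close>
  have pq: "p = q + of_real c * (w - z)" "p = r + of_real c * (w - cnj z)"
    by (auto simp: p_def q_def r_def algebra_simps)
  have "deriv f w * (1 / (f w - f z) - 1 / (f w - cnj (f z))) = (q / (w - z) - r / (w - cnj z)) / p"
  proof -
    have "1 / ((w - z) / (p * q)) - 1 / ((w - cnj z) / (p * r)) = p * (q / (w - z) - r / (w - cnj z))"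
      by (simp add: right_diff_distrib)
    then show ?thesis
      unfolding d1 d2 DERIV_imp_deriv[OF der[OF w]] p_def[symmetric]
      using nz' by (simp add: power2_eq_square)
  qed
  also have "q / (w - z) = p / (w - z) - of_real c" using pq(1) wz by (simp add: field_simps)
  also have "r / (w - cnj z) = p / (w - cnj z) - of_real c" using pq(2) wz by (simp add: field_simps)
  also have "(p / (w - z) - of_real c - (p / (w - cnj z) - of_real c)) / p = 1 / (w - z) - 1 / (w - cnj z)"
    using nz' by (simp add: diff_divide_distrib)
  finally show ?thesis .
qed

text \<open>Invariance of the hyperbolic distance, which is a function of |z - w|^2 / (Im z Im w),
  cleared of denominators. Injectivity and all discreteness estimates rest on it.\<close>

lemma real_moebius_hyperbolic:
  assumes f: "real_moebius f" and z: "z \<in> HH" and w: "w \<in> HH"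
  shows "(norm (f z - f w))\<^sup>2 * (Im z * Im w) = (norm (z - w))\<^sup>2 * (Im (f z) * Im (f w))"
proof -
  obtain a b c d where nz: "\<And>z. z \<in> HH \<Longrightarrow> complex_of_real c * z + of_real d \<noteq> 0"
    and diff: "\<And>z w. z \<in> HH \<Longrightarrow> w \<in> HH \<Longrightarrow>
       f z - f w = (z - w) / ((of_real c * z + of_real d) * (of_real c * w + of_real d))"
    and Im: "\<And>z. Im (f z) = Im z / (norm (complex_of_real c * z + of_real d))\<^sup>2"
    using real_moebius_cases[OF f] by metis
  show ?thesis
    using nz[OF z] nz[OF w] unfolding Im diff[OF z w]
    by (simp add: norm_divide norm_mult power_mult_distrib power_divide)
qed

lemma real_moebius_inj_on:
  assumes f: "real_moebius f"
  shows "inj_on f HH"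
proof (rule inj_onI)
  fix z w assume zw: "z \<in> HH" "w \<in> HH" "f z = f w"
  then have "f z \<in> HH" "f w \<in> HH" by (auto simp: real_moebius_in_HH_iff[OF f])
  then show "z = w" using real_moebius_hyperbolic[OF f zw(1,2)] zw
    by (auto simp: upper_half_plane_def)
qed

lemma real_moebius_image:
  assumes f: "real_moebius f"
  shows "f ` HH = HH"
proof
  show "f ` HH \<subseteq> HH" by (auto simp: real_moebius_in_HH_iff[OF f])
  obtain a b c d :: real where det: "a * d - b * c = 1"
    and fdef: "\<And>z. f z = (of_real a * z + of_real b) / (of_real c * z + of_real d)"
    using f by (auto simp: real_moebius_def)
  have det': "complex_of_real a * of_real d - of_real b * of_real c = 1"
    by (metis det of_real_1 of_real_diff of_real_mult)
  define k where "k = (\<lambda>z. (of_real d * z + of_real (- b)) / (of_real (- c) * z + complex_of_real a))"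
  have k: "real_moebius k"
    unfolding real_moebius_def k_def
  proof (intro exI conjI allI)
    show "d * a - (- b) * (- c) = 1" using det by (simp add: algebra_simps)
  qed (rule refl)
  show "HH \<subseteq> f ` HH"
  proof
    fix z assume z: "z \<in> HH"
    \<comment> \<open>A vanishing denominator would make \<open>k z\<close> equal to 0 by the
      convention on division, although \<open>k z\<close> lies in \<open>HH\<close>.\<close>
    have nz: "of_real (- c) * z + complex_of_real a \<noteq> 0"
    proof
      assume "of_real (- c) * z + complex_of_real a = 0"
      then have "k z = 0" by (simp add: k_def)
      moreover have "k z \<in> HH" using z by (simp add: real_moebius_in_HH_iff[OF k])
      ultimately show False by (simp add: upper_half_plane_def)
    qed
    let ?n = "of_real (- c) * z + complex_of_real a"
    have 1: "of_real a * k z + of_real b = z / ?n"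
      using nz det' unfolding k_def by (simp add: field_simps)
    have 2: "of_real c * k z + of_real d = 1 / ?n"
      using nz det' unfolding k_def by (simp add: field_simps)
    have "f (k z) = z"
      unfolding fdef 1 2 using nz by simp
    then show "z \<in> f ` HH" using z real_moebius_in_HH_iff[OF k] by (metis imageI)
  qed
qed

lemma real_moebius_measurable:
  assumes "real_moebius f"
  shows "f \<in> borel_measurable borel"
proof -
  obtain a b c d where "f = (\<lambda>z. (complex_of_real a * z + of_real b) / (of_real c * z + of_real d))"
    using assms unfolding real_moebius_def by (metis ext)
  then show ?thesis by simp
qed

section \<open>The invariant measure\<close>

lemma borel_measurable_vec_Complex:
  "(\<lambda>v :: real^2. Complex (v $ 1) (v $ 2)) \<in> borel_measurable borel"
  unfolding Complex_eq by (intro borel_measurable_continuous_onI continuous_intros)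

text \<open>The change of variables theorem is about \<open>real^'n\<close> and determinants of
  matrices, so the plane is also identified with \<open>real^2\<close>.\<close>

lemma distr_lborel_vec_Complex:
  "distr (lborel :: (real^2) measure) borel (\<lambda>v. Complex (v $ 1) (v $ 2)) = lborel"
proof (rule lborel_eqI [symmetric])
  fix l u :: complex assume lu: "\<And>b. b \<in> Basis \<Longrightarrow> l \<bullet> b \<le> u \<bullet> b"
  have le: "Re l \<le> Re u" "Im l \<le> Im u"
    using lu[of 1] lu[of \<i>] by (auto simp: Basis_complex_def)
  let ?l = "vector [Re l, Im l] :: real^2" and ?u = "vector [Re u, Im u] :: real^2"
  have vim: "(\<lambda>v :: real^2. Complex (v $ 1) (v $ 2)) -` box l u = box ?l ?u"
    by (auto simp: in_box_complex_iff mem_box_cart forall_2)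
  have "emeasure (distr lborel borel (\<lambda>v :: real^2. Complex (v $ 1) (v $ 2))) (box l u) =
      emeasure lborel (box ?l ?u)"
    by (subst emeasure_distr) (auto simp: vim borel_measurable_vec_Complex)
  also have "\<dots> = ennreal (\<Prod>b\<in>Basis. (?u - ?l) \<bullet> b)"
    by (rule emeasure_lborel_box) (use le in \<open>auto simp: Basis_vec_def inner_axis forall_2 UNIV_2\<close>)
  also have "(\<Prod>b\<in>Basis. (?u - ?l) \<bullet> b) = (Re u - Re l) * (Im u - Im l)"
    by (simp add: Basis_vec_def UNIV_2 inner_axis axis_eq_axis)
  also have "\<dots> = (\<Prod>b\<in>Basis. (u - l) \<bullet> b)"
    by (simp add: Basis_complex_def)
  finally show "emeasure (distr lborel borel (\<lambda>v :: real^2. Complex (v $ 1) (v $ 2))) (box l u) =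
    (\<Prod>b\<in>Basis. (u - l) \<bullet> b)" .
qed simp

text \<open>The real Jacobian of a holomorphic map is |f'|^2. A Borel function \<open>d\<close>
  represents it on \<open>S\<close>, which avoids any question about the measurability of
  \<open>deriv f\<close> off \<open>S\<close>.\<close>

lemma nn_integral_holomorphic_substitution:
  fixes f :: "complex \<Rightarrow> complex" and w :: "complex \<Rightarrow> real"
  assumes S: "open S" and f: "f holomorphic_on S" and inj: "inj_on f S"
    and w: "w \<in> borel_measurable borel" "\<And>z. w z \<ge> 0"
    and f_meas: "f \<in> borel_measurable borel"
    and d: "d \<in> borel_measurable borel" "\<And>z. z \<in> S \<Longrightarrow> d z = (norm (deriv f z))\<^sup>2"
  shows "(\<integral>\<^sup>+z. ennreal (d z * w (f z)) * indicator S z \<partial>lborel) =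
         (\<integral>\<^sup>+z. ennreal (w z) * indicator (f ` S) z \<partial>lborel)"
proof -
  define \<phi> where "\<phi> = (\<lambda>v :: real^2. Complex (v $ 1) (v $ 2))"
  define \<psi> where "\<psi> = (\<lambda>z. vector [Re z, Im z] :: real^2)"
  have \<phi>\<psi> [simp]: "\<phi> (\<psi> z) = z" for z by (simp add: \<phi>_def \<psi>_def)
  have \<psi>\<phi> [simp]: "\<psi> (\<phi> v) = v" for v by (simp add: \<phi>_def \<psi>_def vec_eq_iff forall_2)
  have \<phi>_meas [measurable]: "\<phi> \<in> borel_measurable borel"
    unfolding \<phi>_def by (rule borel_measurable_vec_Complex)
  note [measurable] = w(1) f_meas d(1)
  have [measurable]: "S \<in> sets borel" using S by auto
  have fS: "open (f ` S)" by (rule open_mapping_thm3[OF f S inj])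
  then have [measurable]: "f ` S \<in> sets borel" by auto
  define T where "T = \<phi> -` S"
  have \<phi>_cont: "continuous_on UNIV \<phi>"
    unfolding \<phi>_def Complex_eq by (intro continuous_intros)
  have T_open: "open T" unfolding T_def using \<phi>_cont S by (simp add: continuous_open_vimage continuous_on_eq_continuous_at)
  define G where "G = \<psi> \<circ> f \<circ> \<phi>"
  define G' where "G' = (\<lambda>v h. \<psi> (deriv f (\<phi> v) * \<phi> h))"
  have \<phi>_lin: "bounded_linear \<phi>"
    unfolding \<phi>_def by (intro linear_conv_bounded_linear[THEN iffD1] linearI) (auto simp: complex_eq_iff)
  have \<psi>_lin: "bounded_linear \<psi>"
    unfolding \<psi>_def by (intro linear_conv_bounded_linear[THEN iffD1] linearI) (auto simp: vec_eq_iff forall_2)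
  have G_der: "(G has_derivative G' v) (at v within T)" if "v \<in> T" for v
  proof -
    have "(f has_derivative (*) (deriv f (\<phi> v))) (at (\<phi> v))"
      using holomorphic_derivI[OF f S] that by (auto simp: T_def has_field_derivative_def)
    from diff_chain_at[OF bounded_linear_imp_has_derivative[OF \<phi>_lin] this]
    have "((f \<circ> \<phi>) has_derivative ((*) (deriv f (\<phi> v)) \<circ> \<phi>)) (at v)" .
    from diff_chain_at[OF this bounded_linear_imp_has_derivative[OF \<psi>_lin]]
    have "((\<psi> \<circ> (f \<circ> \<phi>)) has_derivative (\<psi> \<circ> ((*) (deriv f (\<phi> v)) \<circ> \<phi>))) (at v)" .
    moreover have "\<psi> \<circ> (f \<circ> \<phi>) = G" by (simp add: G_def comp_assoc)
    moreover have "\<psi> \<circ> ((*) (deriv f (\<phi> v)) \<circ> \<phi>) = G' v" by (rule ext) (simp add: G'_def)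
    ultimately show ?thesis by (simp add: has_derivative_at_withinI)
  qed
  \<comment> \<open>Multiplication by a complex number c has determinant |c|^2 as a real linear
    map.\<close>
  have det: "\<bar>det (matrix (G' v))\<bar> = d (\<phi> v)" if "v \<in> T" for v
  proof -
    have "det (matrix (G' v)) = (Re (deriv f (\<phi> v)))\<^sup>2 + (Im (deriv f (\<phi> v)))\<^sup>2"
      by (simp add: det_2 matrix_def G'_def \<phi>_def \<psi>_def axis_def power2_eq_square)
    then show ?thesis using d(2)[of "\<phi> v"] that by (simp add: T_def cmod_power2)
  qed
  have G_inj: "inj_on G T"
  proof (rule inj_onI)
    fix x y assume xy: "x \<in> T" "y \<in> T" "G x = G y"
    then have "\<phi> (\<psi> (f (\<phi> x))) = \<phi> (\<psi> (f (\<phi> y)))" by (simp add: G_def)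
    then have "\<phi> x = \<phi> y" using inj xy by (simp add: T_def inj_on_eq_iff)
    then have "\<psi> (\<phi> x) = \<psi> (\<phi> y)" by (rule arg_cong)
    then show "x = y" by simp
  qed
  have GT: "G ` T = \<phi> -` (f ` S)"
  proof
    show "G ` T \<subseteq> \<phi> -` (f ` S)" by (auto simp: G_def T_def)
    show "\<phi> -` (f ` S) \<subseteq> G ` T"
    proof
      fix v assume "v \<in> \<phi> -` (f ` S)"
      then obtain z where z: "z \<in> S" "\<phi> v = f z" by auto
      then have "G (\<psi> z) = \<psi> (\<phi> v)" by (simp add: G_def)
      then have "v = G (\<psi> z)" by simp
      moreover have "\<psi> z \<in> T" using z by (simp add: T_def)
      ultimately show "v \<in> G ` T" by blast
    qed
  qed
  define w1 where "w1 = (\<lambda>v. d (\<phi> v) * w (f (\<phi> v)))"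
  define w2 where "w2 = (\<lambda>v. w (\<phi> v))"
  have [measurable]: "w1 \<in> borel_measurable borel" "w2 \<in> borel_measurable borel"
    unfolding w1_def w2_def by measurable
  have T_meas [measurable]: "T \<in> sets borel" and GT_meas [measurable]: "G ` T \<in> sets borel"
    unfolding GT unfolding T_def
    using measurable_sets[OF \<phi>_meas, of S] measurable_sets[OF \<phi>_meas, of "f ` S"] by simp_all
  have cov: "w1 absolutely_integrable_on T \<and> integral T w1 = b \<longleftrightarrow>
      w2 absolutely_integrable_on (G ` T) \<and> integral (G ` T) w2 = b" for b
  proof -
    have "(\<lambda>x. \<bar>det (matrix (G' x))\<bar> *\<^sub>R (vec (w2 (G x)) :: real^1)) absolutely_integrable_on T \<and>
           integral T (\<lambda>x. \<bar>det (matrix (G' x))\<bar> *\<^sub>R (vec (w2 (G x)) :: real^1)) = vec b \<longleftrightarrow>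
       (\<lambda>x. vec (w2 x) :: real^1) absolutely_integrable_on (G ` T) \<and> integral (G ` T) (\<lambda>x. vec (w2 x) :: real^1) = vec b"
      by (rule has_absolute_integral_change_of_variables) (use G_der G_inj T_open in auto)
    moreover have "(\<lambda>x. \<bar>det (matrix (G' x))\<bar> *\<^sub>R (vec (w2 (G x)) :: real^1)) absolutely_integrable_on T \<longleftrightarrow>
        (\<lambda>x. vec (w1 x) :: real^1) absolutely_integrable_on T"
      by (rule set_integrable_cong) (auto simp: det w1_def w2_def G_def vec_eq_iff)
    moreover have "integral T (\<lambda>x. \<bar>det (matrix (G' x))\<bar> *\<^sub>R (vec (w2 (G x)) :: real^1)) =
        integral T (\<lambda>x. vec (w1 x) :: real^1)"
      by (rule integral_cong) (auto simp: det w1_def w2_def G_def vec_eq_iff)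
    ultimately show ?thesis
      by (simp add: absolutely_integrable_on_1_iff integral_on_1_eq)
  qed
  have w1_nn: "w1 v \<ge> 0" if "v \<in> T" for v using that d(2)[of "\<phi> v"] w(2) by (auto simp: w1_def T_def)
  have w2_nn: "w2 v \<ge> 0" for v by (simp add: w2_def w)
  \<comment> \<open>The change of variables theorem concerns absolutely integrable functions. For
    non-negative ones, integrals in [0, infinity] are recovered by giving the non-integrable case
    the value infinity on both sides.\<close>
  have nn: "(\<integral>\<^sup>+v. ennreal (u v) * indicator A v \<partial>lborel) =
      (if u absolutely_integrable_on A then ennreal (integral A u) else \<infinity>)"
    if [measurable]: "u \<in> borel_measurable borel" "A \<in> sets borel" and pos: "\<And>v. v \<in> A \<Longrightarrow> u v \<ge> 0"
    for u :: "real^2 \<Rightarrow> real" and A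
  proof -
    have eq: "(\<integral>\<^sup>+v. ennreal (u v) * indicator A v \<partial>lborel) = (\<integral>\<^sup>+v. ennreal (indicator A v *\<^sub>R u v) \<partial>lborel)"
      by (rule nn_integral_cong) (auto simp: indicator_def)
    have iff: "u absolutely_integrable_on A \<longleftrightarrow> integrable lborel (\<lambda>v. indicator A v *\<^sub>R u v)"
      unfolding set_integrable_def by (subst integrable_completion) auto
    have pos': "AE v in lborel. 0 \<le> indicator A v *\<^sub>R u v"
      using pos by (auto simp: indicator_def)
    show ?thesis
    proof (cases "integrable lborel (\<lambda>v. indicator A v *\<^sub>R u v)")
      case True
      have "(\<integral>\<^sup>+v. ennreal (indicator A v *\<^sub>R u v) \<partial>lborel) = ennreal (LINT v:A|lborel. u v)"
        unfolding set_lebesgue_integral_def by (rule nn_integral_eq_integral[OF True pos'])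
      also have "(LINT v:A|lborel. u v) = integral A u"
        by (rule set_borel_integral_eq_integral(2)) (use True in \<open>simp add: set_integrable_def\<close>)
      finally show ?thesis using True iff eq by simp
    next
      case False
      then have "(\<integral>\<^sup>+v. ennreal (indicator A v *\<^sub>R u v) \<partial>lborel) = \<infinity>"
        by (subst (asm) integrable_iff_bounded)
          (use pos' in \<open>auto simp: less_top[symmetric] indicator_def abs_of_nonneg pos cong: nn_integral_cong\<close>)
      then show ?thesis using False iff eq by simp
    qed
  qed
  have "(\<integral>\<^sup>+z. ennreal (d z * w (f z)) * indicator S z \<partial>lborel) = (\<integral>\<^sup>+v. ennreal (w1 v) * indicator T v \<partial>lborel)"
    by (subst distr_lborel_vec_Complex[symmetric], subst nn_integral_distr)
      (auto simp: borel_measurable_vec_Complex w1_def T_def \<phi>_def indicator_def intro!: nn_integral_cong)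
  also have "\<dots> = (\<integral>\<^sup>+v. ennreal (w2 v) * indicator (G ` T) v \<partial>lborel)"
    using cov[of "integral T w1"] cov[of "integral (G ` T) w2"] w1_nn w2_nn
    by (subst (1 2) nn) auto
  also have "\<dots> = (\<integral>\<^sup>+z. ennreal (w z) * indicator (f ` S) z \<partial>lborel)"
    by (subst distr_lborel_vec_Complex[symmetric], subst nn_integral_distr)
      (auto simp: borel_measurable_vec_Complex w2_def GT \<phi>_def indicator_def intro!: nn_integral_cong)
  finally show ?thesis .
qed

text \<open>The invariant area dx dy / y^2, taken as a measure on the Borel sets of the whole plane
  that vanishes off \<open>HH\<close>, so that Moebius maps can push it forward as functions on the
  plane.\<close>

definition hyp_measure :: "complex measure" where
  "hyp_measure = density lborel (\<lambda>z. ennreal (indicator HH z / (Im z)\<^sup>2))"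

lemma borel_HH [measurable]: "HH \<in> sets borel"
  using open_HH by auto

lemma sets_hyp_measure [simp, measurable_cong]: "sets hyp_measure = sets borel"
  and space_hyp_measure [simp]: "space hyp_measure = UNIV"
  by (auto simp: hyp_measure_def)

text \<open>Since |f'| = Im f / Im, the Jacobian |f'|^2 makes up exactly for the change of the
  density 1 / y^2.\<close>

lemma distr_hyp_measure:
  assumes f: "real_moebius f"
  shows "distr hyp_measure borel f = hyp_measure"
proof (rule measure_eqI)
  note [measurable] = real_moebius_measurable[OF f]
  fix A assume "A \<in> sets (distr hyp_measure borel f)"
  then have [measurable]: "A \<in> sets borel" by simp
  then have [measurable]: "f -` A \<in> sets borel"
    using measurable_sets[OF real_moebius_measurable[OF f]] by simp
  define w where "w = (\<lambda>z. indicator A z / (Im z)\<^sup>2 :: real)"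
  have [measurable]: "w \<in> borel_measurable borel" unfolding w_def by measurable
  define d where "d = (\<lambda>z. (Im (f z) / Im z)\<^sup>2)"
  have [measurable]: "d \<in> borel_measurable borel" unfolding d_def by measurable
  have "emeasure (distr hyp_measure borel f) A = (\<integral>\<^sup>+z. ennreal (indicator HH z / (Im z)\<^sup>2) * indicator (f -` A) z \<partial>lborel)"
    by (subst emeasure_distr) (auto simp: hyp_measure_def emeasure_density)
  also have "\<dots> = (\<integral>\<^sup>+z. ennreal (d z * w (f z)) * indicator HH z \<partial>lborel)"
  proof (rule nn_integral_cong)
    fix z
    have "Im (f z) \<noteq> 0" if "z \<in> HH"
      using that real_moebius_in_HH_iff[OF f, of z] by (simp add: upper_half_plane_def)
    then show "ennreal (indicator HH z / (Im z)\<^sup>2) * indicator (f -` A) z = ennreal (d z * w (f z)) * indicator HH z"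
      by (auto simp: d_def w_def indicator_def power_divide)
  qed
  also have "\<dots> = (\<integral>\<^sup>+z. ennreal (w z) * indicator (f ` HH) z \<partial>lborel)"
  proof (rule nn_integral_holomorphic_substitution[OF open_HH real_moebius_holomorphic[OF f] real_moebius_inj_on[OF f]])
    fix z assume z: "z \<in> HH"
    then show "d z = (norm (deriv f z))\<^sup>2"
      using real_moebius_norm_deriv[OF f z, symmetric] by (auto simp: d_def upper_half_plane_def)
  qed (auto simp: w_def)
  also have "\<dots> = (\<integral>\<^sup>+z. ennreal (indicator HH z / (Im z)\<^sup>2) * indicator A z \<partial>lborel)"
    unfolding real_moebius_image[OF f]
    by (rule nn_integral_cong) (auto simp: w_def indicator_def)
  also have "\<dots> = emeasure hyp_measure A"
    by (auto simp: hyp_measure_def emeasure_density)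
  finally show "emeasure (distr hyp_measure borel f) A = emeasure hyp_measure A" .
qed simp

section \<open>Discreteness and unfolding\<close>

locale fuchsian = group G for G :: "('g, 'm) monoid_scheme" (structure) +
  fixes act :: "'g \<Rightarrow> complex \<Rightarrow> complex"
  assumes moebius: "\<gamma> \<in> carrier G \<Longrightarrow> real_moebius (act \<gamma>)"
    and act_mult: "\<gamma> \<in> carrier G \<Longrightarrow> \<delta> \<in> carrier G \<Longrightarrow> z \<in> HH \<Longrightarrow>
      act (\<gamma> \<otimes> \<delta>) z = act \<gamma> (act \<delta> z)"
begin

text \<open>The coefficient of the pullback of the form f(z) dz; with it an integral over a
  translated curve becomes one over the curve itself.\<close>

abbreviation "pull f \<gamma> \<equiv> \<lambda>z. f (act \<gamma> z) * deriv (act \<gamma>) z"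

lemma act_HH: "\<gamma> \<in> carrier G \<Longrightarrow> z \<in> HH \<Longrightarrow> act \<gamma> z \<in> HH"
  using real_moebius_in_HH_iff[OF moebius] by simp

text \<open>By \<open>act_mult\<close> the neutral element acts idempotently on \<open>HH\<close>,
  and an injective idempotent map is the identity.\<close>

lemma act_one: "z \<in> HH \<Longrightarrow> act \<one> z = z"
  using act_mult[of \<one> \<one> z] inj_onD[OF real_moebius_inj_on[OF moebius[OF one_closed]], of "act \<one> z" z]
  by (simp add: act_HH)

lemma act_inv: "\<gamma> \<in> carrier G \<Longrightarrow> z \<in> HH \<Longrightarrow> act (inv \<gamma>) (act \<gamma> z) = z"
  and act_inv': "\<gamma> \<in> carrier G \<Longrightarrow> z \<in> HH \<Longrightarrow> act \<gamma> (act (inv \<gamma>) z) = z"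
  by (simp_all flip: act_mult add: act_one)

lemma act_has_deriv: "\<gamma> \<in> carrier G \<Longrightarrow> z \<in> HH \<Longrightarrow> (act \<gamma> has_field_derivative deriv (act \<gamma>) z) (at z)"
  by (rule real_moebius_has_deriv[OF moebius])

text \<open>\<open>U\<close> contains a disc about \<open>u\<close>, so different group elements
  carry \<open>u\<close> to points with a definite hyperbolic distance. Above height
  \<open>y0\<close> a small Euclidean distance is a small hyperbolic one.\<close>

lemma translates_separated:
  assumes U: "open U" "U \<subseteq> HH" "u \<in> U"
    and disj: "\<And>\<gamma>. \<gamma> \<in> carrier G \<Longrightarrow> \<gamma> \<noteq> \<one> \<Longrightarrow> act \<gamma> ` U \<inter> U = {}" and y0: "y0 > 0"
  obtains \<epsilon> where "\<epsilon> > 0"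
    "\<And>\<gamma> \<delta>. \<gamma> \<in> carrier G \<Longrightarrow> \<delta> \<in> carrier G \<Longrightarrow> y0 \<le> Im (act \<gamma> u) \<Longrightarrow> y0 \<le> Im (act \<delta> u) \<Longrightarrow>
       norm (act \<gamma> u - act \<delta> u) < \<epsilon> \<Longrightarrow> \<gamma> = \<delta>"
proof -
  obtain r where r: "r > 0" "ball u r \<subseteq> U" using U by (meson openE)
  have u: "u \<in> HH" "Im u > 0" using U by (auto simp: upper_half_plane_def)
  \<comment> \<open>Put t = |u - v|. The value of \<open>\<epsilon>\<close> gives t^2 \<le> c * Im v
    \<le> c * (Im u + t), and \<open>c\<close> is such that t \<ge> r would then force t \<le> c * E
    = r / 2.\<close>
  define E where "E = Im u / r + 1"
  define c where "c = r / (2 * E)"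
  define \<epsilon> where "\<epsilon> = y0 * sqrt (c / Im u)"
  have E: "E > 0" using r u by (simp add: E_def add_pos_pos)
  then have pos: "c > 0" using r by (simp add: c_def)
  have eps: "\<epsilon> > 0" using y0 pos u by (simp add: \<epsilon>_def)
  have "\<gamma> = \<delta>" if g: "\<gamma> \<in> carrier G" "\<delta> \<in> carrier G" and y: "y0 \<le> Im (act \<gamma> u)" "y0 \<le> Im (act \<delta> u)"
    and less: "norm (act \<gamma> u - act \<delta> u) < \<epsilon>" for \<gamma> \<delta>
  proof (rule ccontr)
    assume ne: "\<gamma> \<noteq> \<delta>"
    define v where "v = act (inv \<gamma> \<otimes> \<delta>) u"
    have v: "v \<in> HH" using g u by (simp add: v_def act_HH)
    then have vpos: "Im v > 0" by (simp add: upper_half_plane_def)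
    have \<gamma>v: "act \<gamma> v = act \<delta> u" using g u by (simp add: v_def act_mult act_HH act_inv')
    define t where "t = norm (u - v)"
    have "(norm (act \<gamma> u - act \<delta> u))\<^sup>2 * (Im u * Im v) = t\<^sup>2 * (Im (act \<gamma> u) * Im (act \<delta> u))"
      using real_moebius_hyperbolic[OF moebius[OF g(1)] u(1) v] by (simp add: \<gamma>v t_def)
    moreover have "t\<^sup>2 * (y0 * y0) \<le> t\<^sup>2 * (Im (act \<gamma> u) * Im (act \<delta> u))"
      using y y0 by (intro mult_left_mono mult_mono) auto
    moreover have "(norm (act \<gamma> u - act \<delta> u))\<^sup>2 * (Im u * Im v) \<le> \<epsilon>\<^sup>2 * (Im u * Im v)"
      using less u vpos by (intro mult_right_mono power_mono) auto
    moreover have "\<epsilon>\<^sup>2 = y0 * y0 * (c / Im u)"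
      using u pos by (simp add: \<epsilon>_def power_mult_distrib) (simp add: power2_eq_square)
    moreover from this have "\<epsilon>\<^sup>2 * (Im u * Im v) = (y0 * y0) * (c * Im v)"
      using u by simp
    ultimately have "t\<^sup>2 * (y0 * y0) \<le> (c * Im v) * (y0 * y0)" by (simp add: mult.commute)
    then have t2: "t\<^sup>2 \<le> c * Im v" using y0 by simp
    have "Im v \<le> Im u + t"
      using abs_Im_le_cmod[of "u - v"] by (simp add: t_def)
    then have t3: "t\<^sup>2 \<le> c * (Im u + t)"
      using t2 pos by (meson mult_left_mono order_trans less_imp_le)
    have "t < r"
    proof (rule ccontr)
      assume "\<not> t < r"
      then have tr: "r \<le> t" "t > 0" using r by auto
      have "(Im u / t + 1) * t = Im u + t" using tr by (simp add: field_simps)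
      then have "t * t \<le> c * (Im u / t + 1) * t"
        using t3 by (simp add: power2_eq_square mult.assoc)
      then have "t \<le> c * (Im u / t + 1)" using tr by simp
      also have "\<dots> \<le> c * (Im u / r + 1)"
        using tr r u pos by (intro mult_left_mono add_right_mono divide_left_mono) auto
      also have "\<dots> = r / 2" using E by (simp add: c_def flip: E_def)
      finally show False using tr r by simp
    qed
    then have "v \<in> U" using r by (auto simp: t_def dist_norm subset_iff)
    moreover have "v \<in> act (inv \<gamma> \<otimes> \<delta>) ` U" using U by (simp add: v_def)
    moreover have "inv \<gamma> \<otimes> \<delta> \<noteq> \<one>" using ne g by (metis inv_closed inv_equality inv_inv)
    ultimately show False using disj[of "inv \<gamma> \<otimes> \<delta>"] g by auto
  qed
  then show ?thesis using that[OF eps] by blast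
qed

text \<open>The hyperbolic distance from \<open>act \<gamma> z\<close> to
  \<open>act \<gamma> u\<close> does not depend on \<gamma>. A return of \<open>z\<close> to
  \<open>K\<close> thus confines the translate of \<open>u\<close> to a bounded set above a positive
  height, where translates are separated; infinitely many would accumulate.\<close>

lemma finite_return:
  assumes U: "open U" "U \<subseteq> HH" "u \<in> U"
    and disj: "\<And>\<gamma>. \<gamma> \<in> carrier G \<Longrightarrow> \<gamma> \<noteq> \<one> \<Longrightarrow> act \<gamma> ` U \<inter> U = {}"
    and K: "compact K" "K \<subseteq> HH" and z: "z \<in> HH"
  shows "finite {\<gamma> \<in> carrier G. act \<gamma> z \<in> K}"
proof (cases "K = {}")
  case False
  let ?S = "{\<gamma> \<in> carrier G. act \<gamma> z \<in> K}"
  have u: "u \<in> HH" "Im u > 0" using U by (auto simp: upper_half_plane_def)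
  have zpos: "Im z > 0" using z by (simp add: upper_half_plane_def)
  obtain w0 where w0: "w0 \<in> K" "\<And>w. w \<in> K \<Longrightarrow> Im w0 \<le> Im w"
    using continuous_attains_inf[OF K(1) False continuous_on_Im[OF continuous_on_id]] by auto
  obtain M where M: "M > 0" "\<And>w. w \<in> K \<Longrightarrow> norm w \<le> M"
    using compact_imp_bounded[OF K(1)] by (auto simp: bounded_pos)
  define m1 where "m1 = Im w0"
  have m1: "m1 > 0" "\<And>w. w \<in> K \<Longrightarrow> m1 \<le> Im w" using w0 K by (auto simp: m1_def upper_half_plane_def)
  \<comment> \<open>\<open>D - 1\<close> is the invariant |u - z|^2 / (Im u Im z). The two entries
    of \<open>y0\<close> belong to the cases Im x \<ge> m1 / 2 and Im x < m1 / 2; in the second, s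
    \<ge> m1 / 2, and s^2 \<le> D * M * Im x bounds Im x from below.\<close>
  define D where "D = (norm (u - z))\<^sup>2 / (Im u * Im z) + 1"
  have D: "D \<ge> 1" using u zpos by (simp add: D_def)
  define y0 where "y0 = min (m1 / 2) ((m1 / 2)\<^sup>2 / (D * M))"
  have y0: "y0 > 0" using m1 M D by (auto simp: y0_def intro!: divide_pos_pos)
  define C where "C = 1 + D * (M + 1) * M"
  have key: "y0 \<le> Im (act \<gamma> u) \<and> norm (act \<gamma> u) \<le> C + M" if "\<gamma> \<in> ?S" for \<gamma>
  proof -
    have g: "\<gamma> \<in> carrier G" and wK: "act \<gamma> z \<in> K" using that by auto
    define x w s where "x = act \<gamma> u" and "w = act \<gamma> z" and "s = norm (x - w)"
    have xpos: "Im x > 0" using act_HH[OF g u(1)] by (simp add: x_def upper_half_plane_def)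
    have w: "m1 \<le> Im w" "norm w \<le> M" using m1(2)[OF wK] M(2)[OF wK] by (auto simp: w_def)
    then have wM: "Im w \<le> M" "Im w > 0" using abs_Im_le_cmod[of w] m1 by auto
    have "s\<^sup>2 * (Im u * Im z) = (norm (u - z))\<^sup>2 * (Im x * Im w)"
      using real_moebius_hyperbolic[OF moebius[OF g] u(1) z] by (simp add: x_def w_def s_def)
    then have "s\<^sup>2 = (D - 1) * (Im x * Im w)" using u zpos by (simp add: D_def field_simps)
    also have "\<dots> \<le> D * (Im x * M)" using D xpos wM M by (intro mult_mono) auto
    finally have s2: "s\<^sup>2 \<le> D * M * Im x" by (simp add: mult_ac)
    have xs: "Im x \<le> M + s" "m1 \<le> Im x + s"
      using abs_Im_le_cmod[of "x - w"] wM w by (auto simp: s_def)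
    have s0: "s \<ge> 0" by (simp add: s_def)
    have "s \<le> C"
    proof (cases "s \<le> 1")
      case True
      then show ?thesis using D M by (simp add: C_def add_increasing2)
    next
      case False
      have "s\<^sup>2 \<le> D * M * (M + s)" using s2 xs D M
        by (meson mult_left_mono mult_nonneg_nonneg order_trans less_imp_le zero_le_one)
      also have "\<dots> \<le> D * M * ((M + 1) * s)"
        using False D M by (intro mult_left_mono) (auto simp: algebra_simps)
      finally have "s * s \<le> (D * M * (M + 1)) * s" by (simp add: power2_eq_square mult_ac)
      then have "s \<le> D * M * (M + 1)" using False by simp
      then show ?thesis by (simp add: C_def mult_ac)
    qed
    then have "norm x \<le> C + M" using norm_triangle_sub[of x w] w by (simp add: s_def)
    moreover have "y0 \<le> Im x"
    proof (cases "Im x \<ge> m1 / 2")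
      case False
      then have "m1 / 2 \<le> s" using xs by simp
      then have "(m1 / 2)\<^sup>2 \<le> s\<^sup>2" using m1 by (intro power_mono) auto
      then have "(m1 / 2)\<^sup>2 \<le> D * M * Im x" using s2 by linarith
      then have "(m1 / 2)\<^sup>2 / (D * M) \<le> Im x" using D M by (simp add: divide_le_eq mult_ac)
      then show ?thesis by (simp add: y0_def)
    qed (simp add: y0_def)
    ultimately show ?thesis by (simp add: x_def)
  qed
  obtain \<epsilon> where eps: "\<epsilon> > 0" "\<And>\<gamma> \<delta>. \<gamma> \<in> carrier G \<Longrightarrow> \<delta> \<in> carrier G \<Longrightarrow>
      y0 \<le> Im (act \<gamma> u) \<Longrightarrow> y0 \<le> Im (act \<delta> u) \<Longrightarrow> norm (act \<gamma> u - act \<delta> u) < \<epsilon> \<Longrightarrow> \<gamma> = \<delta>"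
    using translates_separated[OF U disj y0] by metis
  let ?f = "\<lambda>\<gamma>. act \<gamma> u"
  have inj: "inj_on ?f ?S" by (rule inj_onI) (use eps key in auto)
  show ?thesis
  proof (rule ccontr)
    assume "infinite ?S"
    then have inf: "infinite (?f ` ?S)" using inj by (simp add: finite_image_iff)
    have "bounded (?f ` ?S)" using key by (auto simp: bounded_iff)
    then obtain l where l: "l islimpt (?f ` ?S)"
      using inf bounded_infinite_imp_islimpt by blast
    define A where "A = ?f ` ?S \<inter> ball l (\<epsilon> / 2)"
    have "infinite (?f ` ?S \<inter> ball l (\<epsilon> / 2))"
      using l eps by (simp add: islimpt_eq_infinite_ball)
    then have inf': "infinite A" by (simp add: A_def)
    obtain x where x: "x \<in> A" using infinite_imp_nonempty[OF inf'] by blast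
    have "infinite (A - {x})" using inf' by simp
    then obtain y where y: "y \<in> A - {x}" using infinite_imp_nonempty by blast
    have xy: "x \<in> ?f ` ?S" "y \<in> ?f ` ?S" "x \<in> ball l (\<epsilon> / 2)" "y \<in> ball l (\<epsilon> / 2)" "x \<noteq> y"
      using x y by (auto simp: A_def)
    then have "norm (x - y) < \<epsilon>"
      using dist_triangle_half_r[of l x \<epsilon> y] by (simp add: dist_norm)
    then show False using xy eps key by auto
  qed
qed auto

text \<open>The half plane is a countable union of compact sets, and the orbit of \<open>u\<close>
  visits each of them only finitely often. Countability is what permits discarding a null set for
  every group element at once.\<close>

lemma countable_carrier:
  assumes U: "open U" "U \<subseteq> HH" "u \<in> U"
    and disj: "\<And>\<gamma>. \<gamma> \<in> carrier G \<Longrightarrow> \<gamma> \<noteq> \<one> \<Longrightarrow> act \<gamma> ` U \<inter> U = {}"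
  shows "countable (carrier G)"
proof -
  define K where "K n = cball 0 (real n) \<inter> {z. Im z \<ge> 1 / Suc n}" for n
  have u: "u \<in> HH" using U by auto
  have K: "compact (K n)" "K n \<subseteq> HH" for n
  proof -
    show "compact (K n)"
      unfolding K_def by (intro compact_Int_closed compact_cball closed_halfspace_Im_ge)
    show "K n \<subseteq> HH"
    proof
      fix z assume "z \<in> K n"
      then have "1 / Suc n \<le> Im z" by (simp add: K_def)
      moreover have "0 < 1 / real (Suc n)" by simp
      ultimately have "0 < Im z" by linarith
      then show "z \<in> HH" by (simp add: upper_half_plane_def)
    qed
  qed
  have "carrier G \<subseteq> (\<Union>n. {\<gamma> \<in> carrier G. act \<gamma> u \<in> K n})"
  proof
    fix \<gamma> assume g: "\<gamma> \<in> carrier G"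
    have pos: "Im (act \<gamma> u) > 0" using act_HH[OF g u] by (simp add: upper_half_plane_def)
    obtain n1 where n1: "norm (act \<gamma> u) \<le> real n1" using real_arch_simple by blast
    obtain n2 where n2: "1 / Suc n2 < Im (act \<gamma> u)" using nat_approx_posE[OF pos] by blast
    have "1 / Suc (max n1 n2) \<le> 1 / Suc n2" by (simp add: frac_le)
    then have "act \<gamma> u \<in> K (max n1 n2)" using n1 n2 by (simp add: K_def)
    then show "\<gamma> \<in> (\<Union>n. {\<gamma> \<in> carrier G. act \<gamma> u \<in> K n})" using g by blast
  qed
  moreover have "countable (\<Union>n. {\<gamma> \<in> carrier G. act \<gamma> u \<in> K n})"
    by (intro countable_UN countableI_type countable_finite finite_return[OF U disj K u])
  ultimately show ?thesis by (rule countable_subset)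
qed

end

section \<open>Unfolding integrals over the group\<close>

lemma hyp_measure_sigma_finite: "sigma_finite_measure hyp_measure"
proof -
  have "sigma_finite_measure (density lborel (\<lambda>z. ennreal (indicator HH z / (Im z)\<^sup>2)))"
    by (subst sigma_finite_measure.sigma_finite_iff_density_finite[OF sigma_finite_lborel]) auto
  then show ?thesis by (simp add: hyp_measure_def)
qed

lemma AE_hyp_measure_iff: "(AE z in hyp_measure. P z) \<longleftrightarrow> (AE z in lborel. z \<in> HH \<longrightarrow> P z)"
proof -
  have "(AE z in hyp_measure. P z) \<longleftrightarrow> (AE z in lborel. 0 < ennreal (indicator HH z / (Im z)\<^sup>2) \<longrightarrow> P z)"
    unfolding hyp_measure_def by (rule AE_density) auto
  also have "(\<lambda>z. 0 < ennreal (indicator HH z / (Im z)\<^sup>2)) = (\<lambda>z. z \<in> HH)"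
    by (auto simp: fun_eq_iff upper_half_plane_def indicator_def)
  finally show ?thesis by simp
qed

lemma AE_hyp_measure_HH: "AE z in hyp_measure. z \<in> HH"
  by (simp add: AE_hyp_measure_iff)

lemma
  fixes f :: "complex \<Rightarrow> 'b :: {banach, second_countable_topology}"
  assumes [measurable]: "f \<in> borel_measurable borel"
  shows integrable_hyp_measure_iff:
      "integrable hyp_measure f \<longleftrightarrow> integrable lborel (\<lambda>z. (indicator HH z / (Im z)\<^sup>2) *\<^sub>R f z)"
    and integral_hyp_measure:
      "integral\<^sup>L hyp_measure f = (LINT z|lborel. (indicator HH z / (Im z)\<^sup>2) *\<^sub>R f z)"
  unfolding hyp_measure_def by (rule integrable_density integral_density; simp)+

context fuchsian
begin

lemma act_measurable: "\<gamma> \<in> carrier G \<Longrightarrow> act \<gamma> \<in> borel_measurable borel"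
  by (rule real_moebius_measurable[OF moebius])

lemma AE_hyp_measure_act:
  assumes "AE z in hyp_measure. P z" "\<gamma> \<in> carrier G"
  shows "AE z in hyp_measure. P (act \<gamma> z)"
proof -
  note [measurable] = act_measurable[OF assms(2)]
  obtain N where N: "N \<in> null_sets hyp_measure" "{z. \<not> P z} \<subseteq> N"
    using assms(1) by (auto simp: eventually_ae_filter)
  have "AE z in distr hyp_measure borel (act \<gamma>). z \<notin> N"
    unfolding distr_hyp_measure[OF moebius[OF assms(2)]] using N AE_not_in by blast
  then have "AE z in hyp_measure. act \<gamma> z \<notin> N"
    using N by (subst (asm) AE_distr_iff) auto
  then show ?thesis by eventually_elim (use N in auto)
qed

lemma
  fixes f h :: "complex \<Rightarrow> 'b :: {banach, second_countable_topology}"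
  assumes g: "\<gamma> \<in> carrier G"
    and [measurable]: "f \<in> borel_measurable borel" "h \<in> borel_measurable borel"
    and ae: "AE z in hyp_measure. f (act \<gamma> z) = h z"
  shows integrable_act_cong: "integrable hyp_measure f \<longleftrightarrow> integrable hyp_measure h"
    and integral_act_cong: "integral\<^sup>L hyp_measure f = integral\<^sup>L hyp_measure h"
proof -
  note [measurable] = act_measurable[OF g]
  have "integrable hyp_measure f \<longleftrightarrow> integrable (distr hyp_measure borel (act \<gamma>)) f"
    by (simp add: distr_hyp_measure[OF moebius[OF g]])
  also have "\<dots> \<longleftrightarrow> integrable hyp_measure (\<lambda>z. f (act \<gamma> z))"
    by (rule integrable_distr_eq) auto
  also have "\<dots> \<longleftrightarrow> integrable hyp_measure h"
    by (rule integrable_cong_AE) (use ae in auto)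
  finally show "integrable hyp_measure f \<longleftrightarrow> integrable hyp_measure h" .
  have "integral\<^sup>L hyp_measure f = integral\<^sup>L (distr hyp_measure borel (act \<gamma>)) f"
    by (simp add: distr_hyp_measure[OF moebius[OF g]])
  also have "\<dots> = (LINT z|hyp_measure. f (act \<gamma> z))"
    by (rule integral_distr) auto
  also have "\<dots> = integral\<^sup>L hyp_measure h"
    by (rule integral_cong_AE) (use ae in auto)
  finally show "integral\<^sup>L hyp_measure f = integral\<^sup>L hyp_measure h" .
qed

text \<open>Almost every orbit meets \<open>F\<close> once, so the plane is cut into translates of
  \<open>F\<close>, and moving each piece back to \<open>F\<close> by an invariant substitution
  replaces \<open>Q\<close> by its sum over the orbit. Beyond measurability, \<open>F\<close> enters
  only through \<open>tile\<close>.\<close>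

theorem unfolding_integral:
  fixes Q \<Omega> :: "complex \<Rightarrow> complex"
  assumes countable: "countable (carrier G)"
    and F [measurable]: "F \<in> sets borel"
    and tile: "AE z in hyp_measure. \<exists>!\<gamma>. \<gamma> \<in> carrier G \<and> act \<gamma> z \<in> F"
    and Q: "integrable hyp_measure Q"
    and \<Omega>: "AE z in hyp_measure. finite {\<gamma> \<in> carrier G. Q (act \<gamma> z) \<noteq> 0} \<and>
              (\<Sum>\<gamma> | \<gamma> \<in> carrier G \<and> Q (act \<gamma> z) \<noteq> 0. Q (act \<gamma> z)) = \<Omega> z"
    and \<Omega>_meas [measurable]: "(\<lambda>z. indicator F z *\<^sub>R \<Omega> z) \<in> borel_measurable borel"
  shows "integrable hyp_measure (\<lambda>z. indicator F z *\<^sub>R \<Omega> z)"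
    and "(LINT z|hyp_measure. indicator F z *\<^sub>R \<Omega> z) = integral\<^sup>L hyp_measure Q"
proof -
  let ?C = "count_space (carrier G)" and ?m = hyp_measure
  interpret m: sigma_finite_measure ?m by (rule hyp_measure_sigma_finite)
  interpret C: sigma_finite_measure ?C by (rule sigma_finite_measure_count_space_countable[OF countable])
  interpret P: pair_sigma_finite ?C ?m ..
  have Q_meas [measurable]: "Q \<in> borel_measurable borel" using borel_measurable_integrable[OF Q] by simp
  \<comment> \<open>\<open>k\<close> carries the translates of \<open>Q\<close> over
    \<open>F\<close>, \<open>k2\<close> the function \<open>Q\<close> over the translates of
    \<open>F\<close>; the substitution by \<open>act \<gamma>\<close> turns one into the
    other.\<close>
  define k where "k = (\<lambda>\<gamma> z. indicator F z *\<^sub>R Q (act \<gamma> z))"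
  define k2 where "k2 = (\<lambda>\<gamma> z. indicator F (act (inv \<gamma>) z) *\<^sub>R Q z)"
  have k_meas1: "k \<gamma> \<in> borel_measurable borel" and k2_meas1: "k2 \<gamma> \<in> borel_measurable borel" if "\<gamma> \<in> carrier G" for \<gamma>
  proof -
    note [measurable] = act_measurable[OF that] act_measurable[OF inv_closed[OF that]]
    show "k \<gamma> \<in> borel_measurable borel" "k2 \<gamma> \<in> borel_measurable borel"
      unfolding k_def k2_def by measurable
  qed
  have k_meas: "case_prod k \<in> borel_measurable (?C \<Otimes>\<^sub>M ?m)"
    and k2_meas: "case_prod k2 \<in> borel_measurable (?C \<Otimes>\<^sub>M ?m)"
    by (rule measurable_pair_measure_countable1[OF countable];
        simp add: k_meas1 k2_meas1 measurable_cong_sets[OF sets_hyp_measure refl])+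
  have kk2: "AE z in ?m. k2 \<gamma> (act \<gamma> z) = k \<gamma> z" if "\<gamma> \<in> carrier G" for \<gamma>
    using AE_hyp_measure_HH by eventually_elim (simp add: k_def k2_def act_inv that)
  have transfer: "integrable ?m (k2 \<gamma>) \<longleftrightarrow> integrable ?m (k \<gamma>)"
    "(LINT z|?m. k2 \<gamma> z) = (LINT z|?m. k \<gamma> z)"
    "(LINT z|?m. norm (k2 \<gamma> z)) = (LINT z|?m. norm (k \<gamma> z))" if g: "\<gamma> \<in> carrier G" for \<gamma>
  proof -
    note [measurable] = k_meas1[OF g] k2_meas1[OF g]
    show "integrable ?m (k2 \<gamma>) \<longleftrightarrow> integrable ?m (k \<gamma>)" "(LINT z|?m. k2 \<gamma> z) = (LINT z|?m. k \<gamma> z)"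
      by (rule integrable_act_cong[OF g _ _ kk2[OF g]] integral_act_cong[OF g _ _ kk2[OF g]]; measurable)+
    have "AE z in ?m. norm (k2 \<gamma> (act \<gamma> z)) = norm (k \<gamma> z)"
      using kk2[OF g] by eventually_elim simp
    then show "(LINT z|?m. norm (k2 \<gamma> z)) = (LINT z|?m. norm (k \<gamma> z))"
      by (intro integral_act_cong[OF g]) auto
  qed
  have k2_sum: "AE z in ?m. integrable ?C (\<lambda>\<gamma>. k2 \<gamma> z) \<and> (LINT \<gamma>|?C. k2 \<gamma> z) = Q z
      \<and> (LINT \<gamma>|?C. norm (k2 \<gamma> z)) = norm (Q z)"
    using tile
  proof eventually_elim
    fix z assume "\<exists>!\<gamma>. \<gamma> \<in> carrier G \<and> act \<gamma> z \<in> F"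
    then obtain \<gamma>0 where g0: "\<gamma>0 \<in> carrier G" "act \<gamma>0 z \<in> F"
      and uniq: "\<And>\<gamma>. \<gamma> \<in> carrier G \<Longrightarrow> act \<gamma> z \<in> F \<Longrightarrow> \<gamma> = \<gamma>0" by auto
    define \<gamma>1 where "\<gamma>1 = inv \<gamma>0"
    have g1: "\<gamma>1 \<in> carrier G" using g0 by (simp add: \<gamma>1_def)
    have k2: "k2 \<gamma> z = (if \<gamma> = \<gamma>1 then Q z else 0)" if "\<gamma> \<in> carrier G" for \<gamma>
    proof (cases "\<gamma> = \<gamma>1")
      case True
      then show ?thesis using g0 by (simp add: k2_def \<gamma>1_def)
    next
      case False
      then have "act (inv \<gamma>) z \<notin> F" using uniq[of "inv \<gamma>"] that g0 by (auto simp: \<gamma>1_def)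
      then show ?thesis using False by (simp add: k2_def)
    qed
    have sub: "{\<gamma> \<in> carrier G. k2 \<gamma> z \<noteq> 0} \<subseteq> {\<gamma>1}" using k2 by (auto split: if_splits)
    have fin: "finite {\<gamma> \<in> carrier G. k2 \<gamma> z \<noteq> 0}" using sub finite_subset by blast
    have "integrable ?C (\<lambda>\<gamma>. indicator {\<gamma>1} \<gamma> *\<^sub>R Q z)"
      by (intro integrable_scaleR_left integrable_real_indicator) (use g1 in auto)
    then have "integrable ?C (\<lambda>\<gamma>. k2 \<gamma> z)"
      by (rule Bochner_Integration.integrable_cong[THEN iffD1, rotated -1]) (auto simp: k2)
    moreover have "(LINT \<gamma>|?C. k2 \<gamma> z) = Q z"
    proof -
      have "(LINT \<gamma>|?C. k2 \<gamma> z) = (\<Sum>\<gamma> | \<gamma> \<in> carrier G \<and> k2 \<gamma> z \<noteq> 0. k2 \<gamma> z)"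
        by (rule lebesgue_integral_count_space_finite_support[OF fin])
      also have "\<dots> = (\<Sum>\<gamma>\<in>{\<gamma>1}. k2 \<gamma> z)"
        by (rule sum.mono_neutral_left) (use sub g1 in auto)
      finally show ?thesis using k2[OF g1] by simp
    qed
    moreover have "(LINT \<gamma>|?C. norm (k2 \<gamma> z)) = norm (Q z)"
    proof -
      have "(LINT \<gamma>|?C. norm (k2 \<gamma> z)) = (\<Sum>\<gamma> | \<gamma> \<in> carrier G \<and> norm (k2 \<gamma> z) \<noteq> 0. norm (k2 \<gamma> z))"
        by (rule lebesgue_integral_count_space_finite_support) (use fin in simp)
      also have "\<dots> = (\<Sum>\<gamma>\<in>{\<gamma>1}. norm (k2 \<gamma> z))"
        by (rule sum.mono_neutral_left) (use sub g1 in auto)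
      finally show ?thesis using k2[OF g1] by simp
    qed
    ultimately show "integrable ?C (\<lambda>\<gamma>. k2 \<gamma> z) \<and> (LINT \<gamma>|?C. k2 \<gamma> z) = Q z
      \<and> (LINT \<gamma>|?C. norm (k2 \<gamma> z)) = norm (Q z)" by blast
  qed
  \<comment> \<open>Absolute integrability on the product is checked for \<open>k2\<close>, whose
    absolute values sum to |Q| over the group; \<open>transfer\<close> then hands it on to
    \<open>k\<close>.\<close>
  have int2: "integrable (?C \<Otimes>\<^sub>M ?m) (case_prod k2)"
  proof -
    interpret P': pair_sigma_finite ?m ?C ..
    have sw: "(\<lambda>(z, \<gamma>). k2 \<gamma> z) \<in> borel_measurable (?m \<Otimes>\<^sub>M ?C)"
      using measurable_pair_swap[OF k2_meas] by simp
    have "integrable (?m \<Otimes>\<^sub>M ?C) (\<lambda>(z, \<gamma>). k2 \<gamma> z)"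
    proof (rule P'.Fubini_integrable[OF sw])
      have "(\<lambda>z. LINT \<gamma>|?C. norm (case (z, \<gamma>) of (z, \<gamma>) \<Rightarrow> k2 \<gamma> z)) \<in> borel_measurable ?m"
        by (rule C.borel_measurable_lebesgue_integral) (use sw in \<open>simp add: case_prod_unfold\<close>)
      then show "integrable ?m (\<lambda>z. LINT \<gamma>|?C. norm (case (z, \<gamma>) of (z, \<gamma>) \<Rightarrow> k2 \<gamma> z))"
        using k2_sum by (subst integrable_cong_AE[where g = "\<lambda>z. norm (Q z)"]) (auto intro: Q)
      show "AE z in ?m. integrable ?C (\<lambda>\<gamma>. case (z, \<gamma>) of (z, \<gamma>) \<Rightarrow> k2 \<gamma> z)"
        using k2_sum by eventually_elim simp
    qed
    from P'.integrable_product_swap[OF this] show ?thesis by (simp add: case_prod_unfold)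
  qed
  have int1: "integrable (?C \<Otimes>\<^sub>M ?m) (case_prod k)"
  proof (rule P.Fubini_integrable[OF k_meas])
    have "integrable ?C (\<lambda>\<gamma>. LINT z|?m. norm (k2 \<gamma> z))"
      using P.integrable_fst'[OF integrable_norm[OF int2]] by simp
    then show "integrable ?C (\<lambda>\<gamma>. LINT z|?m. norm (case (\<gamma>, z) of (\<gamma>, z) \<Rightarrow> k \<gamma> z))"
      by (rule Bochner_Integration.integrable_cong[THEN iffD1, rotated -1]) (simp_all add: transfer)
    have "AE \<gamma> in ?C. integrable ?m (\<lambda>z. k2 \<gamma> z)"
      using P.AE_integrable_fst'[OF int2] by simp
    then show "AE \<gamma> in ?C. integrable ?m (\<lambda>z. case (\<gamma>, z) of (\<gamma>, z) \<Rightarrow> k \<gamma> z)"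
      by (auto simp: AE_count_space transfer)
  qed
  have k_sum: "AE z in ?m. (LINT \<gamma>|?C. k \<gamma> z) = indicator F z *\<^sub>R \<Omega> z"
    using \<Omega>
  proof eventually_elim
    fix z assume *: "finite {\<gamma> \<in> carrier G. Q (act \<gamma> z) \<noteq> 0} \<and>
              (\<Sum>\<gamma> | \<gamma> \<in> carrier G \<and> Q (act \<gamma> z) \<noteq> 0. Q (act \<gamma> z)) = \<Omega> z"
    have "(LINT \<gamma>|?C. k \<gamma> z) = indicator F z *\<^sub>R (LINT \<gamma>|?C. Q (act \<gamma> z))"
      unfolding k_def by simp
    also have "(LINT \<gamma>|?C. Q (act \<gamma> z)) = \<Omega> z"
      using * by (subst lebesgue_integral_count_space_finite_support) auto
    finally show "(LINT \<gamma>|?C. k \<gamma> z) = indicator F z *\<^sub>R \<Omega> z" .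
  qed
  have k_int: "integrable ?m (\<lambda>z. LINT \<gamma>|?C. k \<gamma> z)"
    using P.integrable_snd[OF int1] by simp
  have \<Omega>_m: "(\<lambda>z. indicator F z *\<^sub>R \<Omega> z) \<in> borel_measurable ?m"
    by measurable
  show "integrable ?m (\<lambda>z. indicator F z *\<^sub>R \<Omega> z)"
    by (rule integrable_cong_AE[OF borel_measurable_integrable[OF k_int] \<Omega>_m k_sum, THEN iffD1, OF k_int])
  have "(LINT z|?m. indicator F z *\<^sub>R \<Omega> z) = (LINT z|?m. LINT \<gamma>|?C. k \<gamma> z)"
    by (rule integral_cong_AE[OF borel_measurable_integrable[OF k_int] \<Omega>_m k_sum, symmetric])
  also have "\<dots> = (LINT \<gamma>|?C. LINT z|?m. k \<gamma> z)"
    by (rule P.Fubini_integral[OF int1])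
  also have "\<dots> = (LINT \<gamma>|?C. LINT z|?m. k2 \<gamma> z)"
    by (rule Bochner_Integration.integral_cong) (auto simp: transfer)
  also have "\<dots> = (LINT z|?m. LINT \<gamma>|?C. k2 \<gamma> z)"
    by (rule P.Fubini_integral[OF int2, symmetric])
  also have "\<dots> = integral\<^sup>L ?m Q"
    using k2_sum P.integrable_snd[OF int2] Q
    by (intro integral_cong_AE) (auto intro: borel_measurable_integrable)
  finally show "(LINT z|?m. indicator F z *\<^sub>R \<Omega> z) = integral\<^sup>L ?m Q" .
qed

end

section \<open>Sums over the sides of the polygon\<close>

text \<open>\<open>A k \<gamma>\<close> and \<open>B k \<gamma>\<close> stand for the contributions
  of the sides a_k and b_k translated by \<gamma>. The word a_k b_k a_k^-1 b_k^-1 runs through the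
  translate of a_k by R_(k-1) forwards and another one backwards, and likewise for b_k. Arbitrary
  values allow integrals, kernels and traces to be treated alike.\<close>

definition polygon_sum :: "('g, 'm) monoid_scheme \<Rightarrow> nat \<Rightarrow> (nat \<Rightarrow> 'g) \<Rightarrow> (nat \<Rightarrow> 'g) \<Rightarrow>
    (nat \<Rightarrow> 'g \<Rightarrow> 'x) \<Rightarrow> (nat \<Rightarrow> 'g \<Rightarrow> 'x) \<Rightarrow> 'x :: ab_group_add" where
  "polygon_sum G g a b A B = (\<Sum>k=1..g.
      (A k (comm_prod G a b (k - 1))
        - A k (comm_prod G a b (k - 1) \<otimes>\<^bsub>G\<^esub> a k \<otimes>\<^bsub>G\<^esub> b k \<otimes>\<^bsub>G\<^esub> inv\<^bsub>G\<^esub> a k))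
      + (B k (comm_prod G a b (k - 1) \<otimes>\<^bsub>G\<^esub> a k) - B k (comm_prod G a b k)))"

locale surface_relation = group G for G :: "('g, 'm) monoid_scheme" (structure) +
  fixes g :: nat and a b :: "nat \<Rightarrow> 'g"
  assumes a_closed: "k \<in> {1..g} \<Longrightarrow> a k \<in> carrier G"
    and b_closed: "k \<in> {1..g} \<Longrightarrow> b k \<in> carrier G"
    and relation: "comm_prod G a b g = \<one>"
begin

abbreviation "R \<equiv> comm_prod G a b"
abbreviation "corner k \<equiv> R (k - 1) \<otimes> a k \<otimes> b k \<otimes> inv a k"
abbreviation "psum \<equiv> polygon_sum G g a b"

lemma R_closed: "k \<le> g \<Longrightarrow> R k \<in> carrier G"
  by (induction k) (auto simp: a_closed b_closed)

lemma R_step: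
  assumes "k \<in> {1..g}"
  shows "R k = corner k \<otimes> inv b k"
proof -
  obtain j where j: "k = Suc j" using assms by (cases k) auto
  then have "R j \<in> carrier G" "a k \<in> carrier G" "b k \<in> carrier G"
    using assms by (auto simp: R_closed a_closed b_closed)
  then show ?thesis by (simp add: j m_assoc)
qed

lemma
  assumes "k \<in> {1..g}"
  shows vertex_closed: "R (k - 1) \<in> carrier G" "R (k - 1) \<otimes> a k \<in> carrier G"
      "corner k \<in> carrier G" "R k \<in> carrier G"
    and vertex_eqs: "corner k \<otimes> a k = R (k - 1) \<otimes> a k \<otimes> b k"
      "R k \<otimes> b k = corner k"
proof -
  have c: "R (k - 1) \<in> carrier G" "a k \<in> carrier G" "b k \<in> carrier G"
    using assms by (auto simp: R_closed a_closed b_closed)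
  then show "R (k - 1) \<in> carrier G" "R (k - 1) \<otimes> a k \<in> carrier G"
      "corner k \<in> carrier G" by auto
  show "R k \<in> carrier G" using assms by (simp add: R_closed)
  show "corner k \<otimes> a k = R (k - 1) \<otimes> a k \<otimes> b k"
    using c by (simp add: m_assoc)
  show "R k \<otimes> b k = corner k"
    using c by (simp add: R_step[OF assms] m_assoc)
qed

definition vertices :: "'g set" where
  "vertices = (\<Union>k\<in>{1..g}. {R (k - 1), R (k - 1) \<otimes> a k, corner k, R k})"

lemma finite_vertices: "finite vertices"
  by (simp add: vertices_def)

lemma vertices_carrier: "\<gamma> \<in> vertices \<Longrightarrow> \<gamma> \<in> carrier G"
  unfolding vertices_def using vertex_closed by blast

lemma polygon_sum_cong:
  assumes "\<And>k \<gamma>. k \<in> {1..g} \<Longrightarrow> \<gamma> \<in> vertices \<Longrightarrow> A k \<gamma> = A' k \<gamma>"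
    and "\<And>k \<gamma>. k \<in> {1..g} \<Longrightarrow> \<gamma> \<in> vertices \<Longrightarrow> B k \<gamma> = B' k \<gamma>"
  shows "psum A B = psum A' B'"
  unfolding polygon_sum_def
proof (rule sum.cong[OF refl])
  fix k assume k: "k \<in> {1..g}"
  then have "R (k - 1) \<in> vertices" "R (k - 1) \<otimes> a k \<in> vertices"
    "corner k \<in> vertices" "R k \<in> vertices"
    unfolding vertices_def by blast+
  then show "A k (R (k - 1)) - A k (corner k) + (B k (R (k - 1) \<otimes> a k) - B k (R k)) =
    A' k (R (k - 1)) - A' k (corner k) + (B' k (R (k - 1) \<otimes> a k) - B' k (R k))"
    using assms[OF k] by simp
qed

lemma polygon_sum_add:
  "psum (\<lambda>k \<gamma>. A k \<gamma> + A' k \<gamma>) (\<lambda>k \<gamma>. B k \<gamma> + B' k \<gamma>) = psum A B + psum A' B'"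
  unfolding polygon_sum_def sum.distrib[symmetric] by (rule sum.cong) (auto simp: algebra_simps)

lemma polygon_sum_diff:
  "psum (\<lambda>k \<gamma>. A k \<gamma> - A' k \<gamma>) (\<lambda>k \<gamma>. B k \<gamma> - B' k \<gamma>) = psum A B - psum A' B'"
  unfolding polygon_sum_def sum_subtractf[symmetric] by (rule sum.cong) (auto simp: algebra_simps)

lemma polygon_sum_mult:
  fixes c :: "'x :: ring"
  shows "psum (\<lambda>k \<gamma>. c * A k \<gamma>) (\<lambda>k \<gamma>. c * B k \<gamma>) = c * psum A B"
  unfolding polygon_sum_def sum_distrib_left by (rule sum.cong) (auto simp: algebra_simps)

text \<open>Every side occurs once with each orientation, so contributions that do not depend on the
  translate cancel.\<close>

lemma polygon_sum_const: "psum (\<lambda>k \<gamma>. c k) (\<lambda>k \<gamma>. d k) = 0"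
  by (simp add: polygon_sum_def)

lemma
  fixes A B :: "nat \<Rightarrow> 'g \<Rightarrow> 'y \<Rightarrow> complex"
  assumes "\<And>k \<gamma>. k \<in> {1..g} \<Longrightarrow> \<gamma> \<in> carrier G \<Longrightarrow> integrable M (A k \<gamma>)"
    and "\<And>k \<gamma>. k \<in> {1..g} \<Longrightarrow> \<gamma> \<in> carrier G \<Longrightarrow> integrable M (B k \<gamma>)"
  shows integrable_polygon_sum: "integrable M (\<lambda>y. psum (\<lambda>k \<gamma>. A k \<gamma> y) (\<lambda>k \<gamma>. B k \<gamma> y))"
    and integral_polygon_sum: "(LINT y|M. psum (\<lambda>k \<gamma>. A k \<gamma> y) (\<lambda>k \<gamma>. B k \<gamma> y)) =
      psum (\<lambda>k \<gamma>. integral\<^sup>L M (A k \<gamma>)) (\<lambda>k \<gamma>. integral\<^sup>L M (B k \<gamma>))"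
proof -
  define D where "D = (\<lambda>k y. A k (R (k - 1)) y - A k (corner k) y + (B k (R (k - 1) \<otimes> a k) y - B k (R k) y))"
  have D: "has_bochner_integral M (D k) (integral\<^sup>L M (A k (R (k - 1))) - integral\<^sup>L M (A k (corner k)) +
      (integral\<^sup>L M (B k (R (k - 1) \<otimes> a k)) - integral\<^sup>L M (B k (R k))))" if k: "k \<in> {1..g}" for k
    unfolding D_def using vertex_closed[OF k]
    by (intro has_bochner_integral_add has_bochner_integral_diff has_bochner_integral_integrable assms k)
  have *: "has_bochner_integral M (\<lambda>y. \<Sum>k=1..g. D k y) (psum (\<lambda>k \<gamma>. integral\<^sup>L M (A k \<gamma>)) (\<lambda>k \<gamma>. integral\<^sup>L M (B k \<gamma>)))"
    unfolding polygon_sum_def by (rule has_bochner_integral_sum[OF D])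
  show "integrable M (\<lambda>y. psum (\<lambda>k \<gamma>. A k \<gamma> y) (\<lambda>k \<gamma>. B k \<gamma> y))"
    "(LINT y|M. psum (\<lambda>k \<gamma>. A k \<gamma> y) (\<lambda>k \<gamma>. B k \<gamma> y)) =
      psum (\<lambda>k \<gamma>. integral\<^sup>L M (A k \<gamma>)) (\<lambda>k \<gamma>. integral\<^sup>L M (B k \<gamma>))"
    using * unfolding D_def polygon_sum_def has_bochner_integral_iff by blast+
qed

text \<open>The chain has no boundary: successive sides share a vertex, the differences collapse to
  \<open>H (R g) - H (R 0)\<close>, and the surface relation identifies the two ends.\<close>

lemma polygon_sum_telescope:
  "psum (\<lambda>k \<gamma>. H (\<gamma> \<otimes> a k) - H \<gamma>) (\<lambda>k \<gamma>. H (\<gamma> \<otimes> b k) - H \<gamma>) = 0"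
proof -
  have "psum (\<lambda>k \<gamma>. H (\<gamma> \<otimes> a k) - H \<gamma>) (\<lambda>k \<gamma>. H (\<gamma> \<otimes> b k) - H \<gamma>) =
      (\<Sum>k=1..g. H (R k) - H (R (k - 1)))"
    unfolding polygon_sum_def by (rule sum.cong[OF refl]) (simp only: vertex_eqs, simp)
  also have "\<dots> = H (R g) - H (R 0)"
    by (induction g) auto
  also have "\<dots> = 0" by (simp add: relation)
  finally show ?thesis .
qed

end

section \<open>Matrices, conjugation and the trace\<close>

lemma matrix_mult_add_right: "(A :: complex^'n^'m) ** (B + C) = A ** B + A ** C"
  by (simp add: vec_eq_iff matrix_matrix_mult_def sum.distrib distrib_left)

lemma matrix_mult_add_left: "(B + C) ** (A :: complex^'n^'m) = B ** A + C ** A"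
  by (simp add: vec_eq_iff matrix_matrix_mult_def sum.distrib distrib_right)

lemma matrix_mult_diff_right: "(A :: complex^'n^'m) ** (B - C) = A ** B - A ** C"
  by (simp add: vec_eq_iff matrix_matrix_mult_def sum_subtractf right_diff_distrib)

lemma matrix_mult_diff_left: "(B - C) ** (A :: complex^'n^'m) = B ** A - C ** A"
  by (simp add: vec_eq_iff matrix_matrix_mult_def sum_subtractf left_diff_distrib)

lemma
  fixes A :: "complex^'n^'n"
  assumes "invertible A"
  shows matrix_inv_right: "A ** matrix_inv A = mat 1"
    and matrix_inv_left: "matrix_inv A ** A = mat 1"
  using someI_ex[OF assms[unfolded invertible_def]] by (auto simp: matrix_inv_def)

lemma matrix_inv_unique:
  fixes A B :: "complex^'n^'n"
  assumes "A ** B = mat 1" "B ** A = mat 1"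
  shows "matrix_inv A = B"
proof -
  have "invertible A" using assms by (auto simp: invertible_def)
  then have "matrix_inv A ** (A ** B) = B" by (simp add: matrix_mul_assoc matrix_inv_left)
  then show ?thesis by (simp add: assms)
qed

definition Ad :: "complex^'n^'n \<Rightarrow> complex^'n^'n \<Rightarrow> complex^'n^'n" where
  "Ad S X = S ** X ** matrix_inv S"

lemma matrix_inv_mult:
  fixes A B :: "complex^'n^'n"
  assumes "invertible A" "invertible B"
  shows "matrix_inv (A ** B) = matrix_inv B ** matrix_inv A"
proof (rule matrix_inv_unique)
  show "A ** B ** (matrix_inv B ** matrix_inv A) = mat 1"
    by (metis assms matrix_inv_right matrix_mul_assoc matrix_mul_rid)
  show "matrix_inv B ** matrix_inv A ** (A ** B) = mat 1"
    by (metis assms matrix_inv_left matrix_mul_assoc matrix_mul_rid)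
qed

lemma Ad_mult: "invertible A \<Longrightarrow> invertible B \<Longrightarrow> Ad (A ** B) X = Ad A (Ad B X)"
  by (simp add: Ad_def matrix_inv_mult matrix_mul_assoc)

lemma Ad_add: "Ad A (X + Y) = Ad A X + Ad A Y"
  by (simp add: Ad_def matrix_mult_add_right matrix_mult_add_left)

lemma Ad_diff: "Ad A (X - Y) = Ad A X - Ad A Y"
  using Ad_add[of A "X - Y" Y] by (simp add: algebra_simps)

lemma trace_Ad:
  assumes "invertible A"
  shows "trace (Ad A X ** Ad A Y) = trace (X ** Y)"
proof -
  have "Ad A X ** Ad A Y = A ** (X ** (matrix_inv A ** A) ** Y ** matrix_inv A)"
    by (simp add: Ad_def matrix_mul_assoc)
  then have "trace (Ad A X ** Ad A Y) = trace (A ** (X ** Y ** matrix_inv A))"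
    by (simp add: assms matrix_inv_left)
  also have "\<dots> = trace (X ** Y ** matrix_inv A ** A)" by (rule trace_mul_sym)
  also have "X ** Y ** matrix_inv A ** A = X ** Y ** (matrix_inv A ** A)" by (simp add: matrix_mul_assoc)
  finally show ?thesis by (simp add: assms matrix_inv_left)
qed

section \<open>The Goldman form as a sum over sides\<close>

locale surface_rep = surface_relation +
  fixes \<sigma> :: "'a \<Rightarrow> complex^'n^'n"
  assumes rep: "mat_representation G \<sigma>"
begin

lemma rep_inv: "\<gamma> \<in> carrier G \<Longrightarrow> invertible (\<sigma> \<gamma>)"
  and rep_mult: "\<gamma> \<in> carrier G \<Longrightarrow> \<delta> \<in> carrier G \<Longrightarrow> \<sigma> (\<gamma> \<otimes> \<delta>) = \<sigma> \<gamma> ** \<sigma> \<delta>"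
  using rep by (auto simp: mat_representation_def)

lemma Ad_rep_mult:
  "\<gamma> \<in> carrier G \<Longrightarrow> \<delta> \<in> carrier G \<Longrightarrow> Ad (\<sigma> (\<gamma> \<otimes> \<delta>)) X = Ad (\<sigma> \<gamma>) (Ad (\<sigma> \<delta>) X)"
  by (simp add: rep_mult Ad_mult rep_inv)

text \<open>The dual generators are quotients of vertices: \<alpha>_k is R_(k-1) times the inverse
  of \<open>corner k\<close>, and \<beta>_k is R_k times the inverse of R_(k-1) a_k. The cocycle
  rule splits each Goldman term into the difference between the two translates of one side.\<close>

theorem goldman_form_eq_polygon_sum:
  assumes cocycle: "\<And>\<gamma> \<delta>. \<gamma> \<in> carrier G \<Longrightarrow> \<delta> \<in> carrier G \<Longrightarrow>
      \<chi>1 (\<gamma> \<otimes> \<delta>) = \<chi>1 \<gamma> + Ad (\<sigma> \<gamma>) (\<chi>1 \<delta>)"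
  shows "goldman_form G g a b \<sigma> \<chi>1 \<chi>2 =
    psum (\<lambda>k \<gamma>. trace (\<chi>1 \<gamma> ** Ad (\<sigma> \<gamma>) (\<chi>2 (a k)))) (\<lambda>k \<gamma>. trace (\<chi>1 \<gamma> ** Ad (\<sigma> \<gamma>) (\<chi>2 (b k))))"
proof -
  \<comment> \<open>The cocycle rule for the product of \<gamma> \<delta>^-1 and \<delta> is solved
    for the first factor; conjugation by \<sigma>(\<gamma> \<delta>^-1) then disappears under the
    trace.\<close>
  have key: "trace (\<chi>1 (\<gamma> \<otimes> inv \<delta>) ** Ad (\<sigma> \<gamma>) Y) =
      trace (\<chi>1 \<gamma> ** Ad (\<sigma> \<gamma>) Y) - trace (\<chi>1 \<delta> ** Ad (\<sigma> \<delta>) Y)"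
    if gd: "\<gamma> \<in> carrier G" "\<delta> \<in> carrier G" for \<gamma> \<delta> Y
  proof -
    let ?\<epsilon> = "\<gamma> \<otimes> inv \<delta>"
    have eps: "?\<epsilon> \<in> carrier G" "?\<epsilon> \<otimes> \<delta> = \<gamma>" using gd by (auto simp: m_assoc)
    have 1: "\<chi>1 ?\<epsilon> = \<chi>1 \<gamma> - Ad (\<sigma> ?\<epsilon>) (\<chi>1 \<delta>)"
      using cocycle[OF eps(1) gd(2)] eps(2) by simp
    have 2: "Ad (\<sigma> \<gamma>) Y = Ad (\<sigma> ?\<epsilon>) (Ad (\<sigma> \<delta>) Y)"
      using Ad_rep_mult[OF eps(1) gd(2)] eps(2) by simp
    have "trace (\<chi>1 ?\<epsilon> ** Ad (\<sigma> \<gamma>) Y) = trace (\<chi>1 \<gamma> ** Ad (\<sigma> \<gamma>) Y) - trace (Ad (\<sigma> ?\<epsilon>) (\<chi>1 \<delta>) ** Ad (\<sigma> \<gamma>) Y)"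
      unfolding 1 by (simp add: matrix_mult_diff_left trace_sub)
    also have "trace (Ad (\<sigma> ?\<epsilon>) (\<chi>1 \<delta>) ** Ad (\<sigma> \<gamma>) Y) = trace (\<chi>1 \<delta> ** Ad (\<sigma> \<delta>) Y)"
      unfolding 2 by (rule trace_Ad[OF rep_inv[OF eps(1)]])
    finally show ?thesis .
  qed
  show ?thesis
    unfolding goldman_form_def Let_def polygon_sum_def Ad_def[symmetric]
  proof (rule sum.cong[OF refl])
    fix k assume k: "k \<in> {1..g}"
    note c = vertex_closed[OF k] a_closed[OF k] b_closed[OF k]
    have 1: "R (k - 1) \<otimes> inv b k \<otimes> inv R k = R (k - 1) \<otimes> inv (corner k)"
      unfolding vertex_eqs(2)[OF k, symmetric] using c by (simp add: inv_mult_group m_assoc)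
    have 2: "R k \<otimes> inv a k \<otimes> inv R (k - 1) = R k \<otimes> inv (R (k - 1) \<otimes> a k)"
      using c by (simp add: inv_mult_group m_assoc)
    show "trace (\<chi>1 (R (k - 1) \<otimes> inv b k \<otimes> inv R k) ** Ad (\<sigma> (R (k - 1))) (\<chi>2 (a k))) -
        trace (\<chi>1 (R k \<otimes> inv a k \<otimes> inv R (k - 1)) ** Ad (\<sigma> (R k)) (\<chi>2 (b k))) =
        trace (\<chi>1 (R (k - 1)) ** Ad (\<sigma> (R (k - 1))) (\<chi>2 (a k))) -
        trace (\<chi>1 (corner k) ** Ad (\<sigma> (corner k)) (\<chi>2 (a k))) +
        (trace (\<chi>1 (R (k - 1) \<otimes> a k) ** Ad (\<sigma> (R (k - 1) \<otimes> a k)) (\<chi>2 (b k))) -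
         trace (\<chi>1 (R k) ** Ad (\<sigma> (R k)) (\<chi>2 (b k))))"
      unfolding 1 2 key[OF c(1,3)] key[OF c(4,2)] by simp
  qed
qed

text \<open>With H(\<gamma>) = tr(\<chi>1(\<gamma>) Ad(\<gamma>) X), the term at \<gamma> for a
  generator \<delta> is H(\<gamma> \<delta>) - H(\<gamma>) - H(\<delta>): the first two parts
  telescope and the last does not see the translate.\<close>

lemma coboundary_polygon_sum:
  assumes cocycle: "\<And>\<gamma> \<delta>. \<gamma> \<in> carrier G \<Longrightarrow> \<delta> \<in> carrier G \<Longrightarrow>
      \<chi>1 (\<gamma> \<otimes> \<delta>) = \<chi>1 \<gamma> + Ad (\<sigma> \<gamma>) (\<chi>1 \<delta>)"
  shows "psum (\<lambda>k \<gamma>. trace (\<chi>1 \<gamma> ** Ad (\<sigma> \<gamma>) (Ad (\<sigma> (a k)) X - X)))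
    (\<lambda>k \<gamma>. trace (\<chi>1 \<gamma> ** Ad (\<sigma> \<gamma>) (Ad (\<sigma> (b k)) X - X))) = 0"
proof -
  define H where "H = (\<lambda>\<gamma>. trace (\<chi>1 \<gamma> ** Ad (\<sigma> \<gamma>) X))"
  have eq: "trace (\<chi>1 \<gamma> ** Ad (\<sigma> \<gamma>) (Ad (\<sigma> \<delta>) X - X)) = (H (\<gamma> \<otimes> \<delta>) - H \<gamma>) + - H \<delta>"
    if gd: "\<gamma> \<in> carrier G" "\<delta> \<in> carrier G" for \<gamma> \<delta>
  proof -
    have "H (\<gamma> \<otimes> \<delta>) = trace (\<chi>1 \<gamma> ** Ad (\<sigma> \<gamma>) (Ad (\<sigma> \<delta>) X)) +
        trace (Ad (\<sigma> \<gamma>) (\<chi>1 \<delta>) ** Ad (\<sigma> \<gamma>) (Ad (\<sigma> \<delta>) X))"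
      using gd by (simp add: H_def cocycle Ad_rep_mult matrix_mult_add_left trace_add)
    also have "trace (Ad (\<sigma> \<gamma>) (\<chi>1 \<delta>) ** Ad (\<sigma> \<gamma>) (Ad (\<sigma> \<delta>) X)) = H \<delta>"
      unfolding H_def by (rule trace_Ad[OF rep_inv[OF gd(1)]])
    finally show ?thesis
      by (simp add: H_def Ad_diff matrix_mult_diff_right trace_sub)
  qed
  have "psum (\<lambda>k \<gamma>. trace (\<chi>1 \<gamma> ** Ad (\<sigma> \<gamma>) (Ad (\<sigma> (a k)) X - X)))
    (\<lambda>k \<gamma>. trace (\<chi>1 \<gamma> ** Ad (\<sigma> \<gamma>) (Ad (\<sigma> (b k)) X - X))) =
    psum (\<lambda>k \<gamma>. (H (\<gamma> \<otimes> a k) - H \<gamma>) + - H (a k)) (\<lambda>k \<gamma>. (H (\<gamma> \<otimes> b k) - H \<gamma>) + - H (b k))"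
    by (rule polygon_sum_cong) (simp_all only: eq a_closed b_closed vertices_carrier)
  also have "\<dots> = 0"
    unfolding polygon_sum_add polygon_sum_telescope polygon_sum_const by simp
  finally show ?thesis .
qed

end

section \<open>The fundamental polygon\<close>

text \<open>The chain rule makes the integrands agree off the finite exceptional set of
  \<open>e\<close>, so the equality holds whether or not the integrals converge.\<close>

lemma contour_integral_holomorphic_comp:
  assumes e: "valid_path e" "path_image e \<subseteq> S" and S: "open S" and h: "h holomorphic_on S"
  shows "contour_integral (h \<circ> e) f = contour_integral e (\<lambda>z. f (h z) * deriv h z)"
proof -
  obtain K where K: "finite K" "e C1_differentiable_on {0..1} - K"
    using e(1) by (auto simp: valid_path_def piecewise_C1_differentiable_on_def)
  have "integral {0..1} (\<lambda>x. f ((h \<circ> e) x) * vector_derivative (h \<circ> e) (at x)) =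
      integral {0..1} (\<lambda>x. f (h (e x)) * deriv h (e x) * vector_derivative e (at x))"
  proof (rule integral_spike[of K])
    show "negligible K" using K(1) by (rule negligible_finite)
    fix x assume x: "x \<in> {0..1} - K"
    have "e differentiable at x" using K(2) x by (auto simp: C1_differentiable_on_eq)
    moreover have "h field_differentiable at (e x)"
      by (rule holomorphic_on_imp_differentiable_at[OF h S]) (use e(2) x in \<open>auto simp: path_image_def\<close>)
    ultimately have "vector_derivative (h \<circ> e) (at x) = vector_derivative e (at x) * deriv h (e x)"
      by (rule vector_derivative_chain_at_general)
    then show "f (h (e x)) * deriv h (e x) * vector_derivative e (at x) =
        f ((h \<circ> e) x) * vector_derivative (h \<circ> e) (at x)"
      by (simp add: mult_ac)
  qed
  then show ?thesis by (simp add: contour_integral_integral)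
qed

lemma sum_lessThan_mult_4:
  fixes f :: "nat \<Rightarrow> 'x :: comm_monoid_add"
  shows "(\<Sum>j<4 * n. f j) = (\<Sum>k=1..n. f (4 * (k - 1)) + f (4 * (k - 1) + 1) + f (4 * (k - 1) + 2) + f (4 * (k - 1) + 3))"
proof (induction n)
  case (Suc n)
  have "4 * Suc n = Suc (Suc (Suc (Suc (4 * n))))" by simp
  then have "(\<Sum>j<4 * Suc n. f j) = (\<Sum>j<4 * n. f j) + f (4 * n) + f (4 * n + 1) + f (4 * n + 2) + f (4 * n + 3)"
    by (simp only: sum.lessThan_Suc) (simp add: eval_nat_numeral)
  then show ?case using Suc by (simp add: add.assoc)
qed simp

locale surface_action = surface_relation G g a b + fuchsian G act
  for G :: "('g, 'm) monoid_scheme" (structure) and g a b act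
begin

lemma prefix_closed: "j \<le> 4 * g \<Longrightarrow> surface_prefix G a b j \<in> carrier G"
proof (induction j)
  case (Suc j)
  have "j div 4 + 1 \<in> {1..g}" using Suc by auto
  from a_closed[OF this] b_closed[OF this] show ?case
    using Suc by (auto simp: surface_letter_def Let_def)
qed simp

text \<open>Edges are numbered from 0 and generators from 1, so the k-th commutator starts at
  \<open>4 * (k - 1)\<close>. The last two edges of a block are reversed and attached at their end
  points, which calls for the prefixes with offsets 3 and 4 instead of 2 and 3.\<close>

lemma prefix_eqs:
  assumes k: "k \<in> {1..g}"
  shows "surface_prefix G a b (4 * (k - 1)) = R (k - 1)"
    "surface_prefix G a b (4 * (k - 1) + 1) = R (k - 1) \<otimes> a k"
    "surface_prefix G a b (4 * (k - 1) + 3) = corner k"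
    "surface_prefix G a b (4 * (k - 1) + 4) = R k"
proof -
  have step: "surface_prefix G a b (4 * j + 1) = surface_prefix G a b (4 * j) \<otimes> a (Suc j)"
    "surface_prefix G a b (4 * j + 3) = surface_prefix G a b (4 * j) \<otimes> a (Suc j) \<otimes> b (Suc j) \<otimes> inv a (Suc j)"
    "surface_prefix G a b (4 * j + 4) =
      surface_prefix G a b (4 * j) \<otimes> a (Suc j) \<otimes> b (Suc j) \<otimes> inv a (Suc j) \<otimes> inv b (Suc j)" for j
  proof -
    have d: "4 * j div 4 = j" "Suc (4 * j) div 4 = j" "Suc (Suc (4 * j)) div 4 = j" "Suc (Suc (Suc (4 * j))) div 4 = j"
      "4 * j mod 4 = 0" "Suc (4 * j) mod 4 = 1" "Suc (Suc (4 * j)) mod 4 = 2" "Suc (Suc (Suc (4 * j))) mod 4 = 3"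
      by presburger+
    have s: "4 * j + 1 = Suc (4 * j)" "4 * j + 3 = Suc (Suc (Suc (4 * j)))" "4 * j + 4 = Suc (Suc (Suc (Suc (4 * j))))"
      by simp_all
    show "surface_prefix G a b (4 * j + 1) = surface_prefix G a b (4 * j) \<otimes> a (Suc j)"
      "surface_prefix G a b (4 * j + 3) = surface_prefix G a b (4 * j) \<otimes> a (Suc j) \<otimes> b (Suc j) \<otimes> inv a (Suc j)"
      "surface_prefix G a b (4 * j + 4) =
        surface_prefix G a b (4 * j) \<otimes> a (Suc j) \<otimes> b (Suc j) \<otimes> inv a (Suc j) \<otimes> inv b (Suc j)"
      unfolding s by (simp_all add: surface_letter_def Let_def d del: mult_Suc_right)
  qed
  have R: "surface_prefix G a b (4 * j) = R j" if "j \<le> g" for j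
    using that
  proof (induction j)
    case (Suc j)
    have "surface_prefix G a b (4 * Suc j) = surface_prefix G a b (4 * j + 4)" by (simp add: add.commute)
    then show ?case using Suc R_step[of "Suc j"] unfolding step(3) by simp
  qed simp
  obtain j where j: "k = Suc j" using k by (cases k) auto
  have "R j = surface_prefix G a b (4 * j)" using R[of j] k j by simp
  then show "surface_prefix G a b (4 * (k - 1)) = R (k - 1)"
    "surface_prefix G a b (4 * (k - 1) + 1) = R (k - 1) \<otimes> a k"
    "surface_prefix G a b (4 * (k - 1) + 3) = corner k"
    "surface_prefix G a b (4 * (k - 1) + 4) = R k"
    unfolding j diff_Suc_1 step using R_step[OF k] j by simp_all
qed

end

locale surface_polygon = surface_action +
  fixes p :: complex and ca cb :: "nat \<Rightarrow> real \<Rightarrow> complex"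
  assumes p: "p \<in> HH"
    and ca: "k \<in> {1..g} \<Longrightarrow> valid_path (ca k) \<and> pathstart (ca k) = p \<and> pathfinish (ca k) = act (a k) p"
    and cb: "k \<in> {1..g} \<Longrightarrow> valid_path (cb k) \<and> pathstart (cb k) = p \<and> pathfinish (cb k) = act (b k) p"
begin

abbreviation "edge \<equiv> polygon_edge G act a b ca cb"
abbreviation "edges \<equiv> polygon_edges G act a b ca cb"
abbreviation "wpre \<equiv> surface_prefix G a b"

lemma edge_ends:
  assumes "j < 4 * g"
  shows "pathstart (edge j) = act (wpre j) p" "pathfinish (edge j) = act (wpre (Suc j)) p"
proof -
  define k where "k = j div 4 + 1"
  have k: "k \<in> {1..g}" using assms by (auto simp: k_def)
  have kk: "Suc (j div 4) = k" by (simp add: k_def)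
  note c = prefix_closed[of j] prefix_closed[of "Suc j"] a_closed[OF k] b_closed[OF k]
  have m: "j mod 4 = 0 \<or> j mod 4 = 1 \<or> j mod 4 = 2 \<or> j mod 4 = 3" by presburger
  show "pathstart (edge j) = act (wpre j) p" "pathfinish (edge j) = act (wpre (Suc j)) p"
    using m c assms ca[OF k] cb[OF k] p
    by (auto simp: polygon_edge_def Let_def kk pathstart_compose pathfinish_compose
        surface_letter_def act_mult[symmetric] m_assoc)
qed

text \<open>\<open>edges m j\<close> joins m + 1 edges, numbered j to j + m; this is why the full
  boundary is \<open>edges (4 * g - 1) 0\<close>.\<close>

lemma edges_path:
  assumes "j + m < 4 * g"
  shows "pathstart (edges m j) = act (wpre j) p \<and> pathfinish (edges m j) = act (wpre (Suc (j + m))) p \<and>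
    path_image (edges m j) = (\<Union>i\<le>m. path_image (edge (j + i)))"
  using assms
proof (induction m arbitrary: j)
  case 0
  then show ?case by (simp add: edge_ends)
next
  case (Suc m)
  have IH: "pathstart (edges m (Suc j)) = act (wpre (Suc j)) p"
    "pathfinish (edges m (Suc j)) = act (wpre (Suc (Suc j + m))) p"
    "path_image (edges m (Suc j)) = (\<Union>i\<le>m. path_image (edge (Suc j + i)))"
    using Suc.IH[of "Suc j"] Suc.prems by auto
  have "path_image (edges (Suc m) j) = path_image (edge j) \<union> path_image (edges m (Suc j))"
    using IH(1) edge_ends[of j] Suc.prems by (simp add: path_image_join)
  also have "\<dots> = (\<Union>i\<le>Suc m. path_image (edge (j + i)))"
    unfolding IH(3) atMost_Suc_eq_insert_0 by (simp add: image_image)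
  finally show ?case using IH edge_ends[of j] Suc.prems by simp
qed

lemma contour_integral_edges:
  assumes "j + m < 4 * g" "\<And>i. i < 4 * g \<Longrightarrow> valid_path (edge i)"
    "\<And>i. i < 4 * g \<Longrightarrow> f contour_integrable_on edge i"
  shows "valid_path (edges m j) \<and> f contour_integrable_on edges m j \<and>
    contour_integral (edges m j) f = (\<Sum>i\<le>m. contour_integral (edge (j + i)) f)"
  using assms(1)
proof (induction m arbitrary: j)
  case 0
  then show ?case by (simp add: assms)
next
  case (Suc m)
  have IH: "valid_path (edges m (Suc j))" "f contour_integrable_on edges m (Suc j)"
    "contour_integral (edges m (Suc j)) f = (\<Sum>i\<le>m. contour_integral (edge (Suc j + i)) f)"
    using Suc.IH[of "Suc j"] Suc.prems by auto
  have j: "valid_path (edge j)" "f contour_integrable_on edge j" "pathfinish (edge j) = pathstart (edges m (Suc j))"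
    using assms(2,3)[of j] edges_path[of "Suc j" m] edge_ends[of j] Suc.prems by auto
  have "contour_integral (edges (Suc m) j) f = contour_integral (edge j) f + contour_integral (edges m (Suc j)) f"
    using j IH by simp
  also have "\<dots> = (\<Sum>i\<le>Suc m. contour_integral (edge (j + i)) f)"
    unfolding IH(3) sum.atMost_Suc_shift by simp
  finally show ?case using j IH by simp
qed

definition boundary :: "real \<Rightarrow> complex" where "boundary = edges (4 * g - 1) 0"

context
  assumes gpos: "g > 0" and bd: "path_image boundary \<subseteq> HH"
begin

lemma boundary_image: "path_image boundary = (\<Union>i<4 * g. path_image (edge i))"
proof -
  have "{..4 * g - 1} = {..<4 * g}" using gpos by auto
  then show ?thesis using edges_path[of 0 "4 * g - 1"] gpos by (simp add: boundary_def)
qed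

lemma boundary_closed: "pathfinish boundary = pathstart boundary"
proof -
  have "wpre (4 * (g - 1) + 4) = \<one>" using prefix_eqs(4)[of g] gpos relation by simp
  moreover have "4 * (g - 1) + 4 = Suc (4 * g - 1)" using gpos by simp
  ultimately show ?thesis using edges_path[of 0 "4 * g - 1"] gpos by (simp add: boundary_def)
qed

lemma edge_eqs:
  assumes k: "k \<in> {1..g}"
  shows "edge (4 * (k - 1)) = act (R (k - 1)) \<circ> ca k"
    "edge (4 * (k - 1) + 1) = act (R (k - 1) \<otimes> a k) \<circ> cb k"
    "edge (4 * (k - 1) + 2) = act (corner k) \<circ> reversepath (ca k)"
    "edge (4 * (k - 1) + 3) = act (R k) \<circ> reversepath (cb k)"
proof -
  obtain j where j: "k = Suc j" using k by (cases k) auto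
  have d: "4 * j div 4 = j" "(4 * j + 1) div 4 = j" "(4 * j + 2) div 4 = j" "(4 * j + 3) div 4 = j"
    "4 * j mod 4 = 0" "(4 * j + 1) mod 4 = 1" "(4 * j + 2) mod 4 = 2" "(4 * j + 3) mod 4 = 3"
    by presburger+
  have s: "Suc (4 * j + 2) = 4 * j + 3" "Suc (4 * j + 3) = 4 * j + 4" by simp_all
  note P = prefix_eqs[OF k, unfolded j diff_Suc_1]
  show "edge (4 * (k - 1)) = act (R (k - 1)) \<circ> ca k"
    "edge (4 * (k - 1) + 1) = act (R (k - 1) \<otimes> a k) \<circ> cb k"
    "edge (4 * (k - 1) + 2) = act (corner k) \<circ> reversepath (ca k)"
    "edge (4 * (k - 1) + 3) = act (R k) \<circ> reversepath (cb k)"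
    unfolding j diff_Suc_1 polygon_edge_def Let_def d s P by simp_all
qed

text \<open>Only the boundary is assumed to lie in \<open>HH\<close>. Each generating path has a
  translate among the edges, and a Moebius map sends no point from outside \<open>HH\<close> into
  it.\<close>

lemma generator_paths_in_HH:
  assumes k: "k \<in> {1..g}"
  shows "path_image (ca k) \<subseteq> HH" "path_image (cb k) \<subseteq> HH"
proof -
  have "4 * (k - 1) < 4 * g" "4 * (k - 1) + 1 < 4 * g" using k by auto
  then have "path_image (edge (4 * (k - 1))) \<subseteq> HH" "path_image (edge (4 * (k - 1) + 1)) \<subseteq> HH"
    using bd boundary_image by blast+
  then show "path_image (ca k) \<subseteq> HH" "path_image (cb k) \<subseteq> HH"
    unfolding edge_eqs[OF k] path_image_compose
    using real_moebius_in_HH_iff[OF moebius[OF vertex_closed(1)[OF k]]]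
      real_moebius_in_HH_iff[OF moebius[OF vertex_closed(2)[OF k]]] by blast+
qed

lemma edge_valid:
  assumes "i < 4 * g"
  shows "valid_path (edge i)"
proof -
  define k where "k = i div 4 + 1"
  have k: "k \<in> {1..g}" using assms by (auto simp: k_def)
  have "valid_path (act \<gamma> \<circ> q)" if "\<gamma> \<in> carrier G" "valid_path q" "path_image q \<subseteq> HH" for \<gamma> q
    by (rule valid_path_compose_holomorphic[OF that(2) real_moebius_holomorphic[OF moebius[OF that(1)]] open_HH that(3)])
  then show ?thesis
    using prefix_closed[of i] prefix_closed[of "Suc i"] assms ca[OF k] cb[OF k] generator_paths_in_HH[OF k]
    unfolding polygon_edge_def Let_def k_def[symmetric] by simp
qed

text \<open>Every edge is a translate of some \<open>ca k\<close> or \<open>cb k\<close>, possibly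
  reversed. Substitution puts the translation into the integrand, and reversal produces the minus
  signs of \<open>polygon_sum\<close>.\<close>

lemma contour_integral_boundary:
  assumes f: "f holomorphic_on S" "open S" "path_image boundary \<subseteq> S"
  shows "contour_integral boundary f =
    psum (\<lambda>k \<gamma>. contour_integral (ca k) (pull f \<gamma>))
         (\<lambda>k \<gamma>. contour_integral (cb k) (pull f \<gamma>))"
proof -
  have int: "f contour_integrable_on edge i" if "i < 4 * g" for i
    by (rule contour_integrable_holomorphic_simple[OF f(1,2) edge_valid[OF that]])
      (use f(3) boundary_image that in auto)
  have comp: "contour_integral (act \<gamma> \<circ> q) f = contour_integral q (pull f \<gamma>)"
    if "\<gamma> \<in> carrier G" "valid_path q" "path_image q \<subseteq> HH" for \<gamma> q
    by (rule contour_integral_holomorphic_comp[OF that(2,3) open_HH real_moebius_holomorphic[OF moebius[OF that(1)]]])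
  have rev: "contour_integral (reversepath q) h = - contour_integral q h" if "valid_path q" for q h
    by (rule contour_integral_reversepath[OF that])
  have "contour_integral boundary f = (\<Sum>i\<le>4 * g - 1. contour_integral (edge (0 + i)) f)"
    unfolding boundary_def using contour_integral_edges[of 0 "4 * g - 1" f] edge_valid int gpos by simp
  also have "{..4 * g - 1} = {..<4 * g}" using gpos by auto
  finally have "contour_integral boundary f = (\<Sum>i<4 * g. contour_integral (edge i) f)" by simp
  also have "\<dots> = psum (\<lambda>k \<gamma>. contour_integral (ca k) (pull f \<gamma>))
         (\<lambda>k \<gamma>. contour_integral (cb k) (pull f \<gamma>))"
    unfolding sum_lessThan_mult_4 polygon_sum_def
  proof (rule sum.cong[OF refl])
    fix k assume k: "k \<in> {1..g}"
    note v = vertex_closed[OF k]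
    note q = generator_paths_in_HH[OF k] ca[OF k] cb[OF k]
    show "contour_integral (edge (4 * (k - 1))) f + contour_integral (edge (4 * (k - 1) + 1)) f +
      contour_integral (edge (4 * (k - 1) + 2)) f + contour_integral (edge (4 * (k - 1) + 3)) f =
      contour_integral (ca k) (pull f (R (k - 1))) - contour_integral (ca k) (pull f (corner k)) +
      (contour_integral (cb k) (pull f (R (k - 1) \<otimes> a k)) - contour_integral (cb k) (pull f (R k)))"
      unfolding edge_eqs[OF k] using q by (simp add: comp[OF v(1)] comp[OF v(2)] comp[OF v(3)] comp[OF v(4)] rev del: One_nat_def)
  qed
  finally show ?thesis .
qed

end
end

section \<open>Comparing curves and sums in the half plane\<close>

lemma contour_integral_convex_eq:
  assumes D: "open D" "convex D" "f holomorphic_on D"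
    and e: "valid_path e" "path_image e \<subseteq> D" "valid_path e'" "path_image e' \<subseteq> D"
    and ends: "pathstart e = pathstart e'" "pathfinish e = pathfinish e'"
  shows "contour_integral e f = contour_integral e' f"
proof -
  obtain P where P: "\<And>z. z \<in> D \<Longrightarrow> (P has_field_derivative f z) (at z within D)"
    using holomorphic_convex_primitive'[OF D(2,1,3)] by blast
  have "(f has_contour_integral P (pathfinish e) - P (pathstart e)) e"
    by (rule contour_integral_primitive[OF P e(1,2)])
  moreover have "(f has_contour_integral P (pathfinish e') - P (pathstart e')) e'"
    by (rule contour_integral_primitive[OF P e(3,4)])
  ultimately show ?thesis by (simp add: contour_integral_unique ends)
qed

text \<open>A compact subset of \<open>HH\<close> keeps a positive height. Boxes are wanted because
  Green's formula for arcs is stated in them, and because they are convex, so that closed chains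
  inside do not see poles outside.\<close>

lemma compact_in_HH_box:
  assumes K: "compact K" "K \<subseteq> HH"
  obtains c d where "K \<subseteq> box c d" "cbox c d \<subseteq> HH" "box c d \<noteq> {}"
proof (cases "K = {}")
  case True
  show ?thesis
    by (rule that[of \<i> "1 + 2 * \<i>"])
      (auto simp: True upper_half_plane_def in_cbox_complex_iff box_ne_empty Basis_complex_def)
next
  case False
  obtain w0 where w0: "w0 \<in> K" "\<And>w. w \<in> K \<Longrightarrow> Im w0 \<le> Im w"
    using continuous_attains_inf[OF K(1) False continuous_on_Im[OF continuous_on_id]] by auto
  obtain M where M: "M > 0" "\<And>w. w \<in> K \<Longrightarrow> norm w \<le> M"
    using compact_imp_bounded[OF K(1)] by (auto simp: bounded_pos)
  have pos: "Im w0 > 0" using w0 K by (auto simp: upper_half_plane_def)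
  define c d where "c = Complex (- M - 1) (Im w0 / 2)" and "d = Complex (M + 1) (M + 1)"
  have sub: "K \<subseteq> box c d"
  proof
    fix w assume w: "w \<in> K"
    show "w \<in> box c d"
      using w0(2)[OF w] M(2)[OF w] abs_Re_le_cmod[of w] abs_Im_le_cmod[of w] pos
      by (auto simp: in_box_complex_iff c_def d_def)
  qed
  show ?thesis
    by (rule that[of c d]) (use sub pos w0 in \<open>auto simp: c_def in_cbox_complex_iff upper_half_plane_def\<close>)
qed

lemma has_sum_sum_finite:
  fixes f :: "'i \<Rightarrow> 'x \<Rightarrow> complex"
  assumes "finite I" "\<And>i. i \<in> I \<Longrightarrow> (f i has_sum s i) A"
  shows "((\<lambda>x. \<Sum>i\<in>I. f i x) has_sum (\<Sum>i\<in>I. s i)) A"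
  using assms by (induction I rule: finite_induct) (auto intro: has_sum_add)

lemma has_sum_minus:
  fixes f h :: "'x \<Rightarrow> complex"
  assumes "(f has_sum s) A" "(h has_sum t) A"
  shows "((\<lambda>x. f x - h x) has_sum (s - t)) A"
  using has_sum_add[OF assms(1), of "\<lambda>x. - h x" "- t"] assms(2) by (simp add: has_sum_uminus)

text \<open>Subtracting the pole at the mirror point makes the Cauchy kernel invariant under real
  Moebius maps without changing its integral over closed curves in the half plane.\<close>
definition pole_kernel :: "complex \<Rightarrow> complex \<Rightarrow> complex" where
  "pole_kernel \<zeta> w = 1 / (w - \<zeta>) - 1 / (w - cnj \<zeta>)"

lemma pole_kernel_holomorphic:
  assumes "\<zeta> \<in> HH" shows "pole_kernel \<zeta> holomorphic_on HH - {\<zeta>}"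
  unfolding pole_kernel_def
  by (intro holomorphic_intros) (use assms in \<open>auto simp: upper_half_plane_def complex_eq_iff\<close>)

lemma inverse_diff_cnj_holomorphic:
  assumes "\<zeta> \<in> HH" shows "(\<lambda>w. 1 / (w - cnj \<zeta>)) holomorphic_on HH"
  by (intro holomorphic_intros) (use assms in \<open>auto simp: upper_half_plane_def complex_eq_iff\<close>)

section \<open>Winding numbers of the polygon summed over orbits\<close>

locale fundamental_polygon = surface_polygon +
  assumes gpos: "g > 0" and bd: "path_image boundary \<subseteq> HH"
    and bd_valid: "valid_path boundary"
    and wn: "z \<notin> path_image boundary \<Longrightarrow> winding_number boundary z = 0 \<or> winding_number boundary z = 1"
    and inside_ne: "{z. z \<notin> path_image boundary \<and> winding_number boundary z = 1} \<noteq> {}"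
    and cover: "(\<Union>\<gamma>\<in>carrier G. act \<gamma> `
        ({z. z \<notin> path_image boundary \<and> winding_number boundary z = 1} \<union> path_image boundary)) = HH"
    and disjoint: "\<gamma> \<in> carrier G \<Longrightarrow> \<gamma> \<noteq> \<one> \<Longrightarrow>
        act \<gamma> ` {z. z \<notin> path_image boundary \<and> winding_number boundary z = 1}
          \<inter> {z. z \<notin> path_image boundary \<and> winding_number boundary z = 1} = {}"
begin

definition polygon_interior :: "complex set" where
  "polygon_interior = {z. z \<notin> path_image boundary \<and> winding_number boundary z = 1}"

lemma bd_closed: "pathfinish boundary = pathstart boundary"
  by (rule boundary_closed[OF gpos bd])

lemma polygon_interior_open: "open polygon_interior"
  unfolding polygon_interior_def using open_winding_number_levelsets[OF valid_path_imp_path[OF bd_valid] bd_closed] by simp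

lemma polygon_interior_HH: "polygon_interior \<subseteq> HH"
proof
  fix z assume z: "z \<in> polygon_interior"
  show "z \<in> HH"
  proof (rule ccontr)
    assume "z \<notin> HH"
    then have "winding_number boundary z = 0"
      using winding_number_zero_outside[OF valid_path_imp_path[OF bd_valid] convex_HH bd_closed _ bd] by blast
    then show False using z by (simp add: polygon_interior_def)
  qed
qed

lemma finite_translates:
  assumes "compact K" "K \<subseteq> HH" "z \<in> HH"
  shows "finite {\<gamma> \<in> carrier G. act \<gamma> z \<in> K}"
proof -
  obtain u where "u \<in> polygon_interior" using inside_ne by (auto simp: polygon_interior_def)
  then show ?thesis
    using finite_return[OF polygon_interior_open polygon_interior_HH _ disjoint[folded polygon_interior_def] assms] by blast
qed

lemma countable_G: "countable (carrier G)"
proof -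
  obtain u where "u \<in> polygon_interior" using inside_ne by (auto simp: polygon_interior_def)
  then show ?thesis
    using countable_carrier[OF polygon_interior_open polygon_interior_HH _ disjoint[folded polygon_interior_def]] by blast
qed

text \<open>A valid path may be non-rectifiable at finitely many points, so the non-holomorphic integrand
  of Green's formula is only ever integrated along the segments below;
  along the given curves only holomorphic functions are.\<close>
definition la :: "nat \<Rightarrow> real \<Rightarrow> complex" where "la k = linepath p (act (a k) p)"
definition lb :: "nat \<Rightarrow> real \<Rightarrow> complex" where "lb k = linepath p (act (b k) p)"

definition pole_integral :: "(real \<Rightarrow> complex) \<Rightarrow> complex \<Rightarrow> complex" where
  "pole_integral e \<zeta> = contour_integral e (pole_kernel \<zeta>)"

text \<open>2 pi i times the winding number of the chain of translated segments. By invariance of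
  the kernel the translation is moved from the segment to the point, so that summing over an orbit
  merely permutes the terms.\<close>

definition straight_winding :: "complex \<Rightarrow> complex" where
  "straight_winding \<zeta> = psum (\<lambda>k \<gamma>. pole_integral (la k) (act (inv \<gamma>) \<zeta>)) (\<lambda>k \<gamma>. pole_integral (lb k) (act (inv \<gamma>) \<zeta>))"

definition edge_curves :: "complex set" where
  "edge_curves = path_image boundary \<union>
     (\<Union>k\<in>{1..g}. path_image (ca k) \<union> path_image (cb k) \<union> path_image (la k) \<union> path_image (lb k))"

lemma la_props:
  assumes "k \<in> {1..g}"
  shows "path_image (la k) \<subseteq> HH" "path_image (lb k) \<subseteq> HH" "valid_path (la k)" "valid_path (lb k)"
    "pathstart (la k) = p" "pathstart (lb k) = p" "pathfinish (la k) = act (a k) p" "pathfinish (lb k) = act (b k) p"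
  using closed_segment_subset[OF p act_HH[OF a_closed[OF assms] p] convex_HH]
    closed_segment_subset[OF p act_HH[OF b_closed[OF assms] p] convex_HH]
  by (auto simp: la_def lb_def)

lemma pole_integral_translate:
  assumes g: "\<gamma> \<in> carrier G" and \<zeta>: "\<zeta> \<in> HH" and e: "path_image e \<subseteq> HH" "act (inv \<gamma>) \<zeta> \<notin> path_image e"
  shows "contour_integral e (pull (pole_kernel \<zeta>) \<gamma>) = pole_integral e (act (inv \<gamma>) \<zeta>)"
  unfolding pole_integral_def
proof (rule contour_integral_eq)
  fix w assume w: "w \<in> path_image e"
  have z: "act (inv \<gamma>) \<zeta> \<in> HH" using g \<zeta> by (simp add: act_HH)
  have "deriv (act \<gamma>) w * (1 / (act \<gamma> w - act \<gamma> (act (inv \<gamma>) \<zeta>)) - 1 / (act \<gamma> w - cnj (act \<gamma> (act (inv \<gamma>) \<zeta>)))) =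
      1 / (w - act (inv \<gamma>) \<zeta>) - 1 / (w - cnj (act (inv \<gamma>) \<zeta>))"
    by (rule real_moebius_kernel[OF moebius[OF g] z]) (use w e in auto)
  then show "pole_kernel \<zeta> (act \<gamma> w) * deriv (act \<gamma>) w = pole_kernel (act (inv \<gamma>) \<zeta>) w"
    using g \<zeta> by (simp add: pole_kernel_def act_inv' mult.commute)
qed

text \<open>A group-invariant condition that holds almost everywhere, so an identity for generic
  points applies to a whole orbit at once.\<close>

definition generic :: "complex \<Rightarrow> bool" where
  "generic z \<longleftrightarrow> z \<in> HH \<and> (\<forall>\<gamma>\<in>carrier G. act \<gamma> z \<notin> edge_curves)"

lemma generic_act: "generic z \<Longrightarrow> \<gamma> \<in> carrier G \<Longrightarrow> generic (act \<gamma> z)"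
  unfolding generic_def by (auto simp: act_HH) (metis act_mult m_closed)

lemma generic_not_on_edges: "generic z \<Longrightarrow> z \<notin> edge_curves"
  unfolding generic_def by (metis act_one one_closed)

text \<open>The mirror pole may be added for free: it lies below the half plane, where the closed
  boundary does not wind around it. The resulting kernel is invariant and can be pulled back to the
  generating paths.\<close>

lemma winding_number_eq_polygon_sum:
  assumes z: "generic \<zeta>"
  shows "2 * pi * \<i> * winding_number boundary \<zeta> =
    psum (\<lambda>k \<gamma>. pole_integral (ca k) (act (inv \<gamma>) \<zeta>)) (\<lambda>k \<gamma>. pole_integral (cb k) (act (inv \<gamma>) \<zeta>))"
proof -
  have \<zeta>: "\<zeta> \<in> HH" "\<zeta> \<notin> path_image boundary"
    using z generic_not_on_edges[OF z] by (auto simp: generic_def edge_curves_def)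
  have open': "open (HH - {\<zeta>})" using open_HH by blast
  have sub: "path_image boundary \<subseteq> HH - {\<zeta>}" using bd \<zeta> by auto
  have hk: "pole_kernel \<zeta> contour_integrable_on boundary"
    by (rule contour_integrable_holomorphic_simple[OF pole_kernel_holomorphic[OF \<zeta>(1)] open' bd_valid sub])
  have hc: "((\<lambda>w. 1 / (w - cnj \<zeta>)) has_contour_integral 0) boundary"
    by (rule Cauchy_theorem_convex_simple[OF inverse_diff_cnj_holomorphic[OF \<zeta>(1)] convex_HH bd_valid bd bd_closed])
  have "2 * pi * \<i> * winding_number boundary \<zeta> = contour_integral boundary (\<lambda>w. 1 / (w - \<zeta>))"
    using winding_number_valid_path[OF bd_valid \<zeta>(2)] by simp
  also have "\<dots> = contour_integral boundary (\<lambda>w. pole_kernel \<zeta> w + 1 / (w - cnj \<zeta>))"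
    by (simp add: pole_kernel_def)
  also have "\<dots> = contour_integral boundary (pole_kernel \<zeta>)"
    using has_contour_integral_add[OF has_contour_integral_integral[OF hk] hc]
    by (simp add: contour_integral_unique)
  also have "\<dots> = psum (\<lambda>k \<gamma>. contour_integral (ca k) (pull (pole_kernel \<zeta>) \<gamma>))
         (\<lambda>k \<gamma>. contour_integral (cb k) (pull (pole_kernel \<zeta>) \<gamma>))"
    by (rule contour_integral_boundary[OF gpos bd pole_kernel_holomorphic[OF \<zeta>(1)] open' sub])
  also have "\<dots> = psum (\<lambda>k \<gamma>. pole_integral (ca k) (act (inv \<gamma>) \<zeta>)) (\<lambda>k \<gamma>. pole_integral (cb k) (act (inv \<gamma>) \<zeta>))"
  proof (rule polygon_sum_cong)
    fix k \<gamma> assume k: "k \<in> {1..g}" and g: "\<gamma> \<in> vertices"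
    have inv: "inv \<gamma> \<in> carrier G" using vertices_carrier[OF g] by simp
    have "act (inv \<gamma>) \<zeta> \<notin> edge_curves" using generic_not_on_edges[OF generic_act[OF z inv]] .
    then have n: "act (inv \<gamma>) \<zeta> \<notin> path_image (ca k)" "act (inv \<gamma>) \<zeta> \<notin> path_image (cb k)"
      using k unfolding edge_curves_def by blast+
    show "contour_integral (ca k) (pull (pole_kernel \<zeta>) \<gamma>) = pole_integral (ca k) (act (inv \<gamma>) \<zeta>)"
      by (rule pole_integral_translate[OF vertices_carrier[OF g] \<zeta>(1) generator_paths_in_HH(1)[OF gpos bd k] n(1)])
    show "contour_integral (cb k) (pull (pole_kernel \<zeta>) \<gamma>) = pole_integral (cb k) (act (inv \<gamma>) \<zeta>)"
      by (rule pole_integral_translate[OF vertices_carrier[OF g] \<zeta>(1) generator_paths_in_HH(2)[OF gpos bd k] n(2)])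
  qed
  finally show ?thesis .
qed

text \<open>The covering property puts some translate of \<open>z\<close> into the closed polygon,
  genericity keeps it off the boundary, and disjointness of the translates of the interior makes it
  the only one.\<close>

lemma winding_has_sum:
  assumes z: "generic z"
  shows "((\<lambda>\<gamma>. winding_number boundary (act \<gamma> z)) has_sum 1) (carrier G)"
proof -
  have z': "z \<in> HH" using z by (simp add: generic_def)
  obtain \<gamma> w where gw: "\<gamma> \<in> carrier G" "w \<in> polygon_interior \<union> path_image boundary" "z = act \<gamma> w"
    using z' cover unfolding polygon_interior_def by blast
  have nb: "act \<delta> z \<notin> path_image boundary" if "\<delta> \<in> carrier G" for \<delta>
    using generic_not_on_edges[OF generic_act[OF z that]] by (auto simp: edge_curves_def)
  have w: "w \<in> HH" using gw polygon_interior_HH bd by blast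
  define \<gamma>0 where "\<gamma>0 = inv \<gamma>"
  have g0: "\<gamma>0 \<in> carrier G" "act \<gamma>0 z = w" using gw w by (auto simp: \<gamma>0_def act_inv)
  then have w_in: "w \<in> polygon_interior" using nb[OF g0(1)] gw by auto
  have 0: "winding_number boundary (act \<delta> z) = 0" if d: "\<delta> \<in> carrier G" "\<delta> \<noteq> \<gamma>0" for \<delta>
  proof (rule ccontr)
    assume "winding_number boundary (act \<delta> z) \<noteq> 0"
    then have "act \<delta> z \<in> polygon_interior" using wn nb[OF d(1)] by (auto simp: polygon_interior_def)
    moreover have "act \<delta> z = act (\<delta> \<otimes> inv \<gamma>0) w"
      using d g0 z' by (simp add: act_mult[symmetric] g0(2)[symmetric] m_assoc)
    moreover have "\<delta> \<otimes> inv \<gamma>0 \<noteq> \<one>" using d g0 by (metis inv_closed inv_equality inv_inv)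
    ultimately show False using disjoint[of "\<delta> \<otimes> inv \<gamma>0", folded polygon_interior_def] w_in d g0 by auto
  qed
  have "((\<lambda>\<gamma>. winding_number boundary (act \<gamma> z)) has_sum 1) {\<gamma>0}"
    using w_in g0 by (intro has_sum_finiteI) (auto simp: polygon_interior_def)
  then show ?thesis
    by (rule has_sum_cong_neutral[THEN iffD1, rotated -1]) (use g0 0 in auto)
qed

text \<open>Replacing a side by a segment changes the winding number by a finitely supported function that
  enters once with each sign at two translates, hence drops out of the sum over the group.\<close>
lemma straight_winding_has_sum:
  assumes z: "generic z"
  shows "((\<lambda>\<gamma>. straight_winding (act \<gamma> z)) has_sum 2 * pi * \<i>) (carrier G)"
proof -
  have z': "z \<in> HH" using z by (simp add: generic_def)
  define K where "K = (\<Union>k\<in>{1..g}. path_image (ca k) \<union> path_image (cb k) \<union> path_image (la k) \<union> path_image (lb k))"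
  have "compact K" unfolding K_def
    by (intro compact_UN compact_Un compact_path_image) (use ca cb la_props in \<open>auto intro: valid_path_imp_path\<close>)
  moreover have "K \<subseteq> HH" unfolding K_def
    using generator_paths_in_HH[OF gpos bd] la_props by blast
  ultimately obtain c d where cd: "K \<subseteq> box c d" "cbox c d \<subseteq> HH" using compact_in_HH_box by metis
  \<comment> \<open>For \<zeta> outside the box the kernel is holomorphic on the convex box
    containing all the paths, so it cannot tell a side from its segment.\<close>
  have same: "pole_integral e \<zeta> = pole_integral e' \<zeta>"
    if "\<zeta> \<in> HH" "\<zeta> \<notin> cbox c d" "valid_path e" "path_image e \<subseteq> K" "valid_path e'" "path_image e' \<subseteq> K"
      "pathstart e = pathstart e'" "pathfinish e = pathfinish e'" for e e' \<zeta>
    unfolding pole_integral_def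
  proof (rule contour_integral_convex_eq)
    show "pole_kernel \<zeta> holomorphic_on box c d"
      by (rule holomorphic_on_subset[OF pole_kernel_holomorphic[OF that(1)]])
        (use cd that box_subset_cbox in blast)
  qed (use that cd in auto)
  have fin: "finite {\<gamma> \<in> carrier G. act \<gamma> z \<in> cbox c d}"
    by (rule finite_translates) (use cd z' in auto)
  \<comment> \<open>\<open>E\<close> vanishes off the box, so only finitely many translates count.
    Left multiplication by the inverse of \<delta> permutes the group, and the sum is the same for
    every \<delta>.\<close>
  have shift: "\<exists>s. \<forall>\<delta>\<in>carrier G. ((\<lambda>\<gamma>. E (act (inv \<delta>) (act \<gamma> z))) has_sum s) (carrier G)"
    if E: "\<And>\<zeta>. \<zeta> \<in> HH \<Longrightarrow> \<zeta> \<notin> cbox c d \<Longrightarrow> E \<zeta> = 0" for E :: "complex \<Rightarrow> complex"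
  proof (intro exI ballI)
    let ?S = "{\<gamma> \<in> carrier G. act \<gamma> z \<in> cbox c d}"
    fix \<delta> assume d: "\<delta> \<in> carrier G"
    have "((\<lambda>\<gamma>. E (act \<gamma> z)) has_sum (\<Sum>\<gamma>\<in>?S. E (act \<gamma> z))) ?S"
      by (rule has_sum_finite[OF fin])
    then have 1: "((\<lambda>\<gamma>. E (act \<gamma> z)) has_sum (\<Sum>\<gamma>\<in>?S. E (act \<gamma> z))) (carrier G)"
      by (rule has_sum_cong_neutral[THEN iffD1, rotated -1]) (auto intro!: E act_HH z')
    have bij: "bij_betw (\<lambda>\<gamma>. inv \<delta> \<otimes> \<gamma>) (carrier G) (carrier G)"
      by (rule bij_betw_byWitness[where f' = "\<lambda>\<gamma>. \<delta> \<otimes> \<gamma>"]) (use d in \<open>auto simp: m_assoc[symmetric]\<close>)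
    have "((\<lambda>\<gamma>. E (act (inv \<delta> \<otimes> \<gamma>) z)) has_sum (\<Sum>\<gamma>\<in>?S. E (act \<gamma> z))) (carrier G)"
      using has_sum_reindex_bij_betw[OF bij, of "\<lambda>\<gamma>. E (act \<gamma> z)"] 1 by simp
    then show "((\<lambda>\<gamma>. E (act (inv \<delta>) (act \<gamma> z))) has_sum (\<Sum>\<gamma>\<in>?S. E (act \<gamma> z))) (carrier G)"
      by (rule has_sum_cong[THEN iffD1, rotated]) (use d z' in \<open>simp add: act_mult\<close>)
  qed
  define Ea where "Ea = (\<lambda>k \<zeta>. pole_integral (ca k) \<zeta> - pole_integral (la k) \<zeta>)"
  define Eb where "Eb = (\<lambda>k \<zeta>. pole_integral (cb k) \<zeta> - pole_integral (lb k) \<zeta>)"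
  have KS: "path_image (ca k) \<subseteq> K" "path_image (cb k) \<subseteq> K" "path_image (la k) \<subseteq> K" "path_image (lb k) \<subseteq> K"
    if "k \<in> {1..g}" for k using that unfolding K_def by blast+
  have "\<exists>s. \<forall>\<delta>\<in>carrier G. ((\<lambda>\<gamma>. Ea k (act (inv \<delta>) (act \<gamma> z))) has_sum s) (carrier G)" if k: "k \<in> {1..g}" for k
    by (rule shift) (use k KS[OF k] ca[OF k] la_props[OF k] in \<open>auto simp: Ea_def intro!: same\<close>)
  then obtain s where s: "\<And>k \<delta>. k \<in> {1..g} \<Longrightarrow> \<delta> \<in> carrier G \<Longrightarrow>
      ((\<lambda>\<gamma>. Ea k (act (inv \<delta>) (act \<gamma> z))) has_sum s k) (carrier G)" by metis
  have "\<exists>s. \<forall>\<delta>\<in>carrier G. ((\<lambda>\<gamma>. Eb k (act (inv \<delta>) (act \<gamma> z))) has_sum s) (carrier G)" if k: "k \<in> {1..g}" for k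
    by (rule shift) (use k KS[OF k] cb[OF k] la_props[OF k] in \<open>auto simp: Eb_def intro!: same\<close>)
  then obtain t where t: "\<And>k \<delta>. k \<in> {1..g} \<Longrightarrow> \<delta> \<in> carrier G \<Longrightarrow>
      ((\<lambda>\<gamma>. Eb k (act (inv \<delta>) (act \<gamma> z))) has_sum t k) (carrier G)" by metis
  have "((\<lambda>\<gamma>. psum (\<lambda>k \<delta>. Ea k (act (inv \<delta>) (act \<gamma> z))) (\<lambda>k \<delta>. Eb k (act (inv \<delta>) (act \<gamma> z)))) has_sum
      (\<Sum>k\<in>{1..g}. (s k - s k) + (t k - t k))) (carrier G)"
    unfolding polygon_sum_def
    by (intro has_sum_sum_finite finite_atLeastAtMost has_sum_add has_sum_minus s t vertex_closed)
  then have diff: "((\<lambda>\<gamma>. psum (\<lambda>k \<delta>. Ea k (act (inv \<delta>) (act \<gamma> z))) (\<lambda>k \<delta>. Eb k (act (inv \<delta>) (act \<gamma> z)))) has_sum 0) (carrier G)"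
    by simp
  have eq: "straight_winding (act \<gamma> z) = 2 * pi * \<i> * winding_number boundary (act \<gamma> z) -
     psum (\<lambda>k \<delta>. Ea k (act (inv \<delta>) (act \<gamma> z))) (\<lambda>k \<delta>. Eb k (act (inv \<delta>) (act \<gamma> z)))"
    if "\<gamma> \<in> carrier G" for \<gamma>
    unfolding winding_number_eq_polygon_sum[OF generic_act[OF z that]] Ea_def Eb_def polygon_sum_diff straight_winding_def
    by simp
  have "((\<lambda>\<gamma>. 2 * pi * \<i> * winding_number boundary (act \<gamma> z) -
     psum (\<lambda>k \<delta>. Ea k (act (inv \<delta>) (act \<gamma> z))) (\<lambda>k \<delta>. Eb k (act (inv \<delta>) (act \<gamma> z)))) has_sum (2 * pi * \<i> * 1 - 0)) (carrier G)"
    by (intro has_sum_minus has_sum_cmult_right winding_has_sum[OF z] diff)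
  then show ?thesis
    by (subst has_sum_cong[OF eq]) simp_all
qed

text \<open>A valid path is continuously differentiable off a finite set, so its image is null; the
  countably many preimages under the group are null as well.\<close>

lemma AE_generic: "AE z in hyp_measure. generic z"
proof -
  have neg: "negligible (path_image e)" if e: "valid_path e" for e :: "real \<Rightarrow> complex"
  proof -
    obtain K where K: "finite K" "e C1_differentiable_on {0..1} - K"
      using e by (auto simp: valid_path_def piecewise_C1_differentiable_on_def)
    have "e differentiable_on {0..1} - K"
      using K(2) by (auto simp: C1_differentiable_on_eq differentiable_on_def intro: differentiable_at_withinI)
    then have "negligible (e ` ({0..1} - K))"
      by (intro negligible_differentiable_image_lowdim) auto
    moreover have "negligible (e ` K)" using K(1) by (intro negligible_finite finite_imageI)
    ultimately have "negligible (e ` ({0..1} - K) \<union> e ` K)" by (rule negligible_Un)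
    then show ?thesis by (rule negligible_subset) (auto simp: path_image_def)
  qed
  have "negligible edge_curves"
    unfolding edge_curves_def
    by (intro negligible_Un negligible_Union finite_imageI finite_atLeastAtMost neg bd_valid)
      (use ca cb la_props in \<open>auto intro!: negligible_Un neg\<close>)
  then have "AE z in hyp_measure. z \<notin> edge_curves"
    unfolding AE_hyp_measure_iff using negligible_imp_AE_lborel by fastforce
  then have "AE z in hyp_measure. \<forall>\<gamma>\<in>carrier G. act \<gamma> z \<notin> edge_curves"
    by (subst AE_ball_countable[OF countable_G]) (intro ballI AE_hyp_measure_act[where P = "\<lambda>z. z \<notin> edge_curves"])
  then show ?thesis using AE_hyp_measure_HH by eventually_elim (simp add: generic_def)
qed

end

section \<open>The chain of straight sides\<close>

context fundamental_polygon
begin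

text \<open>The integral of f(z) dz along the closed chain of translated segments. The segments are
  never joined to one path; the signed sum itself plays the part of the contour.\<close>

definition straight_integral :: "(complex \<Rightarrow> complex) \<Rightarrow> complex" where
  "straight_integral f =
    psum (\<lambda>k \<gamma>. contour_integral (la k) (pull f \<gamma>))
         (\<lambda>k \<gamma>. contour_integral (lb k) (pull f \<gamma>))"

text \<open>The segments keep the end points of the sides they replace, so the chain still runs
  through translates of \<open>p\<close>, and the values of a primitive telescope.\<close>

lemma straight_integral_primitive:
  assumes D: "open D" and P: "\<And>z. z \<in> D \<Longrightarrow> (P has_field_derivative f z) (at z)"
    and im: "\<And>k \<gamma>. k \<in> {1..g} \<Longrightarrow> \<gamma> \<in> vertices \<Longrightarrow>
      act \<gamma> ` path_image (la k) \<subseteq> D \<and> act \<gamma> ` path_image (lb k) \<subseteq> D"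
  shows "straight_integral f = 0"
proof -
  have eq: "contour_integral e (pull f \<gamma>) = P (act \<gamma> (pathfinish e)) - P (act \<gamma> (pathstart e))"
    if g: "\<gamma> \<in> carrier G" and e: "valid_path e" "path_image e \<subseteq> HH" "act \<gamma> ` path_image e \<subseteq> D" for e \<gamma>
  proof -
    have "contour_integral e (pull f \<gamma>) = contour_integral (act \<gamma> \<circ> e) f"
      by (rule contour_integral_holomorphic_comp[OF e(1,2) open_HH real_moebius_holomorphic[OF moebius[OF g]], symmetric])
    moreover have "(f has_contour_integral P (pathfinish (act \<gamma> \<circ> e)) - P (pathstart (act \<gamma> \<circ> e))) (act \<gamma> \<circ> e)"
    proof (rule contour_integral_primitive[where S = D])
      show "valid_path (act \<gamma> \<circ> e)"
        by (rule valid_path_compose_holomorphic[OF e(1) real_moebius_holomorphic[OF moebius[OF g]] open_HH e(2)])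
      show "path_image (act \<gamma> \<circ> e) \<subseteq> D" unfolding path_image_compose by (rule e(3))
    qed (use P in \<open>auto intro: has_field_derivative_at_within\<close>)
    ultimately show ?thesis
      by (simp add: contour_integral_unique pathfinish_compose pathstart_compose)
  qed
  define H where "H = (\<lambda>\<gamma>. P (act \<gamma> p))"
  have "straight_integral f = psum (\<lambda>k \<gamma>. H (\<gamma> \<otimes> a k) - H \<gamma>) (\<lambda>k \<gamma>. H (\<gamma> \<otimes> b k) - H \<gamma>)"
    unfolding straight_integral_def
  proof (rule polygon_sum_cong)
    fix k \<gamma> assume k: "k \<in> {1..g}" and g: "\<gamma> \<in> vertices"
    note L = la_props[OF k] and c = vertices_carrier[OF g]
    show "contour_integral (la k) (pull f \<gamma>) = H (\<gamma> \<otimes> a k) - H \<gamma>"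
      using eq[OF c L(3,1)] im[OF k g] L p by (simp add: H_def act_mult[OF c a_closed[OF k]])
    show "contour_integral (lb k) (pull f \<gamma>) = H (\<gamma> \<otimes> b k) - H \<gamma>"
      using eq[OF c L(4,2)] im[OF k g] L p by (simp add: H_def act_mult[OF c b_closed[OF k]])
  qed
  also have "\<dots> = 0" by (rule polygon_sum_telescope)
  finally show ?thesis .
qed

lemma straight_integral_holomorphic:
  assumes D: "open D" "convex D" and f: "f holomorphic_on D"
    and im: "\<And>k \<gamma>. k \<in> {1..g} \<Longrightarrow> \<gamma> \<in> vertices \<Longrightarrow>
      act \<gamma> ` path_image (la k) \<subseteq> D \<and> act \<gamma> ` path_image (lb k) \<subseteq> D"
  shows "straight_integral f = 0"
proof -
  obtain P where P: "\<And>z. z \<in> D \<Longrightarrow> (P has_field_derivative f z) (at z within D)"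
    using holomorphic_convex_primitive'[OF D(2,1) f] by blast
  have P': "(P has_field_derivative f z) (at z)" if "z \<in> D" for z
    using P[OF that] unfolding at_within_open[OF that D(1)] .
  show ?thesis by (rule straight_integral_primitive[OF D(1) P' im])
qed

lemma straight_image_HH:
  assumes "k \<in> {1..g}" "\<gamma> \<in> vertices"
  shows "act \<gamma> ` path_image (la k) \<subseteq> HH \<and> act \<gamma> ` path_image (lb k) \<subseteq> HH"
  using la_props[OF assms(1)] act_HH[OF vertices_carrier[OF assms(2)]] by blast

lemma generic_not_in_straight:
  assumes "generic \<zeta>" "k \<in> {1..g}" "\<gamma> \<in> carrier G"
  shows "\<zeta> \<notin> act \<gamma> ` path_image (la k)" "\<zeta> \<notin> act \<gamma> ` path_image (lb k)"
proof -
  have "act (inv \<gamma>) \<zeta> \<notin> edge_curves" using generic_not_on_edges[OF generic_act[OF assms(1)]] assms(3) by simp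
  then have n: "act (inv \<gamma>) \<zeta> \<notin> path_image (la k)" "act (inv \<gamma>) \<zeta> \<notin> path_image (lb k)"
    using assms(2) unfolding edge_curves_def by blast+
  then show "\<zeta> \<notin> act \<gamma> ` path_image (la k)" "\<zeta> \<notin> act \<gamma> ` path_image (lb k)"
    using la_props(1,2)[OF assms(2)] act_inv[OF assms(3)] by auto
qed

text \<open>Back from the invariant kernel to the plain Cauchy kernel: the mirror pole lies outside
  the convex half plane containing the chain and integrates to zero.\<close>

lemma straight_winding_eq:
  assumes z: "generic \<zeta>"
  shows "straight_integral (\<lambda>w. 1 / (w - \<zeta>)) = straight_winding \<zeta>"
proof -
  have \<zeta>: "\<zeta> \<in> HH" using z by (simp add: generic_def)
  have cnj0: "straight_integral (\<lambda>w. 1 / (w - cnj \<zeta>)) = 0"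
    by (rule straight_integral_holomorphic[OF open_HH convex_HH inverse_diff_cnj_holomorphic[OF \<zeta>]])
      (use straight_image_HH in blast)
  have split: "contour_integral e (pull (\<lambda>w. 1 / (w - \<zeta>)) \<gamma>) =
      pole_integral e (act (inv \<gamma>) \<zeta>) + contour_integral e (pull (\<lambda>w. 1 / (w - cnj \<zeta>)) \<gamma>)"
    if g: "\<gamma> \<in> carrier G" and e: "valid_path e" "path_image e \<subseteq> HH" and n: "\<zeta> \<notin> act \<gamma> ` path_image e" for e \<gamma>
  proof -
    have h: "act \<gamma> holomorphic_on HH" by (rule real_moebius_holomorphic[OF moebius[OF g]])
    have dh: "deriv (act \<gamma>) holomorphic_on HH" by (rule holomorphic_deriv[OF h open_HH])
    have n': "act (inv \<gamma>) \<zeta> \<notin> path_image e" using n act_inv'[OF g \<zeta>] by (metis imageI)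
    have S: "open (HH - {act (inv \<gamma>) \<zeta>})" "path_image e \<subseteq> HH - {act (inv \<gamma>) \<zeta>}"
      using open_HH e n' by auto
    have nz: "act \<gamma> w - cnj \<zeta> \<noteq> 0" if "w \<in> HH" for w
      using act_HH[OF g that] \<zeta> by (auto simp: upper_half_plane_def complex_eq_iff)
    have nz': "act \<gamma> w - \<zeta> \<noteq> 0" if "w \<in> HH - {act (inv \<gamma>) \<zeta>}" for w
      using that act_inv[OF g, of w] by auto
    have h1: "(pull (\<lambda>w. 1 / (w - cnj \<zeta>)) \<gamma>) holomorphic_on (HH - {act (inv \<gamma>) \<zeta>})"
      by (intro holomorphic_intros holomorphic_on_subset[OF h] holomorphic_on_subset[OF dh]) (use nz in auto)
    have h2: "(pull (pole_kernel \<zeta>) \<gamma>) holomorphic_on (HH - {act (inv \<gamma>) \<zeta>})"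
      unfolding pole_kernel_def
      by (intro holomorphic_intros holomorphic_on_subset[OF h] holomorphic_on_subset[OF dh]) (use nz nz' in auto)
    have "contour_integral e (pull (\<lambda>w. 1 / (w - \<zeta>)) \<gamma>) =
      contour_integral e (\<lambda>z. pole_kernel \<zeta> (act \<gamma> z) * deriv (act \<gamma>) z + 1 / (act \<gamma> z - cnj \<zeta>) * deriv (act \<gamma>) z)"
      by (simp add: pole_kernel_def left_diff_distrib)
    also have "\<dots> = contour_integral e (pull (pole_kernel \<zeta>) \<gamma>) +
        contour_integral e (pull (\<lambda>w. 1 / (w - cnj \<zeta>)) \<gamma>)"
      by (rule contour_integral_add; rule contour_integrable_holomorphic_simple[OF _ S(1) e(1) S(2)])
        (use h1 h2 in auto)
    also have "contour_integral e (pull (pole_kernel \<zeta>) \<gamma>) = pole_integral e (act (inv \<gamma>) \<zeta>)"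
      by (rule pole_integral_translate[OF g \<zeta> e(2) n'])
    finally show ?thesis .
  qed
  have "straight_integral (\<lambda>w. 1 / (w - \<zeta>)) =
      psum (\<lambda>k \<gamma>. pole_integral (la k) (act (inv \<gamma>) \<zeta>) + contour_integral (la k) (pull (\<lambda>w. 1 / (w - cnj \<zeta>)) \<gamma>))
        (\<lambda>k \<gamma>. pole_integral (lb k) (act (inv \<gamma>) \<zeta>) + contour_integral (lb k) (pull (\<lambda>w. 1 / (w - cnj \<zeta>)) \<gamma>))"
    unfolding straight_integral_def
  proof (rule polygon_sum_cong)
    fix k \<gamma> assume k: "k \<in> {1..g}" and g: "\<gamma> \<in> vertices"
    note L = la_props[OF k] and c = vertices_carrier[OF g]
    show "contour_integral (la k) (pull (\<lambda>w. 1 / (w - \<zeta>)) \<gamma>) =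
        pole_integral (la k) (act (inv \<gamma>) \<zeta>) + contour_integral (la k) (pull (\<lambda>w. 1 / (w - cnj \<zeta>)) \<gamma>)"
      by (rule split[OF c L(3,1) generic_not_in_straight(1)[OF z k c]])
    show "contour_integral (lb k) (pull (\<lambda>w. 1 / (w - \<zeta>)) \<gamma>) =
        pole_integral (lb k) (act (inv \<gamma>) \<zeta>) + contour_integral (lb k) (pull (\<lambda>w. 1 / (w - cnj \<zeta>)) \<gamma>)"
      by (rule split[OF c L(4,2) generic_not_in_straight(2)[OF z k c]])
  qed
  also have "\<dots> = straight_winding \<zeta> + straight_integral (\<lambda>w. 1 / (w - cnj \<zeta>))"
    unfolding polygon_sum_add straight_winding_def straight_integral_def ..
  finally show ?thesis using cnj0 by simp
qed

text \<open>A translate of a segment is continuously differentiable up to its end points, as the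
  Fubini argument requires; the velocity is written out by the chain rule.\<close>

definition straight_kernel :: "complex \<Rightarrow> 'a \<Rightarrow> complex \<Rightarrow> complex" where
  "straight_kernel q \<gamma> = cauchy_kernel_integral 0 1 (\<lambda>t. act \<gamma> (linepath p q t)) (\<lambda>t. deriv (act \<gamma>) (linepath p q t) * (q - p))"

text \<open>Off the chain this is -2 pi i times the winding function; the sign is that of the kernel
  1 / (\<zeta> - w).\<close>

definition chain_kernel :: "complex \<Rightarrow> complex" where
  "chain_kernel \<zeta> = psum (\<lambda>k \<gamma>. straight_kernel (act (a k) p) \<gamma> \<zeta>) (\<lambda>k \<gamma>. straight_kernel (act (b k) p) \<gamma> \<zeta>)"

lemma straight_arc:
  assumes g: "\<gamma> \<in> carrier G" and q: "q \<in> HH"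
  shows "t \<in> {0..1} \<Longrightarrow> ((\<lambda>t. act \<gamma> (linepath p q t)) has_vector_derivative deriv (act \<gamma>) (linepath p q t) * (q - p)) (at t within {0..1})"
    and "continuous_on {0..1} (\<lambda>t. deriv (act \<gamma>) (linepath p q t) * (q - p))"
    and "continuous_on {0..1} (\<lambda>t. act \<gamma> (linepath p q t))"
    and "(\<lambda>t. act \<gamma> (linepath p q t)) ` {0..1} = act \<gamma> ` path_image (linepath p q)"
    and "integral {0..1} (\<lambda>t. f (act \<gamma> (linepath p q t)) * (deriv (act \<gamma>) (linepath p q t) * (q - p))) =
      contour_integral (linepath p q) (pull f \<gamma>)"
proof -
  have in_HH: "linepath p q t \<in> HH" if "t \<in> {0..1}" for t
    using closed_segment_subset[OF p q convex_HH] that by (metis linepath_in_path subsetD)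
  have h: "act \<gamma> holomorphic_on HH" by (rule real_moebius_holomorphic[OF moebius[OF g]])
  have dh: "continuous_on HH (deriv (act \<gamma>))"
    by (rule holomorphic_on_imp_continuous_on[OF holomorphic_deriv[OF h open_HH]])
  show der: "((\<lambda>t. act \<gamma> (linepath p q t)) has_vector_derivative deriv (act \<gamma>) (linepath p q t) * (q - p)) (at t within {0..1})"
    if t: "t \<in> {0..1}" for t
  proof -
    have "(act \<gamma> has_field_derivative deriv (act \<gamma>) (linepath p q t)) (at (linepath p q t) within linepath p q ` {0..1})"
      using act_has_deriv[OF g in_HH[OF t]] by (rule has_field_derivative_at_within)
    from field_vector_diff_chain_within[OF has_vector_derivative_linepath_within this]
    show ?thesis by (simp add: o_def mult.commute)
  qed
  show "continuous_on {0..1} (\<lambda>t. deriv (act \<gamma>) (linepath p q t) * (q - p))"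
    by (intro continuous_intros continuous_on_compose2[OF dh continuous_on_linepath]) (use in_HH in auto)
  show "continuous_on {0..1} (\<lambda>t. act \<gamma> (linepath p q t))"
    using der by (meson continuous_on_eq_continuous_within has_vector_derivative_continuous)
  show "(\<lambda>t. act \<gamma> (linepath p q t)) ` {0..1} = act \<gamma> ` path_image (linepath p q)"
    by (simp only: path_image_def image_image)
  show "integral {0..1} (\<lambda>t. f (act \<gamma> (linepath p q t)) * (deriv (act \<gamma>) (linepath p q t) * (q - p))) =
      contour_integral (linepath p q) (pull f \<gamma>)"
    by (simp add: contour_integral_integral mult.assoc)
qed

lemma straight_kernel_eq:
  assumes g: "\<gamma> \<in> carrier G" and q: "q \<in> HH" and n: "\<zeta> \<notin> act \<gamma> ` path_image (linepath p q)"
  shows "straight_kernel q \<gamma> \<zeta> = - contour_integral (linepath p q) (pull (\<lambda>w. 1 / (w - \<zeta>)) \<gamma>)"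
proof -
  note A = straight_arc[OF g q]
  have "straight_kernel q \<gamma> \<zeta> = integral {0..1} (\<lambda>t. deriv (act \<gamma>) (linepath p q t) * (q - p) / (\<zeta> - act \<gamma> (linepath p q t)))"
    unfolding straight_kernel_def
    by (rule cauchy_kernel_integral_eq_integral[OF A(3,2)]) (use n A(4) in simp)
  also have "\<dots> = integral {0..1} (\<lambda>t. - (1 / (act \<gamma> (linepath p q t) - \<zeta>) * (deriv (act \<gamma>) (linepath p q t) * (q - p))))"
  proof (rule integral_cong)
    have "c / (\<zeta> - x) = - (1 / (x - \<zeta>) * c)" for x c
      by (cases "x = \<zeta>") (simp_all add: field_simps)
    then show "deriv (act \<gamma>) (linepath p q t) * (q - p) / (\<zeta> - act \<gamma> (linepath p q t)) =
        - (1 / (act \<gamma> (linepath p q t) - \<zeta>) * (deriv (act \<gamma>) (linepath p q t) * (q - p)))" for t .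
  qed
  also have "\<dots> = - contour_integral (linepath p q) (pull (\<lambda>w. 1 / (w - \<zeta>)) \<gamma>)"
    using A(5)[of "\<lambda>w. 1 / (w - \<zeta>)"] by simp
  finally show ?thesis .
qed

lemma chain_kernel_eq:
  assumes "\<And>k \<gamma>. k \<in> {1..g} \<Longrightarrow> \<gamma> \<in> vertices \<Longrightarrow> \<zeta> \<notin> act \<gamma> ` path_image (la k) \<and> \<zeta> \<notin> act \<gamma> ` path_image (lb k)"
  shows "chain_kernel \<zeta> = - straight_integral (\<lambda>w. 1 / (w - \<zeta>))"
proof -
  have "chain_kernel \<zeta> = psum (\<lambda>k \<gamma>. 0 - contour_integral (la k) (pull (\<lambda>w. 1 / (w - \<zeta>)) \<gamma>))
         (\<lambda>k \<gamma>. 0 - contour_integral (lb k) (pull (\<lambda>w. 1 / (w - \<zeta>)) \<gamma>))"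
    unfolding chain_kernel_def
  proof (rule polygon_sum_cong)
    fix k \<gamma> assume k: "k \<in> {1..g}" and g: "\<gamma> \<in> vertices"
    note c = vertices_carrier[OF g] and q = act_HH[OF a_closed[OF k] p] act_HH[OF b_closed[OF k] p]
    show "straight_kernel (act (a k) p) \<gamma> \<zeta> = 0 - contour_integral (la k) (pull (\<lambda>w. 1 / (w - \<zeta>)) \<gamma>)"
      using straight_kernel_eq[OF c q(1)] assms[OF k g] by (simp add: la_def)
    show "straight_kernel (act (b k) p) \<gamma> \<zeta> = 0 - contour_integral (lb k) (pull (\<lambda>w. 1 / (w - \<zeta>)) \<gamma>)"
      using straight_kernel_eq[OF c q(2)] assms[OF k g] by (simp add: lb_def)
  qed
  then show ?thesis
    unfolding polygon_sum_diff polygon_sum_const straight_integral_def by simp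
qed

end

section \<open>Green's formula unfolded over the group\<close>

context fundamental_polygon
begin

text \<open>Green's formula on each arc leaves primitives, which telescope, and the area integral of
  \<open>B\<close> weighted by the winding function. Since y^2 B is invariant, unfolding collects
  the weights over an orbit; they add up to 2 pi i, and division by pi leaves the factor 2
  i.\<close>

theorem straight_integral_Green:
  fixes f A B :: "complex \<Rightarrow> complex"
  assumes der: "\<And>z. z \<in> HH \<Longrightarrow> (f has_derivative (\<lambda>h. A z * h + B z * cnj h)) (at z)"
    and A: "continuous_on HH A" and B: "continuous_on HH B"
    and inv: "\<And>\<gamma> z. \<gamma> \<in> carrier G \<Longrightarrow> z \<in> HH \<Longrightarrow>
      of_real ((Im (act \<gamma> z))\<^sup>2) * B (act \<gamma> z) = of_real ((Im z)\<^sup>2) * B z"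
    and F: "F \<in> sets borel" "F \<subseteq> HH"
    and tile: "AE z in hyp_measure. \<exists>!\<gamma>. \<gamma> \<in> carrier G \<and> act \<gamma> z \<in> F"
  shows "integrable hyp_measure (\<lambda>z. indicator F z *\<^sub>R (of_real ((Im z)\<^sup>2) * B z))"
    and "straight_integral f = 2 * \<i> * (LINT z|hyp_measure. indicator F z *\<^sub>R (of_real ((Im z)\<^sup>2) * B z))"
proof -
  \<comment> \<open>All arcs are placed in one box, so that a single \<open>P\<close> serves for
    every arc and its end point values can cancel between neighbours.\<close>
  define im where "im = (\<Union>k\<in>{1..g}. \<Union>\<gamma>\<in>vertices. act \<gamma> ` path_image (la k) \<union> act \<gamma> ` path_image (lb k))"
  have "compact im" unfolding im_def
  proof (intro compact_UN compact_Un compact_continuous_image finite_vertices finite_atLeastAtMost)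
    fix k \<gamma> assume k: "k \<in> {1..g}" and g: "\<gamma> \<in> vertices"
    have h: "continuous_on HH (act \<gamma>)"
      by (rule holomorphic_on_imp_continuous_on[OF real_moebius_holomorphic[OF moebius[OF vertices_carrier[OF g]]]])
    show "continuous_on (path_image (la k)) (act \<gamma>)" "continuous_on (path_image (lb k)) (act \<gamma>)"
      by (rule continuous_on_subset[OF h la_props(1)[OF k]] continuous_on_subset[OF h la_props(2)[OF k]])+
    show "compact (path_image (la k))" "compact (path_image (lb k))"
      using la_props[OF k] by (auto intro: compact_valid_path_image)
  qed
  moreover have "im \<subseteq> HH" unfolding im_def using straight_image_HH by blast
  ultimately obtain c d where cd: "im \<subseteq> box c d" "cbox c d \<subseteq> HH" "box c d \<noteq> {}"
    using compact_in_HH_box by metis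
  have imk: "act \<gamma> ` path_image (la k) \<subseteq> box c d \<and> act \<gamma> ` path_image (lb k) \<subseteq> box c d"
    if "k \<in> {1..g}" "\<gamma> \<in> vertices" for k \<gamma>
    using cd(1) that unfolding im_def by blast
  obtain P gg r where gg: "compactly_supported gg r" and ggB: "\<And>z. z \<in> cbox c d \<Longrightarrow> gg z = B z"
    and arcs: "\<And>e e'. (\<And>t. t \<in> {0..1} \<Longrightarrow> (e has_vector_derivative e' t) (at t within {0..1})) \<Longrightarrow>
       continuous_on {0..1} e' \<Longrightarrow> e ` {0..1} \<subseteq> box c d \<Longrightarrow>
       integral {0..1} (\<lambda>t. f (e t) * e' t) =
         P (e 1) - P (e 0) - (LINT \<zeta>|lborel. gg \<zeta> * cauchy_kernel_integral 0 1 e e' \<zeta>) / pi"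
  proof (rule Green_arcs[of c d f A B])
    show "box c d \<noteq> {}" by (rule cd(3))
    show "(f has_derivative (\<lambda>h. A z * h + B z * cnj h)) (at z)" if "z \<in> cbox c d" for z
      using der cd(2) that by blast
    show "continuous_on (cbox c d) A" "continuous_on (cbox c d) B"
      by (rule continuous_on_subset[OF A cd(2)] continuous_on_subset[OF B cd(2)])+
    fix P gg r
    assume *: "compactly_supported gg r" "\<And>z. z \<in> cbox c d \<Longrightarrow> gg z = B z"
      "\<And>e e'. (\<And>t. t \<in> {0..1} \<Longrightarrow> (e has_vector_derivative e' t) (at t within {0..1})) \<Longrightarrow>
       continuous_on {0..1} e' \<Longrightarrow> e ` {0..1} \<subseteq> box c d \<Longrightarrow>
       integral {0..1} (\<lambda>t. f (e t) * e' t) =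
         P (e 1) - P (e 0) - (LINT \<zeta>|lborel. gg \<zeta> * cauchy_kernel_integral 0 1 e e' \<zeta>) / pi"
    show thesis by (rule that[of gg r P, OF *])
  qed
  interpret gg: compactly_supported gg r by (rule gg)
  define T where "T = (\<lambda>q \<gamma>. LINT \<zeta>|lborel. gg \<zeta> * straight_kernel q \<gamma> \<zeta>)"
  have int: "integrable lborel (\<lambda>\<zeta>. gg \<zeta> * straight_kernel q \<gamma> \<zeta>)" if "\<gamma> \<in> carrier G" "q \<in> HH" for q \<gamma>
    unfolding straight_kernel_def
    by (rule gg.integrable_cauchy_kernel_integral[OF straight_arc(3,2)[OF that]])
  have arc: "contour_integral (linepath p q) (pull f \<gamma>) =
      (P (act \<gamma> q) - P (act \<gamma> p)) - 1 / pi * T q \<gamma>"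
    if g: "\<gamma> \<in> carrier G" and q: "q \<in> HH" and sub: "act \<gamma> ` path_image (linepath p q) \<subseteq> box c d" for q \<gamma>
    using arcs[OF straight_arc(1,2)[OF g q]] sub
    unfolding straight_arc(4,5)[OF g q] T_def straight_kernel_def
    by (simp add: linepath_0' linepath_1')
  define H where "H = (\<lambda>\<gamma>. P (act \<gamma> p))"
  have "straight_integral f = psum (\<lambda>k \<gamma>. (H (\<gamma> \<otimes> a k) - H \<gamma>) - 1 / pi * T (act (a k) p) \<gamma>)
      (\<lambda>k \<gamma>. (H (\<gamma> \<otimes> b k) - H \<gamma>) - 1 / pi * T (act (b k) p) \<gamma>)"
    unfolding straight_integral_def
  proof (rule polygon_sum_cong)
    fix k \<gamma> assume k: "k \<in> {1..g}" and g: "\<gamma> \<in> vertices"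
    note cl = vertices_carrier[OF g] and q = act_HH[OF a_closed[OF k] p] act_HH[OF b_closed[OF k] p]
    have sub: "act \<gamma> ` path_image (linepath p (act (a k) p)) \<subseteq> box c d" "act \<gamma> ` path_image (linepath p (act (b k) p)) \<subseteq> box c d"
      using imk[OF k g] unfolding la_def lb_def by blast+
    show "contour_integral (la k) (pull f \<gamma>) = (H (\<gamma> \<otimes> a k) - H \<gamma>) - 1 / pi * T (act (a k) p) \<gamma>"
      unfolding la_def H_def act_mult[OF cl a_closed[OF k] p] by (rule arc[OF cl q(1) sub(1)])
    show "contour_integral (lb k) (pull f \<gamma>) = (H (\<gamma> \<otimes> b k) - H \<gamma>) - 1 / pi * T (act (b k) p) \<gamma>"
      unfolding lb_def H_def act_mult[OF cl b_closed[OF k] p] by (rule arc[OF cl q(2) sub(2)])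
  qed
  also have "\<dots> = - (1 / pi * psum (\<lambda>k \<gamma>. T (act (a k) p) \<gamma>) (\<lambda>k \<gamma>. T (act (b k) p) \<gamma>))"
    by (subst polygon_sum_diff) (simp only: polygon_sum_telescope polygon_sum_mult diff_0)
  finally have si: "straight_integral f = - (1 / pi * psum (\<lambda>k \<gamma>. T (act (a k) p) \<gamma>) (\<lambda>k \<gamma>. T (act (b k) p) \<gamma>))" .
  have chain_val: "psum (\<lambda>k \<gamma>. T (act (a k) p) \<gamma>) (\<lambda>k \<gamma>. T (act (b k) p) \<gamma>) = (LINT \<zeta>|lborel. gg \<zeta> * chain_kernel \<zeta>)"
    and chain_int: "integrable lborel (\<lambda>\<zeta>. gg \<zeta> * chain_kernel \<zeta>)"
  proof -
    have eq: "gg \<zeta> * chain_kernel \<zeta> = psum (\<lambda>k \<gamma>. gg \<zeta> * straight_kernel (act (a k) p) \<gamma> \<zeta>)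
        (\<lambda>k \<gamma>. gg \<zeta> * straight_kernel (act (b k) p) \<gamma> \<zeta>)" for \<zeta>
      by (simp only: chain_kernel_def polygon_sum_mult)
    have i: "integrable lborel (\<lambda>\<zeta>. gg \<zeta> * straight_kernel (act (a k) p) \<gamma> \<zeta>)"
      "integrable lborel (\<lambda>\<zeta>. gg \<zeta> * straight_kernel (act (b k) p) \<gamma> \<zeta>)"
      if "k \<in> {1..g}" "\<gamma> \<in> carrier G" for k \<gamma>
      using that by (auto intro!: int act_HH a_closed b_closed p)
    show "integrable lborel (\<lambda>\<zeta>. gg \<zeta> * chain_kernel \<zeta>)"
      "psum (\<lambda>k \<gamma>. T (act (a k) p) \<gamma>) (\<lambda>k \<gamma>. T (act (b k) p) \<gamma>) = (LINT \<zeta>|lborel. gg \<zeta> * chain_kernel \<zeta>)"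
      unfolding eq T_def by (rule integrable_polygon_sum[OF i] integral_polygon_sum[OF i, symmetric]; assumption)+
  qed
  have main: "straight_integral f = - (1 / pi * (LINT \<zeta>|lborel. gg \<zeta> * chain_kernel \<zeta>))"
    unfolding si chain_val ..

  \<comment> \<open>The chain stays in the convex box, where 1 / (w - \<zeta>) is holomorphic as
    soon as \<zeta> is outside.\<close>
  have out0: "chain_kernel \<zeta> = 0" if z: "\<zeta> \<notin> box c d" for \<zeta>
  proof -
    have "chain_kernel \<zeta> = - straight_integral (\<lambda>w. 1 / (w - \<zeta>))"
      by (rule chain_kernel_eq) (use imk z in blast)
    moreover have hol: "(\<lambda>w. 1 / (w - \<zeta>)) holomorphic_on box c d"
      by (intro holomorphic_intros) (use z in auto)
    moreover have "straight_integral (\<lambda>w. 1 / (w - \<zeta>)) = 0"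
      by (rule straight_integral_holomorphic[OF open_box convex_box(2) hol imk])
    ultimately show ?thesis by simp
  qed
  have in_gen: "chain_kernel \<zeta> = - straight_winding \<zeta>" if z: "generic \<zeta>" for \<zeta>
  proof -
    have "chain_kernel \<zeta> = - straight_integral (\<lambda>w. 1 / (w - \<zeta>))"
      by (rule chain_kernel_eq) (intro conjI generic_not_in_straight[OF z] vertices_carrier; assumption)
    then show ?thesis by (simp add: straight_winding_eq[OF z])
  qed
  \<comment> \<open>The weight \<open>(Im z)\<^sup>2\<close> compensates the density of the
    invariant measure and -1 / pi is the constant in \<open>main\<close>; the integral of
    \<open>Q\<close> is therefore \<open>straight_integral f\<close>.\<close>
  define Q where "Q = (\<lambda>z. - (of_real (indicator HH z * (Im z)\<^sup>2 / pi) * (gg z * chain_kernel z)))"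
  have gm [measurable]: "(\<lambda>z. gg z * chain_kernel z) \<in> borel_measurable borel"
    using borel_measurable_integrable[OF chain_int] by simp
  have Q_meas: "Q \<in> borel_measurable borel" unfolding Q_def by measurable
  have Q_eq: "(indicator HH z / (Im z)\<^sup>2) *\<^sub>R Q z = - (of_real (1 / pi) * (gg z * chain_kernel z))" for z
  proof (cases "z \<in> HH")
    case True
    then show ?thesis by (simp add: Q_def upper_half_plane_def scaleR_conv_of_real)
  next
    case False
    then have "z \<notin> box c d" using cd box_subset_cbox by blast
    then show ?thesis using False by (simp add: Q_def out0)
  qed
  have Q_int: "integrable hyp_measure Q"
    unfolding integrable_hyp_measure_iff[OF Q_meas] Q_eq
    by (intro Bochner_Integration.integrable_minus integrable_mult_right chain_int)
  have Q_val: "integral\<^sup>L hyp_measure Q = straight_integral f"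
    unfolding integral_hyp_measure[OF Q_meas] Q_eq main
    by simp
  define \<Omega> where "\<Omega> = (\<lambda>z. of_real ((Im z)\<^sup>2) * B z)"
  \<comment> \<open>\<open>gg\<close> is known to equal \<open>B\<close> only in the box; outside,
    both sides vanish together with the kernel. Inside, invariance replaces the weighted value of
    \<open>B\<close> at the translate by the one at \<open>z\<close>.\<close>
  have Q_act: "Q (act \<gamma> z) = \<Omega> z / pi * straight_winding (act \<gamma> z)" if z: "generic z" and g: "\<gamma> \<in> carrier G" for z \<gamma>
  proof (cases "act \<gamma> z \<in> box c d")
    case True
    have zH: "z \<in> HH" using z by (simp add: generic_def)
    have "gg (act \<gamma> z) = B (act \<gamma> z)" using ggB True box_subset_cbox by blast
    moreover have "of_real ((Im (act \<gamma> z))\<^sup>2) * B (act \<gamma> z) = \<Omega> z"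
      unfolding \<Omega>_def by (rule inv[OF g zH])
    ultimately show ?thesis
      using act_HH[OF g zH] in_gen[OF generic_act[OF z g]] by (simp add: Q_def)
  next
    case False
    then show ?thesis using out0[OF False] in_gen[OF generic_act[OF z g]] by (simp add: Q_def)
  qed
  have sumQ: "AE z in hyp_measure. finite {\<gamma> \<in> carrier G. Q (act \<gamma> z) \<noteq> 0} \<and>
      (\<Sum>\<gamma> | \<gamma> \<in> carrier G \<and> Q (act \<gamma> z) \<noteq> 0. Q (act \<gamma> z)) = 2 * \<i> * \<Omega> z"
    using AE_generic
  proof eventually_elim
    fix z assume z: "generic z"
    let ?S = "{\<gamma> \<in> carrier G. Q (act \<gamma> z) \<noteq> 0}"
    have zH: "z \<in> HH" using z by (simp add: generic_def)
    have "?S \<subseteq> {\<gamma> \<in> carrier G. act \<gamma> z \<in> cbox c d}"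
      using out0 box_subset_cbox[of c d] by (auto simp: Q_def)
    moreover have "finite {\<gamma> \<in> carrier G. act \<gamma> z \<in> cbox c d}"
      by (rule finite_translates) (use cd zH in auto)
    ultimately have fin: "finite ?S" by (rule finite_subset)
    have "((\<lambda>\<gamma>. \<Omega> z / pi * straight_winding (act \<gamma> z)) has_sum (\<Omega> z / pi * (2 * pi * \<i>))) (carrier G)"
      by (rule has_sum_cmult_right[OF straight_winding_has_sum[OF z]])
    then have "((\<lambda>\<gamma>. Q (act \<gamma> z)) has_sum (\<Omega> z / pi * (2 * pi * \<i>))) (carrier G)"
      by (subst has_sum_cong[OF Q_act[OF z]])
    then have "((\<lambda>\<gamma>. Q (act \<gamma> z)) has_sum (\<Omega> z / pi * (2 * pi * \<i>))) ?S"
      by (rule has_sum_cong_neutral[THEN iffD1, rotated -1]) auto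
    then have "(\<Sum>\<gamma>\<in>?S. Q (act \<gamma> z)) = \<Omega> z / pi * (2 * pi * \<i>)"
      using has_sum_finite[OF fin] has_sum_unique by blast
    then show "finite ?S \<and> (\<Sum>\<gamma> | \<gamma> \<in> carrier G \<and> Q (act \<gamma> z) \<noteq> 0. Q (act \<gamma> z)) = 2 * \<i> * \<Omega> z"
      using fin by simp
  qed
  have \<Omega>_cont: "continuous_on HH \<Omega>"
    unfolding \<Omega>_def by (intro continuous_intros B)
  have "(\<lambda>z. indicator HH z *\<^sub>R \<Omega> z) \<in> borel_measurable borel"
    by (rule borel_measurable_continuous_on_indicator[OF borel_HH \<Omega>_cont])
  then have "(\<lambda>z. indicator F z *\<^sub>R (indicator HH z *\<^sub>R \<Omega> z)) \<in> borel_measurable borel"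
    using F(1) by measurable
  also have "(\<lambda>z. indicator F z *\<^sub>R (indicator HH z *\<^sub>R \<Omega> z)) = (\<lambda>z. indicator F z *\<^sub>R \<Omega> z)"
    using F(2) by (auto simp: fun_eq_iff indicator_def)
  finally have \<Omega>_meas: "(\<lambda>z. indicator F z *\<^sub>R \<Omega> z) \<in> borel_measurable borel" .
  have meas2: "(\<lambda>z. indicator F z *\<^sub>R (2 * \<i> * \<Omega> z)) \<in> borel_measurable borel"
    using borel_measurable_times[OF borel_measurable_const[of "2 * \<i>"] \<Omega>_meas] by (simp add: mult.commute)
  note U = unfolding_integral[OF countable_G F(1) tile Q_int sumQ meas2]
  have eq: "(\<lambda>z. indicator F z *\<^sub>R (2 * \<i> * \<Omega> z)) = (\<lambda>z. 2 * \<i> * (indicator F z *\<^sub>R \<Omega> z))"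
    by auto
  have "integrable hyp_measure (\<lambda>z. 2 * \<i> * (indicator F z *\<^sub>R \<Omega> z))" using U(1) unfolding eq .
  then have "integrable hyp_measure (\<lambda>z. 1 / (2 * \<i>) * (2 * \<i> * (indicator F z *\<^sub>R \<Omega> z)))"
    by (rule integrable_mult_right)
  moreover have "1 / (2 * \<i>) * (2 * \<i> * w) = w" for w by simp
  ultimately show "integrable hyp_measure (\<lambda>z. indicator F z *\<^sub>R (of_real ((Im z)\<^sup>2) * B z))"
    by (simp only: \<Omega>_def)
  show "straight_integral f = 2 * \<i> * (LINT z|hyp_measure. indicator F z *\<^sub>R (of_real ((Im z)\<^sup>2) * B z))"
    using U(2) unfolding eq Q_val integral_mult_right_zero by (simp add: \<Omega>_def)
qed

end

section \<open>Goldman form and periods\<close>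

definition cnj_mat :: "complex^'n^'n \<Rightarrow> complex^'n^'n" where
  "cnj_mat A = (\<chi> i j. cnj (A $ i $ j))"

lemma cnj_mat_nth [simp]: "cnj_mat A $ i $ j = cnj (A $ i $ j)"
  by (simp add: cnj_mat_def)

lemma cnj_mat_mult: "cnj_mat (A ** B) = cnj_mat A ** cnj_mat B"
  by (simp add: vec_eq_iff matrix_matrix_mult_def cnj_sum)

lemma cnj_mat_add: "cnj_mat (A + B) = cnj_mat A + cnj_mat B"
  by (simp add: vec_eq_iff)

lemma cnj_mat_cnj_mat [simp]: "cnj_mat (cnj_mat A) = A"
  by (simp add: vec_eq_iff)

lemma cnj_mat_1: "cnj_mat (mat 1) = mat 1"
  by (simp add: vec_eq_iff mat_def)

lemma invertible_cnj_mat: "invertible A \<Longrightarrow> invertible (cnj_mat A)"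
  by (metis cnj_mat_mult cnj_mat_1 invertible_def)

lemma matrix_inv_cnj_mat: "invertible A \<Longrightarrow> matrix_inv (cnj_mat A) = cnj_mat (matrix_inv A)"
  by (rule matrix_inv_unique)
    (simp_all add: cnj_mat_mult[symmetric] matrix_inv_left matrix_inv_right cnj_mat_1)

lemma cnj_mat_Ad: "invertible S \<Longrightarrow> cnj_mat (Ad S X) = Ad (cnj_mat S) (cnj_mat X)"
  by (simp add: Ad_def cnj_mat_mult matrix_inv_cnj_mat)

lemma trace_cnj_mat: "trace (cnj_mat A) = cnj (trace A)"
  by (simp add: trace_def cnj_sum)

lemma mat_adj_eq: "mat_adj A = transpose (cnj_mat A)"
  by (simp add: mat_adj_def transpose_def vec_eq_iff)

lemma unitary_matrix_inv: "unitary_mat U \<Longrightarrow> matrix_inv U = mat_adj U"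
  by (rule matrix_inv_unique) (simp_all add: unitary_mat_def)

lemma mat_adj_mult: "mat_adj (A ** B) = mat_adj B ** mat_adj A"
  by (simp add: mat_adj_eq cnj_mat_mult matrix_transpose_mul)

lemma mat_adj_mat_adj [simp]: "mat_adj (mat_adj A) = A"
  by (simp add: mat_adj_def vec_eq_iff)

text \<open>For unitary matrices the inverse is the adjoint. This is what makes the adjoint of a
  period a cocycle for the same representation.\<close>

lemma mat_adj_Ad: "unitary_mat U \<Longrightarrow> mat_adj (Ad U X) = Ad U (mat_adj X)"
  by (simp add: Ad_def unitary_matrix_inv mat_adj_mult matrix_mul_assoc)

lemma mat_adj_add: "mat_adj (A + B) = mat_adj A + mat_adj B"
  by (simp add: vec_eq_iff mat_adj_def)

lemma scal_mat_nth [simp]: "scal_mat c A $ i $ j = c * A $ i $ j"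
  by (simp add: scal_mat_def)

lemma Ad_nth: "Ad S X $ i $ j = (\<Sum>l\<in>UNIV. (\<Sum>k\<in>UNIV. S $ i $ k * X $ k $ l) * matrix_inv S $ l $ j)"
  by (simp add: Ad_def matrix_matrix_mult_def)

context fundamental_polygon
begin

text \<open>The integrand tr(\<Phi> \<nu>) changes under \<gamma> by the closed form tr(\<chi>1(\<gamma>) Ad(\<gamma>) \<nu>), so paired edges
  leave exactly the terms of the Goldman form, up to a coboundary coming from the base point p.\<close>
theorem straight_integral_eq_goldman_form:
  fixes \<sigma> :: "'a \<Rightarrow> complex^'n^'n" and \<Phi> \<nu> N :: "complex \<Rightarrow> complex^'n^'n"
  assumes rep: "mat_representation G \<sigma>"
    and \<Phi>: "\<And>\<gamma> z. \<gamma> \<in> carrier G \<Longrightarrow> z \<in> HH \<Longrightarrow> \<Phi> (act \<gamma> z) = \<chi>1 \<gamma> + Ad (\<sigma> \<gamma>) (\<Phi> z)"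
    and \<nu>: "\<And>\<gamma> z. \<gamma> \<in> carrier G \<Longrightarrow> z \<in> HH \<Longrightarrow> scal_mat (deriv (act \<gamma>) z) (\<nu> (act \<gamma> z)) = Ad (\<sigma> \<gamma>) (\<nu> z)"
    and N: "\<And>\<gamma> z. \<gamma> \<in> carrier G \<Longrightarrow> z \<in> HH \<Longrightarrow> N (act \<gamma> z) = \<chi>2 \<gamma> + Ad (\<sigma> \<gamma>) (N z)"
    and N_der: "\<And>i j z. z \<in> HH \<Longrightarrow> ((\<lambda>z. N z $ i $ j) has_field_derivative \<nu> z $ i $ j) (at z)"
    and \<Phi>_cont: "\<And>i j. continuous_on HH (\<lambda>z. \<Phi> z $ i $ j)"
    and \<nu>_cont: "\<And>i j. continuous_on HH (\<lambda>z. \<nu> z $ i $ j)"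
  shows "straight_integral (\<lambda>z. trace (\<Phi> z ** \<nu> z)) = goldman_form G g a b \<sigma> \<chi>1 \<chi>2"
proof -
  interpret surface_rep G g a b \<sigma>
    by unfold_locales (rule rep)
  \<comment> \<open>Evaluating \<Phi> at the point \<open>p\<close> moved by \<gamma> \<delta>, in
    one step and in two, yields the cocycle rule.\<close>
  have cocycle: "\<chi>1 (\<gamma> \<otimes> \<delta>) = \<chi>1 \<gamma> + Ad (\<sigma> \<gamma>) (\<chi>1 \<delta>)" if gd: "\<gamma> \<in> carrier G" "\<delta> \<in> carrier G" for \<gamma> \<delta>
  proof -
    have "\<chi>1 (\<gamma> \<otimes> \<delta>) + Ad (\<sigma> (\<gamma> \<otimes> \<delta>)) (\<Phi> p) = \<Phi> (act \<gamma> (act \<delta> p))"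
      using \<Phi>[of "\<gamma> \<otimes> \<delta>" p] gd p by (simp add: act_mult)
    also have "\<dots> = \<chi>1 \<gamma> + Ad (\<sigma> \<gamma>) (\<chi>1 \<delta> + Ad (\<sigma> \<delta>) (\<Phi> p))"
      using gd p by (simp add: \<Phi> act_HH)
    finally show ?thesis by (simp add: Ad_add Ad_rep_mult[OF gd] add.assoc[symmetric])
  qed
  define f where "f = (\<lambda>z. trace (\<Phi> z ** \<nu> z))"
  have tr_cont: "continuous_on HH (\<lambda>z. trace (X z ** \<nu> z))"
    if "\<And>i j. continuous_on HH (\<lambda>z. X z $ i $ j)" for X :: "complex \<Rightarrow> complex^'n^'n"
    unfolding trace_def matrix_matrix_mult_def by (simp, intro continuous_intros that \<nu>_cont)
  have edge_int: "contour_integral (linepath p (act \<delta> p)) (pull f \<gamma>) =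
      contour_integral (linepath p (act \<delta> p)) f +
        (trace (\<chi>1 \<gamma> ** Ad (\<sigma> \<gamma>) (\<chi>2 \<delta>)) + trace (\<chi>1 \<gamma> ** Ad (\<sigma> \<gamma>) (Ad (\<sigma> \<delta>) (N p) - N p)))"
    if gd: "\<gamma> \<in> carrier G" "\<delta> \<in> carrier G" for \<gamma> \<delta>
  proof -
    let ?l = "linepath p (act \<delta> p)"
    have q: "act \<delta> p \<in> HH" using gd p by (simp add: act_HH)
    have seg: "closed_segment p (act \<delta> p) \<subseteq> HH" by (rule closed_segment_subset[OF p q convex_HH])
    have inv: "invertible (\<sigma> \<gamma>)" by (rule rep_inv[OF gd(1)])
    have trC: "trace (\<chi>1 \<gamma> ** Ad (\<sigma> \<gamma>) Y) = (\<Sum>i\<in>UNIV. \<Sum>j\<in>UNIV. (matrix_inv (\<sigma> \<gamma>) ** \<chi>1 \<gamma> ** \<sigma> \<gamma>) $ i $ j * Y $ j $ i)" for Y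
    proof -
      have "trace (\<chi>1 \<gamma> ** Ad (\<sigma> \<gamma>) Y) = trace ((\<chi>1 \<gamma> ** \<sigma> \<gamma> ** Y) ** matrix_inv (\<sigma> \<gamma>))"
        by (simp add: Ad_def matrix_mul_assoc)
      also have "\<dots> = trace ((matrix_inv (\<sigma> \<gamma>) ** \<chi>1 \<gamma> ** \<sigma> \<gamma>) ** Y)"
        by (subst trace_mul_sym) (simp add: matrix_mul_assoc)
      finally show ?thesis by (simp add: trace_def matrix_matrix_mult_def)
    qed
    have f_act: "f (act \<gamma> z) * deriv (act \<gamma>) z = f z + trace (\<chi>1 \<gamma> ** Ad (\<sigma> \<gamma>) (\<nu> z))" if z: "z \<in> HH" for z
    proof -
      have "f (act \<gamma> z) * deriv (act \<gamma>) z = trace (\<Phi> (act \<gamma> z) ** scal_mat (deriv (act \<gamma>) z) (\<nu> (act \<gamma> z)))"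
        unfolding f_def trace_def matrix_matrix_mult_def by (simp add: sum_distrib_left mult_ac)
      also have "\<dots> = trace (\<chi>1 \<gamma> ** Ad (\<sigma> \<gamma>) (\<nu> z)) + trace (Ad (\<sigma> \<gamma>) (\<Phi> z) ** Ad (\<sigma> \<gamma>) (\<nu> z))"
        unfolding \<nu>[OF gd(1) z] \<Phi>[OF gd(1) z] matrix_mult_add_left trace_add ..
      also have "trace (Ad (\<sigma> \<gamma>) (\<Phi> z) ** Ad (\<sigma> \<gamma>) (\<nu> z)) = f z"
        unfolding f_def by (rule trace_Ad[OF inv])
      finally show ?thesis by simp
    qed
    have h: "(\<lambda>z. trace (\<chi>1 \<gamma> ** Ad (\<sigma> \<gamma>) (\<nu> z))) = (\<lambda>z. \<Sum>i\<in>UNIV. \<Sum>j\<in>UNIV. (matrix_inv (\<sigma> \<gamma>) ** \<chi>1 \<gamma> ** \<sigma> \<gamma>) $ i $ j * \<nu> z $ j $ i)"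
      by (rule ext) (rule trC)
    have "((\<lambda>z. \<Sum>i\<in>UNIV. \<Sum>j\<in>UNIV. (matrix_inv (\<sigma> \<gamma>) ** \<chi>1 \<gamma> ** \<sigma> \<gamma>) $ i $ j * \<nu> z $ j $ i) has_contour_integral
        (\<Sum>i\<in>UNIV. \<Sum>j\<in>UNIV. (matrix_inv (\<sigma> \<gamma>) ** \<chi>1 \<gamma> ** \<sigma> \<gamma>) $ i $ j * (N (act \<delta> p) - N p) $ j $ i)) ?l"
    proof (intro has_contour_integral_sum has_contour_integral_lmul finite)
      fix i j
      have "((\<lambda>z. \<nu> z $ j $ i) has_contour_integral N (pathfinish ?l) $ j $ i - N (pathstart ?l) $ j $ i) ?l"
        by (rule contour_integral_primitive[where S = HH])
          (use seg in \<open>auto intro: has_field_derivative_at_within N_der\<close>)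
      then show "((\<lambda>z. \<nu> z $ j $ i) has_contour_integral (N (act \<delta> p) - N p) $ j $ i) ?l" by simp
    qed
    then have int2: "((\<lambda>z. trace (\<chi>1 \<gamma> ** Ad (\<sigma> \<gamma>) (\<nu> z))) has_contour_integral
        trace (\<chi>1 \<gamma> ** Ad (\<sigma> \<gamma>) (N (act \<delta> p) - N p))) ?l"
      unfolding h trC .
    have int1: "(f has_contour_integral contour_integral ?l f) ?l"
      unfolding f_def
      by (intro has_contour_integral_integral contour_integrable_continuous_linepath continuous_on_subset[OF tr_cont seg] \<Phi>_cont)
    have "contour_integral ?l (pull f \<gamma>) =
        contour_integral ?l (\<lambda>z. f z + trace (\<chi>1 \<gamma> ** Ad (\<sigma> \<gamma>) (\<nu> z)))"
      by (rule contour_integral_eq) (use seg f_act in auto)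
    also have "\<dots> = contour_integral ?l f + trace (\<chi>1 \<gamma> ** Ad (\<sigma> \<gamma>) (N (act \<delta> p) - N p))"
      by (rule contour_integral_unique[OF has_contour_integral_add[OF int1 int2]])
    \<comment> \<open>Increments of \<open>N\<close> starting at \<open>p\<close> agree with \<chi>2
      up to the coboundary of \<open>N p\<close>, which the polygon sum annihilates.\<close>
    also have "N (act \<delta> p) - N p = \<chi>2 \<delta> + (Ad (\<sigma> \<delta>) (N p) - N p)"
      using N[OF gd(2) p] by simp
    also have "trace (\<chi>1 \<gamma> ** Ad (\<sigma> \<gamma>) (\<chi>2 \<delta> + (Ad (\<sigma> \<delta>) (N p) - N p))) =
      trace (\<chi>1 \<gamma> ** Ad (\<sigma> \<gamma>) (\<chi>2 \<delta>)) + trace (\<chi>1 \<gamma> ** Ad (\<sigma> \<gamma>) (Ad (\<sigma> \<delta>) (N p) - N p))"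
      unfolding Ad_add matrix_mult_add_right trace_add ..
    finally show ?thesis .
  qed
  have "straight_integral f = psum
      (\<lambda>k \<gamma>. contour_integral (la k) f +
        (trace (\<chi>1 \<gamma> ** Ad (\<sigma> \<gamma>) (\<chi>2 (a k))) + trace (\<chi>1 \<gamma> ** Ad (\<sigma> \<gamma>) (Ad (\<sigma> (a k)) (N p) - N p))))
      (\<lambda>k \<gamma>. contour_integral (lb k) f +
        (trace (\<chi>1 \<gamma> ** Ad (\<sigma> \<gamma>) (\<chi>2 (b k))) + trace (\<chi>1 \<gamma> ** Ad (\<sigma> \<gamma>) (Ad (\<sigma> (b k)) (N p) - N p))))"
    unfolding straight_integral_def la_def lb_def
    by (rule polygon_sum_cong) (rule edge_int[OF vertices_carrier a_closed] edge_int[OF vertices_carrier b_closed]; assumption)+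
  also have "\<dots> = psum (\<lambda>k \<gamma>. trace (\<chi>1 \<gamma> ** Ad (\<sigma> \<gamma>) (\<chi>2 (a k)))) (\<lambda>k \<gamma>. trace (\<chi>1 \<gamma> ** Ad (\<sigma> \<gamma>) (\<chi>2 (b k))))"
    using coboundary_polygon_sum[OF cocycle, of "N p"] by (simp only: polygon_sum_add polygon_sum_const) simp
  also have "\<dots> = goldman_form G g a b \<sigma> \<chi>1 \<chi>2"
    by (rule goldman_form_eq_polygon_sum[OF cocycle, symmetric])
  finally show ?thesis by (simp add: f_def)
qed

end

section \<open>Equivariant primitives and Borel fundamental sets\<close>

lemma linepath_primitive:
  assumes f: "f holomorphic_on HH" and z0: "z0 \<in> HH" and z: "z \<in> HH"
  shows "((\<lambda>z. contour_integral (linepath z0 z) f) has_field_derivative f z) (at z)"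
proof -
  obtain P where P: "\<And>z. z \<in> HH \<Longrightarrow> (P has_field_derivative f z) (at z within HH)"
    using holomorphic_convex_primitive'[OF convex_HH open_HH f] by blast
  have eq: "contour_integral (linepath z0 w) f = P w - P z0" if "w \<in> HH" for w
    using contour_integral_primitive[OF P valid_path_linepath, of z0 w] closed_segment_subset[OF z0 that convex_HH]
    by (simp add: contour_integral_unique)
  have "((\<lambda>w. P w - P z0) has_field_derivative f z - 0) (at z)"
    by (rule DERIV_diff) (use P[OF z] at_within_open[OF z open_HH] in auto)
  then have "((\<lambda>w. P w - P z0) has_field_derivative f z) (at z)" by simp
  then show ?thesis
    by (rule has_field_derivative_transform_within_open[OF _ open_HH z]) (simp add: eq)
qed

context fuchsian
begin

text \<open>\<open>P\<close> after \<open>act \<gamma>\<close> and \<open>Ad S\<close> applied to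
  \<open>P\<close> have the same derivative, so they differ by a constant on the convex half plane;
  it is read off at \<open>z0\<close>, where \<open>P\<close> vanishes.\<close>

lemma equivariant_primitive:
  fixes S :: "complex^'n^'n" and h P :: "complex \<Rightarrow> complex^'n^'n"
  assumes g: "\<gamma> \<in> carrier G"
    and h: "\<And>z. z \<in> HH \<Longrightarrow> scal_mat (deriv (act \<gamma>) z) (h (act \<gamma> z)) = Ad S (h z)"
    and P: "\<And>i j z. z \<in> HH \<Longrightarrow> ((\<lambda>z. P z $ i $ j) has_field_derivative h z $ i $ j) (at z)"
    and z0: "z0 \<in> HH" "P z0 = 0" and z: "z \<in> HH"
  shows "P (act \<gamma> z) = P (act \<gamma> z0) + Ad S (P z)"
proof -
  have "P (act \<gamma> z) $ i $ j - Ad S (P z) $ i $ j = P (act \<gamma> z0) $ i $ j - Ad S (P z0) $ i $ j" for i j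
  proof -
    define D where "D = (\<lambda>z. P (act \<gamma> z) $ i $ j - Ad S (P z) $ i $ j)"
    have "(D has_field_derivative 0) (at w within HH)" if w: "w \<in> HH" for w
    proof -
      have "((\<lambda>z. P (act \<gamma> z) $ i $ j) has_field_derivative h (act \<gamma> w) $ i $ j * deriv (act \<gamma>) w) (at w)"
        by (rule DERIV_chain2[OF P[OF act_HH[OF g w]] act_has_deriv[OF g w]])
      moreover have "((\<lambda>z. Ad S (P z) $ i $ j) has_field_derivative Ad S (h w) $ i $ j) (at w)"
        unfolding Ad_nth by (intro DERIV_sum DERIV_cmult DERIV_cmult_right P w)
      ultimately have "(D has_field_derivative h (act \<gamma> w) $ i $ j * deriv (act \<gamma>) w - Ad S (h w) $ i $ j) (at w)"
        unfolding D_def by (rule DERIV_diff)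
      moreover have "h (act \<gamma> w) $ i $ j * deriv (act \<gamma>) w = Ad S (h w) $ i $ j"
        using h[OF w] by (metis mult.commute scal_mat_nth)
      ultimately show ?thesis by (simp add: has_field_derivative_at_within)
    qed
    then have "D z = D z0"
      using has_field_derivative_zero_constant[OF convex_HH] z z0(1) by metis
    then show ?thesis by (simp add: D_def)
  qed
  moreover have "Ad S (P z0) = 0" by (simp add: z0(2) Ad_def vec_eq_iff matrix_matrix_mult_def)
  ultimately show ?thesis by (simp add: vec_eq_iff algebra_simps)
qed

text \<open>Unfolding works with Borel sets, so a null part \<open>N\<close> is removed from the
  Lebesgue measurable \<open>F\<close>. Since the group is countable, almost every orbit avoids
  \<open>N\<close> and all overlaps of translates, and then meets \<open>S\<close> exactly
  once.\<close>

lemma fundamental_domain_tiles: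
  assumes countable: "countable (carrier G)" and F: "fundamental_domain G act F"
  obtains S where "S \<in> sets borel" "S \<subseteq> F" "negligible (F - S)"
    "AE z in hyp_measure. \<exists>!\<gamma>. \<gamma> \<in> carrier G \<and> act \<gamma> z \<in> S"
proof -
  have FH: "F \<subseteq> HH" and Fm: "F \<in> sets lebesgue" and cov: "(\<Union>\<gamma>\<in>carrier G. act \<gamma> ` F) = HH"
    and ov: "\<And>\<gamma> \<delta>. \<gamma> \<in> carrier G \<Longrightarrow> \<delta> \<in> carrier G \<Longrightarrow> \<gamma> \<noteq> \<delta> \<Longrightarrow> act \<gamma> ` F \<inter> act \<delta> ` F \<in> null_sets lebesgue"
    using F by (simp_all add: fundamental_domain_def)
  obtain S N N' where SN: "F = S \<union> N" "N \<subseteq> N'" "N' \<in> null_sets lborel" "S \<in> sets lborel"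
    using sets_completionE[OF Fm] by metis
  have neg: "negligible N"
    using SN(2,3) by (meson negligible_iff_null_sets negligible_subset null_sets_completionI)
  have "AE z in hyp_measure. z \<notin> N"
    unfolding AE_hyp_measure_iff using negligible_imp_AE_lborel[OF neg] by eventually_elim simp
  then have a1: "AE z in hyp_measure. \<forall>\<gamma>\<in>carrier G. act \<gamma> z \<notin> N"
    by (subst AE_ball_countable[OF countable]) (intro ballI AE_hyp_measure_act[where P = "\<lambda>z. z \<notin> N"])
  have "AE z in hyp_measure. \<forall>\<gamma>\<in>carrier G. \<forall>\<delta>\<in>carrier G. \<gamma> \<noteq> \<delta> \<longrightarrow> z \<notin> act \<gamma> ` F \<inter> act \<delta> ` F"
  proof (subst AE_ball_countable[OF countable], intro ballI, subst AE_ball_countable[OF countable], intro ballI)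
    fix \<gamma> \<delta> assume gd: "\<gamma> \<in> carrier G" "\<delta> \<in> carrier G"
    show "AE z in hyp_measure. \<gamma> \<noteq> \<delta> \<longrightarrow> z \<notin> act \<gamma> ` F \<inter> act \<delta> ` F"
    proof (cases "\<gamma> = \<delta>")
      case False
      then have "negligible (act \<gamma> ` F \<inter> act \<delta> ` F)"
        using ov[OF gd] by (simp add: negligible_iff_null_sets)
      from negligible_imp_AE_lborel[OF this] show ?thesis
        unfolding AE_hyp_measure_iff by eventually_elim simp
    qed simp
  qed
  then have "AE z in hyp_measure. \<exists>!\<gamma>. \<gamma> \<in> carrier G \<and> act \<gamma> z \<in> S"
    using a1 AE_hyp_measure_HH
  proof eventually_elim
    fix z assume u: "\<forall>\<gamma>\<in>carrier G. \<forall>\<delta>\<in>carrier G. \<gamma> \<noteq> \<delta> \<longrightarrow> z \<notin> act \<gamma> ` F \<inter> act \<delta> ` F"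
      and n: "\<forall>\<gamma>\<in>carrier G. act \<gamma> z \<notin> N" and z: "z \<in> HH"
    obtain \<gamma> w where gw: "\<gamma> \<in> carrier G" "w \<in> F" "z = act \<gamma> w" using cov z by blast
    have w: "act (inv \<gamma>) z = w" using gw FH by (auto simp: act_inv)
    show "\<exists>!\<gamma>. \<gamma> \<in> carrier G \<and> act \<gamma> z \<in> S"
    proof (rule ex1I[of _ "inv \<gamma>"])
      have "act (inv \<gamma>) z \<notin> N" using n gw(1) inv_closed by blast
      then show "inv \<gamma> \<in> carrier G \<and> act (inv \<gamma>) z \<in> S"
        using gw w SN(1) by auto
      fix \<delta> assume d: "\<delta> \<in> carrier G \<and> act \<delta> z \<in> S"
      then have "z \<in> act (inv \<delta>) ` F" using SN(1) act_inv[of \<delta> z] z by (metis UnCI imageI)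
      moreover have "z \<in> act \<gamma> ` F" using gw by blast
      ultimately have "inv \<delta> = \<gamma>" using u d gw(1) inv_closed by blast
      then show "\<delta> = inv \<gamma>" using d by auto
    qed
  qed
  moreover have "negligible (F - S)" by (rule negligible_subset[OF neg]) (use SN in auto)
  ultimately show ?thesis using that[of S] SN by auto
qed

end

text \<open>Lets the pairing of two antiholomorphic periods be computed from holomorphic integrands
  and the conjugate representation.\<close>

lemma goldman_form_cnj_mat:
  assumes "\<And>k. k \<le> g \<Longrightarrow> invertible (\<sigma> (comm_prod G a b k))"
  shows "goldman_form G g a b (\<lambda>\<gamma>. cnj_mat (\<sigma> \<gamma>)) (\<lambda>\<gamma>. cnj_mat (\<chi>1 \<gamma>)) (\<lambda>\<gamma>. cnj_mat (\<chi>2 \<gamma>)) =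
    cnj (goldman_form G g a b \<sigma> \<chi>1 \<chi>2)"
  unfolding goldman_form_def Let_def cnj_sum
  by (rule sum.cong[OF refl])
    (auto simp: matrix_inv_cnj_mat assms cnj_mat_mult[symmetric] trace_cnj_mat)

section \<open>Harmonic forms, their primitives and periods\<close>

lemma trace_mult_mat_adj: "trace (A ** mat_adj B) = (\<Sum>i\<in>UNIV. \<Sum>k\<in>UNIV. A $ i $ k * cnj (B $ i $ k))"
  by (simp add: trace_def matrix_matrix_mult_def mat_adj_def)

text \<open>The conjugate of the antiholomorphic primitive of \<mu> that vanishes at
  \<open>z0\<close>. Conjugating makes it holomorphic, so the calculus of contour integrals applies
  directly.\<close>

definition holo_primitive :: "complex \<Rightarrow> (complex \<Rightarrow> complex^'n^'n) \<Rightarrow> complex \<Rightarrow> complex^'n^'n" where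
  "holo_primitive z0 \<mu> z = (\<chi> i j. contour_integral (linepath z0 z) (\<lambda>w. cnj (\<mu> w $ i $ j)))"

lemma es_period_eq: "es_period act z0 \<mu> \<gamma> = cnj_mat (holo_primitive z0 \<mu> (act \<gamma> z0))"
  by (simp add: es_period_def holo_primitive_def vec_eq_iff)

lemma holo_primitive_base: "holo_primitive z0 \<mu> z0 = 0"
  by (simp add: holo_primitive_def vec_eq_iff)

locale harmonic_form = fuchsian +
  fixes \<rho> :: "'a \<Rightarrow> complex^'n^'n" and z0 :: complex and \<mu> :: "complex \<Rightarrow> complex^'n^'n"
  assumes z0: "z0 \<in> HH" and rho: "unitary_representation G \<rho>" and harm: "harmonic_01 G act \<rho> \<mu>"
begin

abbreviation "\<Psi> \<equiv> holo_primitive z0 \<mu>"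

lemma rho_unitary: "\<gamma> \<in> carrier G \<Longrightarrow> unitary_mat (\<rho> \<gamma>)"
  and rho_rep: "mat_representation G \<rho>"
  and rho_invertible: "\<gamma> \<in> carrier G \<Longrightarrow> invertible (\<rho> \<gamma>)"
  using rho by (auto simp: unitary_representation_def mat_representation_def)

lemma cnj_rep: "mat_representation G (\<lambda>\<gamma>. cnj_mat (\<rho> \<gamma>))"
  using rho_rep by (auto simp: mat_representation_def invertible_cnj_mat cnj_mat_mult)

lemma mu_holo: "(\<lambda>z. cnj (\<mu> z $ i $ j)) holomorphic_on HH"
  using harm by (simp add: harmonic_01_def)

lemma mu_equiv: "\<gamma> \<in> carrier G \<Longrightarrow> z \<in> HH \<Longrightarrow>
    scal_mat (cnj (deriv (act \<gamma>) z)) (\<mu> (act \<gamma> z)) = Ad (\<rho> \<gamma>) (\<mu> z)"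
  using harm by (simp add: harmonic_01_def Ad_def)

lemma cnj_mu_equiv:
  assumes "\<gamma> \<in> carrier G" "z \<in> HH"
  shows "scal_mat (deriv (act \<gamma>) z) (cnj_mat (\<mu> (act \<gamma> z))) = Ad (cnj_mat (\<rho> \<gamma>)) (cnj_mat (\<mu> z))"
proof -
  have "scal_mat (deriv (act \<gamma>) z) (cnj_mat (\<mu> (act \<gamma> z))) = cnj_mat (scal_mat (cnj (deriv (act \<gamma>) z)) (\<mu> (act \<gamma> z)))"
    by (simp add: vec_eq_iff)
  then show ?thesis by (simp add: mu_equiv[OF assms] cnj_mat_Ad rho_invertible[OF assms(1)])
qed

lemma adj_mu_equiv:
  assumes "\<gamma> \<in> carrier G" "z \<in> HH"
  shows "scal_mat (deriv (act \<gamma>) z) (mat_adj (\<mu> (act \<gamma> z))) = Ad (\<rho> \<gamma>) (mat_adj (\<mu> z))"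
proof -
  have "scal_mat (deriv (act \<gamma>) z) (mat_adj (\<mu> (act \<gamma> z))) = mat_adj (scal_mat (cnj (deriv (act \<gamma>) z)) (\<mu> (act \<gamma> z)))"
    by (simp add: vec_eq_iff mat_adj_def)
  then show ?thesis by (simp add: mu_equiv[OF assms] mat_adj_Ad rho_unitary[OF assms(1)])
qed

lemma \<Psi>_deriv:
  assumes "z \<in> HH"
  shows "((\<lambda>z. \<Psi> z $ i $ j) has_field_derivative cnj (\<mu> z $ i $ j)) (at z)"
  unfolding holo_primitive_def using linepath_primitive[OF mu_holo z0 assms] by simp

lemma \<Psi>_holo: "(\<lambda>z. \<Psi> z $ i $ j) holomorphic_on HH"
  unfolding holomorphic_on_open[OF open_HH] using \<Psi>_deriv by blast

lemma \<Psi>_equiv: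
  assumes "\<gamma> \<in> carrier G" "z \<in> HH"
  shows "\<Psi> (act \<gamma> z) = \<Psi> (act \<gamma> z0) + Ad (cnj_mat (\<rho> \<gamma>)) (\<Psi> z)"
  by (rule equivariant_primitive[OF assms(1) cnj_mu_equiv[OF assms(1)] _ z0 holo_primitive_base assms(2)])
    (simp_all add: \<Psi>_deriv)

lemma \<Phi>_equiv:
  assumes "\<gamma> \<in> carrier G" "z \<in> HH"
  shows "cnj_mat (\<Psi> (act \<gamma> z)) = es_period act z0 \<mu> \<gamma> + Ad (\<rho> \<gamma>) (cnj_mat (\<Psi> z))"
proof -
  have "cnj_mat (\<Psi> (act \<gamma> z)) = es_period act z0 \<mu> \<gamma> + cnj_mat (Ad (cnj_mat (\<rho> \<gamma>)) (\<Psi> z))"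
    unfolding \<Psi>_equiv[OF assms] cnj_mat_add es_period_eq ..
  then show ?thesis by (simp add: cnj_mat_Ad invertible_cnj_mat rho_invertible[OF assms(1)])
qed

end

text \<open>Under \<gamma> the trace loses the factor |\<gamma>'(z)|^2, which the square of the
  height gains; hence the Hodge integrand defines an invariant measure.\<close>

lemma (in fuchsian) trace_form_invariant:
  fixes \<rho> :: "'g \<Rightarrow> complex^'n^'n"
  assumes "harmonic_form G act \<rho> z0 \<mu>1" "harmonic_form G act \<rho> z0 \<mu>2" "\<gamma> \<in> carrier G" "z \<in> HH"
  shows "of_real ((Im (act \<gamma> z))\<^sup>2) * trace (\<mu>1 (act \<gamma> z) ** mat_adj (\<mu>2 (act \<gamma> z))) =
    of_real ((Im z)\<^sup>2) * trace (\<mu>1 z ** mat_adj (\<mu>2 z))"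
proof -
  interpret m1: harmonic_form G act \<rho> z0 \<mu>1 by (rule assms(1))
  interpret m2: harmonic_form G act \<rho> z0 \<mu>2 by (rule assms(2))
  let ?d = "deriv (act \<gamma>) z"
  have "cnj ?d * ?d * trace (\<mu>1 (act \<gamma> z) ** mat_adj (\<mu>2 (act \<gamma> z))) =
      trace (scal_mat (cnj ?d) (\<mu>1 (act \<gamma> z)) ** scal_mat ?d (mat_adj (\<mu>2 (act \<gamma> z))))"
    unfolding trace_def matrix_matrix_mult_def by (simp add: sum_distrib_left mult_ac)
  also have "\<dots> = trace (\<mu>1 z ** mat_adj (\<mu>2 z))"
    unfolding m1.mu_equiv[OF assms(3,4)] m2.adj_mu_equiv[OF assms(3,4)]
    by (rule trace_Ad[OF m1.rho_invertible[OF assms(3)]])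
  finally have tr: "cnj ?d * ?d * trace (\<mu>1 (act \<gamma> z) ** mat_adj (\<mu>2 (act \<gamma> z))) = trace (\<mu>1 z ** mat_adj (\<mu>2 z))" .
  have "Im (act \<gamma> z) = norm ?d * Im z"
    using real_moebius_norm_deriv[OF moebius[OF assms(3)] assms(4)] by simp
  then have "of_real ((Im (act \<gamma> z))\<^sup>2) = of_real ((Im z)\<^sup>2) * (of_real ((norm ?d)\<^sup>2) :: complex)"
    by (simp add: power_mult_distrib)
  also have "of_real ((norm ?d)\<^sup>2) = cnj ?d * ?d"
    by (subst complex_norm_square) (rule mult.commute)
  finally show ?thesis by (simp only: mult.assoc flip: tr)
qed

text \<open>The coefficients of \<open>t\<close> and \<open>cnj t\<close> are the two Wirtinger
  derivatives: d-bar falls only on the conjugated factor.\<close>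

lemma has_derivative_cnj_mult:
  fixes P h :: "complex \<Rightarrow> complex"
  assumes "(P has_field_derivative P') (at z)" "(h has_field_derivative h') (at z)"
  shows "((\<lambda>z. cnj (P z) * h z) has_derivative (\<lambda>t. (cnj (P z) * h') * t + (cnj P' * h z) * cnj t)) (at z)"
proof -
  have "((\<lambda>z. cnj (P z)) has_derivative (\<lambda>t. cnj (P' * t))) (at z)"
    using assms(1) unfolding has_field_derivative_def by (rule has_derivative_cnj)
  from has_derivative_mult[OF this assms(2)[unfolded has_field_derivative_def]]
  show ?thesis by (simp add: algebra_simps)
qed

theorem theorem1:
  fixes G :: "('g, 'm) monoid_scheme"
    and act :: "'g \<Rightarrow> complex \<Rightarrow> complex"
    and g :: nat and a b :: "nat \<Rightarrow> 'g"
    and z0 :: complex and F :: "complex set"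
    and \<rho> :: "'g \<Rightarrow> complex^'n^'n"
    and \<mu>1 \<mu>2 :: "complex \<Rightarrow> complex^'n^'n"
  assumes "fuchsian_action G act"
    and "g > 1"
    and "standard_generators G act g a b"
    and "z0 \<in> upper_half_plane"
    and "fundamental_domain G act F"
    and "unitary_representation G \<rho>"
    and "irreducible_rep G \<rho>"
    and "harmonic_01 G act \<rho> \<mu>1"
    and "harmonic_01 G act \<rho> \<mu>2"
  shows "goldman_form G g a b \<rho> (es_period act z0 \<mu>1) (\<lambda>\<gamma>. mat_adj (es_period act z0 \<mu>2 \<gamma>))
           = \<i> * hodge_ip F \<mu>1 \<mu>2 \<and>
         goldman_form G g a b \<rho> (es_period act z0 \<mu>1) (es_period act z0 \<mu>2) = 0"
proof -
  interpret fuchsian G act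
    using assms(1) unfolding fuchsian_action_def fuchsian_def fuchsian_axioms_def by blast
  obtain p ca cb where p: "p \<in> HH"
    and cacb: "\<forall>k\<in>{1..g}. valid_path (ca k) \<and> pathstart (ca k) = p \<and> pathfinish (ca k) = act (a k) p \<and>
       valid_path (cb k) \<and> pathstart (cb k) = p \<and> pathfinish (cb k) = act (b k) p"
    and c: "let c = polygon_edges G act a b ca cb (4 * g - 1) 0;
             U = {z. z \<notin> path_image c \<and> winding_number c z = 1} in
           simple_path c \<and> valid_path c \<and> path_image c \<subseteq> upper_half_plane \<and>
           (\<forall>z. z \<notin> path_image c \<longrightarrow> winding_number c z = 0 \<or> winding_number c z = 1) \<and>
           U \<noteq> {} \<and>
           (\<Union>\<gamma>\<in>carrier G. act \<gamma> ` (U \<union> path_image c)) = upper_half_plane \<and>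
           (\<forall>\<gamma>\<in>carrier G. \<gamma> \<noteq> \<one>\<^bsub>G\<^esub> \<longrightarrow> act \<gamma> ` U \<inter> U = {})"
    and gens: "\<forall>k\<in>{1..g}. a k \<in> carrier G \<and> b k \<in> carrier G" "comm_prod G a b g = \<one>\<^bsub>G\<^esub>"
    using assms(3) unfolding standard_generators_def by (elim conjE exE) blast
  interpret surface_polygon G g a b act p ca cb
    by unfold_locales (use p cacb gens in auto)
  interpret fundamental_polygon G g a b act p ca cb
    by unfold_locales (use c assms(2) in \<open>simp_all add: Let_def boundary_def\<close>)
  have h1: "harmonic_form G act \<rho> z0 \<mu>1" and h2: "harmonic_form G act \<rho> z0 \<mu>2"
    by (unfold_locales; use assms in simp)+
  interpret m1: harmonic_form G act \<rho> z0 \<mu>1 by (rule h1)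
  interpret m2: harmonic_form G act \<rho> z0 \<mu>2 by (rule h2)
  let ?\<Psi>1 = "holo_primitive z0 \<mu>1" and ?\<Psi>2 = "holo_primitive z0 \<mu>2"
  have cont: "continuous_on HH (\<lambda>z. cnj (\<mu>2 z $ i $ j))" "continuous_on HH (\<lambda>z. cnj (\<mu>1 z $ i $ j))"
    "continuous_on HH (\<lambda>z. ?\<Psi>1 z $ i $ j)" for i j
    by (intro holomorphic_on_imp_continuous_on m1.mu_holo m2.mu_holo m1.\<Psi>_holo)+
  have cont_mu1: "continuous_on HH (\<lambda>z. \<mu>1 z $ i $ j)" for i j
    using continuous_on_cnj[OF cont(2)[of i j]] by simp

  define f where "f = (\<lambda>z. trace (cnj_mat (?\<Psi>1 z) ** mat_adj (\<mu>2 z)))"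
  have gold1: "straight_integral f = goldman_form G g a b \<rho> (es_period act z0 \<mu>1) (\<lambda>\<gamma>. mat_adj (es_period act z0 \<mu>2 \<gamma>))"
    unfolding f_def
  \<comment> \<open>The adjoint of the conjugate of \<Psi>2 is its transpose, a holomorphic
    primitive of \<mu>2*. Under the group it changes by the adjoint periods.\<close>
  proof (rule straight_integral_eq_goldman_form[where N = "\<lambda>z. mat_adj (cnj_mat (?\<Psi>2 z))"])
    show "mat_adj (cnj_mat (?\<Psi>2 (act \<gamma> z))) = mat_adj (es_period act z0 \<mu>2 \<gamma>) + Ad (\<rho> \<gamma>) (mat_adj (cnj_mat (?\<Psi>2 z)))"
      if "\<gamma> \<in> carrier G" "z \<in> HH" for \<gamma> z
      unfolding m2.\<Phi>_equiv[OF that] mat_adj_add mat_adj_Ad[OF m2.rho_unitary[OF that(1)]] ..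
    show "((\<lambda>z. mat_adj (cnj_mat (?\<Psi>2 z)) $ i $ j) has_field_derivative mat_adj (\<mu>2 z) $ i $ j) (at z)"
      if "z \<in> HH" for i j z
      using m2.\<Psi>_deriv[OF that, of j i] by (simp add: mat_adj_def)
    show "continuous_on HH (\<lambda>z. cnj_mat (?\<Psi>1 z) $ i $ j)" for i j
      by (simp add: cont continuous_on_cnj)
    show "continuous_on HH (\<lambda>z. mat_adj (\<mu>2 z) $ i $ j)" for i j
      by (simp add: mat_adj_def cont)
  qed (use m1.rho_rep m1.\<Phi>_equiv m2.adj_mu_equiv in auto)

  \<comment> \<open>\<open>A\<close> and \<open>B\<close> are the d and d-bar derivatives of
    \<open>f\<close>. The conjugate of \<Psi>1 has d-bar derivative \<mu>1, and \<mu>2* is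
    holomorphic, so \<open>B\<close> is the Hodge integrand.\<close>
  define A where "A = (\<lambda>z. \<Sum>i\<in>UNIV. \<Sum>k\<in>UNIV. cnj (?\<Psi>1 z $ i $ k) * deriv (\<lambda>z. cnj (\<mu>2 z $ i $ k)) z)"
  define B where "B = (\<lambda>z. trace (\<mu>1 z ** mat_adj (\<mu>2 z)))"
  have f_der: "(f has_derivative (\<lambda>t. A z * t + B z * cnj t)) (at z)" if z: "z \<in> HH" for z
  proof -
    have "((\<lambda>z. \<Sum>i\<in>UNIV. \<Sum>k\<in>UNIV. cnj (?\<Psi>1 z $ i $ k) * cnj (\<mu>2 z $ i $ k)) has_derivative
        (\<lambda>t. \<Sum>i\<in>UNIV. \<Sum>k\<in>UNIV. (cnj (?\<Psi>1 z $ i $ k) * deriv (\<lambda>z. cnj (\<mu>2 z $ i $ k)) z) * t +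
          (cnj (cnj (\<mu>1 z $ i $ k)) * cnj (\<mu>2 z $ i $ k)) * cnj t)) (at z)"
      by (intro has_derivative_sum has_derivative_cnj_mult m1.\<Psi>_deriv[OF z] holomorphic_derivI[OF m2.mu_holo open_HH z])
    moreover have "(\<lambda>t. \<Sum>i\<in>UNIV. \<Sum>k\<in>UNIV. (cnj (?\<Psi>1 z $ i $ k) * deriv (\<lambda>z. cnj (\<mu>2 z $ i $ k)) z) * t +
          (cnj (cnj (\<mu>1 z $ i $ k)) * cnj (\<mu>2 z $ i $ k)) * cnj t) = (\<lambda>t. A z * t + B z * cnj t)"
      by (simp add: A_def B_def trace_mult_mat_adj sum.distrib sum_distrib_right)
    ultimately show ?thesis by (simp add: f_def trace_mult_mat_adj)
  qed
  have A_cont: "continuous_on HH A"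
    unfolding A_def
    by (intro continuous_intros continuous_on_cnj cont holomorphic_on_imp_continuous_on[OF holomorphic_deriv[OF m2.mu_holo open_HH]])
  have B_cont: "continuous_on HH B"
    unfolding B_def trace_mult_mat_adj by (intro continuous_intros cont cont_mu1)
  have B_inv: "of_real ((Im (act \<gamma> z))\<^sup>2) * B (act \<gamma> z) = of_real ((Im z)\<^sup>2) * B z"
    if "\<gamma> \<in> carrier G" "z \<in> HH" for \<gamma> z
    unfolding B_def by (rule trace_form_invariant[OF h1 h2 that])
  obtain S where S: "S \<in> sets borel" "S \<subseteq> F" "negligible (F - S)"
    "AE z in hyp_measure. \<exists>!\<gamma>. \<gamma> \<in> carrier G \<and> act \<gamma> z \<in> S"
    by (rule fundamental_domain_tiles[OF countable_G assms(5)])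
  have SH: "S \<subseteq> HH" using S(2) assms(5) by (auto simp: fundamental_domain_def)
  note Green = straight_integral_Green[OF f_der A_cont B_cont B_inv S(1) SH S(4)]
  have meas: "(\<lambda>z. indicator S z *\<^sub>R (of_real ((Im z)\<^sup>2) * B z)) \<in> borel_measurable borel"
    using borel_measurable_integrable[OF Green(1)] by simp
  \<comment> \<open>The density of the invariant measure cancels the weight and gives back the
    Lebesgue integral of \<open>B\<close>.\<close>
  have dens: "(indicator HH z / (Im z)\<^sup>2) *\<^sub>R (indicator S z *\<^sub>R (of_real ((Im z)\<^sup>2) * B z)) = indicator S z *\<^sub>R B z" for z
    using SH by (cases "z \<in> S") (auto simp: upper_half_plane_def scaleR_conv_of_real)
  have "set_integrable lborel S B"
    using Green(1) unfolding integrable_hyp_measure_iff[OF meas] dens set_integrable_def .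
  then have "(LINT z:S|lborel. B z) = integral S B" by (rule set_borel_integral_eq_integral(2))
  also have "integral S B = integral F B"
    by (rule integral_spike_set) (use S in \<open>auto intro: negligible_subset\<close>)
  finally have val: "(LINT z|lborel. indicator S z *\<^sub>R B z) = integral F B"
    by (simp only: set_lebesgue_integral_def)
  have "straight_integral f = 2 * \<i> * integral F B"
    using Green(2) unfolding integral_hyp_measure[OF meas] dens val .
  \<comment> \<open>The factor i * (-2 i) in \<open>hodge_ip\<close> equals 2, so 2 i times the area
    integral is i times the Hodge product.\<close>
  then have first: "goldman_form G g a b \<rho> (es_period act z0 \<mu>1) (\<lambda>\<gamma>. mat_adj (es_period act z0 \<mu>2 \<gamma>))
           = \<i> * hodge_ip F \<mu>1 \<mu>2"
    unfolding gold1 hodge_ip_def B_def by (simp add: algebra_simps)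

  \<comment> \<open>The conjugate of the integrand tr(\<Phi> \<mu>2) for the second pairing: a
    product of holomorphic functions, which belongs to the conjugate representation.\<close>
  define h where "h = (\<lambda>z. trace (?\<Psi>1 z ** cnj_mat (\<mu>2 z)))"
  have "straight_integral h =
      goldman_form G g a b (\<lambda>\<gamma>. cnj_mat (\<rho> \<gamma>)) (\<lambda>\<gamma>. ?\<Psi>1 (act \<gamma> z0)) (\<lambda>\<gamma>. ?\<Psi>2 (act \<gamma> z0))"
    unfolding h_def
    by (rule straight_integral_eq_goldman_form[where N = ?\<Psi>2])
      (use m1.cnj_rep m1.\<Psi>_equiv m2.\<Psi>_equiv m2.cnj_mu_equiv m2.\<Psi>_deriv cont in auto)
  also have "\<dots> = cnj (goldman_form G g a b \<rho> (es_period act z0 \<mu>1) (es_period act z0 \<mu>2))"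
    using goldman_form_cnj_mat[of g \<rho> G a b "es_period act z0 \<mu>1" "es_period act z0 \<mu>2"]
      m1.rho_invertible[OF R_closed]
    by (simp add: es_period_eq)
  finally have "cnj (goldman_form G g a b \<rho> (es_period act z0 \<mu>1) (es_period act z0 \<mu>2)) = straight_integral h" by simp
  also have "\<dots> = 0"
  proof (rule straight_integral_holomorphic[OF open_HH convex_HH _ straight_image_HH])
    show "h holomorphic_on HH"
      unfolding h_def trace_def matrix_matrix_mult_def
      by (simp, intro holomorphic_intros m1.\<Psi>_holo m2.mu_holo)
  qed
  finally show ?thesis using first by simp
qed

end
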